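(* Let $\zeta$ be a primitive aperiodic (non-periodic) substitution on the alphabet $\mathcal{A}=\{0,\ldots,d-1\}$ with $d\ge 2$, whose substitution matrix $\mathsf{S}_\zeta$ is invertible and has characteristic polynomial irreducible over $\mathbb{Q}$. Let $\theta_1$ be the Perron–Frobenius eigenvalue of $\mathsf{S}_\zeta$. If $$\chi(\mathscr{M}_\zeta)<\frac{\log\theta_1}{2},$$ then the substitution $\mathbb{Z}$-action $(X_\zeta,T,\mu)$ has pure singular spectrum.
   Context: A substitution is a map $\zeta:\mathcal{A}\to\mathcal{A}^+$ (nonempty words), extended to words by concatenation. The substitution space $X_\zeta$ is the set of $x\in\mathcal{A}^{\mathbb{Z}}$ such that every finite subword of $x$ appears as a subword of $\zeta^n(a)$ for some $a\in\mathcal{A}$, $n\in\mathbb{N}$; $T$ is the left shift restricted to $X_\zeta$, and $\mu$ is its unique invariant probability measure (primitive substitutions give uniquely ergodic systems). The substitution matrix $\mathsf{S}_\zeta$ is the $d\times d$ matrix with $\mathsf{S}_\zeta(i,j)$ = number of occurrences of $i$ in $\zeta(j)$; $\zeta$ is primitive if some power of $\mathsf{S}_\zeta$ is strictly positive, and non-periodic (aperiodic) if $X_\zeta$ is infinite. "Pure singular spectrum" means the maximal spectral type of the Koopman operator $f\mapsto f\circ T$ on $L^2(X_\zeta,\mu)$ is singular with respect to Lebesgue measure. Spectral cocycle: write $\zeta(b)=u^b_1\cdots u^b_{|\zeta(b)|}$. For $\xi=(\xi_0,\ldots,\xi_{d-1})\in\mathbb{R}^d$ let $\mathscr{M}_\zeta(\xi)$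 be the $d\times d$ complex matrix with entries $$[\mathscr{M}_\zeta(\xi)]_{b,c}=\sum_{j\le|\zeta(b)|,\ u^b_j=c}\exp\Big(-2\pi i\sum_{k=1}^{j-1}\xi_{u^b_k}\Big),\quad (b,c)\in\mathcal{A}^2;$$ it is $\mathbb{Z}^d$-periodic, so defined on $\mathbb{T}^d=\mathbb{R}^d/\mathbb{Z}^d$. Let $E_\zeta:\mathbb{T}^d\to\mathbb{T}^d$, $E_\zeta\xi=\mathsf{S}_\zeta^t\xi \pmod{\mathbb{Z}^d}$, and $\mathscr{M}_\zeta(\xi,n)=\mathscr{M}_\zeta(E_\zeta^{n-1}\xi)\cdots\mathscr{M}_\zeta(\xi)$. When $\mathsf{S}_\zeta$ has no eigenvalues that are roots of unity (as here), $E_\zeta$ is ergodic for Haar measure $m_d$ and the top Lyapunov exponent $\chi(\mathscr{M}_\zeta)=\lim_{n\to\infty}\frac1n\log\|\mathscr{M}_\zeta(\xi,n)\|$ exists and is constant for $m_d$-a.e. $\xi$ (any matrix norm). *)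

theory Defs
  imports "HOL-Probability.Probability" "HOL-Library.Sublist"
    "Jordan_Normal_Form.Spectral_Radius" "Jordan_Normal_Form.Determinant"
begin

text \<open>Alphabet A = {0,...,d-1} (natural numbers below d).  A substitution is a map
  zeta :: nat => nat list; it is relevant only on letters a < d.\<close>

definition is_substitution :: "nat \<Rightarrow> (nat \<Rightarrow> nat list) \<Rightarrow> bool" where
  "is_substitution d \<zeta> \<longleftrightarrow> (\<forall>a<d. \<zeta> a \<noteq> [] \<and> set (\<zeta> a) \<subseteq> {..<d})"

definition subst_word :: "(nat \<Rightarrow> nat list) \<Rightarrow> nat list \<Rightarrow> nat list" where
  "subst_word \<zeta> w = concat (map \<zeta> w)"

definition subst_matrix :: "nat \<Rightarrow> (nat \<Rightarrow> nat list) \<Rightarrow> int mat" where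
  "subst_matrix d \<zeta> = mat d d (\<lambda>(i,j). int (count_list (\<zeta> j) i))"

definition primitive_subst :: "nat \<Rightarrow> (nat \<Rightarrow> nat list) \<Rightarrow> bool" where
  "primitive_subst d \<zeta> \<longleftrightarrow>
     (\<exists>k>0. \<forall>i<d. \<forall>j<d. (subst_matrix d \<zeta> ^\<^sub>m k) $$ (i,j) > 0)"

definition subst_space :: "nat \<Rightarrow> (nat \<Rightarrow> nat list) \<Rightarrow> (int \<Rightarrow> nat) set" where
  "subst_space d \<zeta> = {x. \<forall>i::int. \<forall>k::nat.
      \<exists>a<d. \<exists>n. sublist (map (\<lambda>j. x (i + int j)) [0..<k]) ((subst_word \<zeta> ^^ n) [a])}"

definition shift_pow :: "int \<Rightarrow> (int \<Rightarrow> nat) \<Rightarrow> (int \<Rightarrow> nat)" where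
  "shift_pow n x = (\<lambda>k. x (k + n))"

definition seq_space :: "(int \<Rightarrow> nat) measure" where
  "seq_space = PiM UNIV (\<lambda>_::int. count_space (UNIV::nat set))"

definition spectral_matrix :: "nat \<Rightarrow> (nat \<Rightarrow> nat list) \<Rightarrow> (nat \<Rightarrow> real) \<Rightarrow> complex mat" where
  "spectral_matrix d \<zeta> \<xi> = mat d d (\<lambda>(b,c).
     (\<Sum>j\<in>{j. j < length (\<zeta> b) \<and> \<zeta> b ! j = c}.
        exp (- 2 * pi * \<i> * complex_of_real (\<Sum>k<j. \<xi> (\<zeta> b ! k)))))"

text \<open>The endomorphism E_zeta xi = S^t xi, lifted to R^d (M_zeta is Z^d-periodic, and
  S is an integer matrix, so reduction mod Z^d is unnecessary).\<close>
definition toral_endo :: "nat \<Rightarrow> (nat \<Rightarrow> nat list) \<Rightarrow> (nat \<Rightarrow> real) \<Rightarrow> (nat \<Rightarrow> real)" where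
  "toral_endo d \<zeta> \<xi> = (\<lambda>i. \<Sum>j<d. of_int (subst_matrix d \<zeta> $$ (j,i)) * \<xi> j)"

fun spectral_cocycle :: "nat \<Rightarrow> (nat \<Rightarrow> nat list) \<Rightarrow> (nat \<Rightarrow> real) \<Rightarrow> nat \<Rightarrow> complex mat" where
  "spectral_cocycle d \<zeta> \<xi> 0 = 1\<^sub>m d"
| "spectral_cocycle d \<zeta> \<xi> (Suc n) =
     spectral_matrix d \<zeta> ((toral_endo d \<zeta> ^^ n) \<xi>) * spectral_cocycle d \<zeta> \<xi> n"

definition mat_norm1 :: "complex mat \<Rightarrow> real" where
  "mat_norm1 A = (\<Sum>i<dim_row A. \<Sum>j<dim_col A. cmod (A $$ (i,j)))"

definition top_lyapunov_is :: "nat \<Rightarrow> (nat \<Rightarrow> nat list) \<Rightarrow> real \<Rightarrow> bool" where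
  "top_lyapunov_is d \<zeta> lyap \<longleftrightarrow>
     (AE \<xi> in PiM {..<d} (\<lambda>_. lborel).
        (\<lambda>n. ln (mat_norm1 (spectral_cocycle d \<zeta> \<xi> n)) / real n) \<longlonglongrightarrow> lyap)"

definition PF_eigenvalue :: "nat \<Rightarrow> (nat \<Rightarrow> nat list) \<Rightarrow> real" where
  "PF_eigenvalue d \<zeta> = spectral_radius (map_mat complex_of_int (subst_matrix d \<zeta>))"

text \<open>Spectral measure of f on [0,1) (identified with the circle):
  finite Borel measure whose Fourier coefficients are the correlations <U^n f, f>.\<close>
definition is_spectral_measure ::
  "(int \<Rightarrow> nat) measure \<Rightarrow> ((int \<Rightarrow> nat) \<Rightarrow> complex) \<Rightarrow> real measure \<Rightarrow> bool" where
  "is_spectral_measure \<mu> f \<sigma> \<longleftrightarrow>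
     sets \<sigma> = sets borel \<and> finite_measure \<sigma> \<and> emeasure \<sigma> (UNIV - {0..<1}) = 0 \<and>
     (\<forall>n::int. integrable \<sigma> (\<lambda>t. exp (2 * pi * \<i> * of_int n * complex_of_real t)) \<and>
       (\<integral>t. exp (2 * pi * \<i> * of_int n * complex_of_real t) \<partial>\<sigma>)
         = (\<integral>x. f (shift_pow n x) * cnj (f x) \<partial>\<mu>))"

definition singular_lebesgue :: "real measure \<Rightarrow> bool" where
  "singular_lebesgue \<sigma> \<longleftrightarrow>
     (\<exists>N\<in>sets borel. emeasure lborel N = 0 \<and> emeasure \<sigma> (UNIV - N) = 0)"

text \<open>Pure singular spectrum: every f in L^2(mu) has a spectral measure, singular w.r.t. Lebesgue
  (equivalently, the maximal spectral type is singular).\<close>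
definition pure_singular_spectrum :: "(int \<Rightarrow> nat) measure \<Rightarrow> bool" where
  "pure_singular_spectrum \<mu> \<longleftrightarrow>
     (\<forall>f. f \<in> borel_measurable \<mu> \<and> integrable \<mu> (\<lambda>x. (cmod (f x))\<^sup>2) \<longrightarrow>
        (\<exists>\<sigma>. is_spectral_measure \<mu> f \<sigma> \<and> singular_lebesgue \<sigma>))"

end

theory Submission
  imports Defs "HOL-Computational_Algebra.Field_as_Ring" "HOL-Library.Discrete_Functions"
    "HOL-Real_Asymp.Real_Asymp"
begin

text \<open>
  For a point \<open>\<omega>\<close> of the circle, put \<open>\<xi> = (\<omega>, \<dots>, \<omega>)\<close>. Applying the substitution expresses the
  twisted sums \<open>\<Sum> h(T\<^sup>n x) e(-n \<omega>)\<close> over words of the form \<open>\<zeta>\<^sup>n(a)\<close> through the spectral cocycle at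
  \<open>\<xi>\<close>. This works for every cylinder function \<open>h\<close>, because the windows that straddle two
  blocks only contribute a bounded error; no recognizability is needed. The Lyapunov exponent only controls
  almost every point of the torus, whereas \<open>\<xi>\<close> lies on a line. But for an integer vector \<open>m \<noteq> 0\<close>,
  irreducibility of the characteristic polynomial gives \<open>\<langle>m, E\<^sup>n \<xi>\<rangle> = b\<^sub>n \<omega>\<close> with eventually
  increasing \<open>\<bar>b\<^sub>n\<bar>\<close>, so that by Weyl's argument the orbit of \<open>\<xi>\<close> equidistributes for almost every \<open>\<omega>\<close>, and
  the exponent bounds the cocycle along this orbit as well. Hence, for almost every \<open>\<omega>\<close>, the sums of length
  \<open>N\<close> are \<open>o(\<surd>N)\<close> along a sequence of \<open>N\<close>, uniformly on the subshift. As the spectral measure of an interval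
  of length \<open>1/N\<close> around \<open>\<omega>\<close> is at most a constant times \<open>N\<^sup>-\<^sup>2\<close> times the squared norm of
  such a sum, the spectral measure gives no mass to a set of full Lebesgue measure. Cylinder functions are dense
  in \<open>L\<^sup>2\<close>, and the estimate is stable under approximation.
\<close>

section \<open>Words and the spectral cocycle\<close>

text \<open>At \<open>(\<omega>,...,\<omega>)\<close> the phase of the block
  \<open>\<zeta>^n(b)\<close> is its length times \<omega>, which is why the diagonal governs sums
  along orbits. The obstacle on this line is that the logarithm of the norm of the cocycle M is
  neither continuous nor bounded below, so equidistribution does not apply to it. For one fixed
  number K of steps it is replaced by ln(1 + d^2 |M|^2)/2 with the Hilbert-Schmidt norm:
  nonnegative, a majorant of the logarithm of the norm, and a continuous function of a trigonometric
  polynomial, so that Weierstrass approximation leads back to characters. K is taken so large that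
  the mean of this function is below K ln(\<Theta>)/2, where \<Theta> is the growth rate of lengths;
  submultiplicativity over groups of K steps does the rest. The factor 1/2 in the threshold arises
  because a bound R on sums of length N gives mass about R^2/N^2 to an interval of length 1/N, hence
  R^2/N to all of them together. L^2 approximation controls nothing at a single frequency; it is
  harmless because the mass is estimated by averages over the frequency, where Parseval
  applies.\<close>

definition weight :: "(nat \<Rightarrow> real) \<Rightarrow> nat list \<Rightarrow> real" where
  "weight \<xi> w = sum_list (map \<xi> w)"

lemma weight_simps [simp]:
  "weight \<xi> [] = 0" "weight \<xi> (a # w) = \<xi> a + weight \<xi> w"
  "weight \<xi> (u @ v) = weight \<xi> u + weight \<xi> v"
  by (simp_all add: weight_def)

lemma weight_sum_count:
  assumes "set w \<subseteq> {..<d}"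
  shows "weight \<xi> w = (\<Sum>l<d. real (count_list w l) * \<xi> l)"
  using assms
proof (induction w)
  case (Cons a w)
  have "(\<Sum>l<d. real (count_list (a # w) l) * \<xi> l)
     = (\<Sum>l<d. (if l = a then \<xi> l else 0) + real (count_list w l) * \<xi> l)"
    by (intro sum.cong) (auto simp: algebra_simps)
  also have "\<dots> = \<xi> a + (\<Sum>l<d. real (count_list w l) * \<xi> l)"
    using Cons.prems by (simp add: sum.distrib)
  finally show ?case using Cons by simp
qed simp

text \<open>For w = \<open>\<zeta> b\<close> this is the (b,c) entry of the spectral matrix.
  Extended to all words by peeling off the first letter, it becomes additive under concatenation up
  to a phase, which is what block decompositions use.\<close>

fun twist :: "nat \<Rightarrow> (nat \<Rightarrow> real) \<Rightarrow> nat list \<Rightarrow> complex" where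
  "twist c \<xi> [] = 0"
| "twist c \<xi> (a # w) = of_bool (a = c) + cis (- 2 * pi * \<xi> a) * twist c \<xi> w"

lemma twist_append:
  "twist c \<xi> (u @ v) = twist c \<xi> u + cis (- 2 * pi * weight \<xi> u) * twist c \<xi> v"
  by (induction u) (auto simp: algebra_simps cis_mult)

lemma twist_conv_sum:
  "twist c \<xi> w = (\<Sum>j\<in>{j. j < length w \<and> w ! j = c}. cis (- 2 * pi * (\<Sum>k<j. \<xi> (w ! k))))"
proof -
  have "twist c \<xi> w = (\<Sum>j<length w. of_bool (w ! j = c) * cis (- 2 * pi * (\<Sum>k<j. \<xi> (w ! k))))"
  proof (induction w)
    case (Cons a w)
    show ?case
      by (simp add: Cons.IH sum.lessThan_Suc_shift sum_distrib_left cis_mult algebra_simps del: sum.lessThan_Suc)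
  qed simp
  also have "\<dots> = (\<Sum>j\<in>{j. j < length w \<and> w ! j = c}. cis (- 2 * pi * (\<Sum>k<j. \<xi> (w ! k))))"
    by (intro sum.mono_neutral_cong_right) auto
  finally show ?thesis .
qed

lemma norm_twist_le: "cmod (twist c \<xi> w) \<le> real (count_list w c)"
proof (induction w)
  case (Cons a w)
  have "cmod (twist c \<xi> (a # w)) \<le> cmod (of_bool (a = c)) + cmod (cis (- 2 * pi * \<xi> a) * twist c \<xi> w)"
    by (simp add: norm_triangle_ineq)
  then show ?case using Cons by (auto simp: norm_mult)
qed simp

lemma exp_eq_cis: "exp (- 2 * pi * \<i> * complex_of_real x) = cis (- 2 * pi * x)"
  by (simp add: cis_conv_exp mult.commute mult.left_commute)

lemma subst_word_funpow_append:
  "(subst_word \<zeta> ^^ n) (u @ v) = (subst_word \<zeta> ^^ n) u @ (subst_word \<zeta> ^^ n) v"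
  by (induction n) (auto simp: subst_word_def)

lemma subst_word_funpow_Nil [simp]: "(subst_word \<zeta> ^^ n) [] = []"
  by (induction n) (auto simp: subst_word_def)

lemma subst_word_funpow_Cons:
  "(subst_word \<zeta> ^^ n) (a # v) = (subst_word \<zeta> ^^ n) [a] @ (subst_word \<zeta> ^^ n) v"
  using subst_word_funpow_append[of n \<zeta> "[a]" v] by simp

section \<open>Iterates of the substitution acting on weights, twisted sums and letter
  counts\<close>

locale substitution =
  fixes d :: nat and \<zeta> :: "nat \<Rightarrow> nat list"
  assumes subst: "is_substitution d \<zeta>" and d_pos: "d \<ge> 2"
begin

abbreviation subn :: "nat \<Rightarrow> nat list \<Rightarrow> nat list" where
  "subn n \<equiv> subst_word \<zeta> ^^ n"

definition sw :: "nat \<Rightarrow> nat \<Rightarrow> nat list" where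
  "sw n a = subn n [a]"

lemma sw_0 [simp]: "sw 0 a = [a]" by (simp add: sw_def)

lemma sw_Suc: "sw (Suc n) a = subn n (\<zeta> a)"
  unfolding sw_def funpow_Suc_right by (simp add: subst_word_def)

lemma sw_add: "sw (m + n) a = subn m (sw n a)"
  by (simp add: sw_def funpow_add)

lemma sw_Cons: "subn n (a # v) = sw n a @ subn n v"
  unfolding sw_def by (rule subst_word_funpow_Cons)

lemma zeta_letters: "a < d \<Longrightarrow> set (\<zeta> a) \<subseteq> {..<d}"
  and zeta_nonempty: "a < d \<Longrightarrow> \<zeta> a \<noteq> []"
  using subst by (auto simp: is_substitution_def)

lemma subst_word_letters: "set w \<subseteq> {..<d} \<Longrightarrow> set (subn n w) \<subseteq> {..<d}"
  by (induction n) (use zeta_letters in \<open>fastforce simp: subst_word_def\<close>)+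

lemma sw_letters: "a < d \<Longrightarrow> set (sw n a) \<subseteq> {..<d}"
  unfolding sw_def by (rule subst_word_letters) auto

lemma weight_funpow:
  assumes "set w \<subseteq> {..<d}"
  shows "weight \<xi> (subn n w) = weight (\<lambda>b. weight \<xi> (sw n b)) w"
  using assms by (induction w) (auto simp: sw_Cons)

lemma toral_endo_eq: "b < d \<Longrightarrow> toral_endo d \<zeta> \<xi> b = weight \<xi> (\<zeta> b)"
  using weight_sum_count[OF zeta_letters, of b \<xi>]
  by (auto simp: toral_endo_def subst_matrix_def intro!: sum.cong)

lemma weight_cong: "set w \<subseteq> {..<d} \<Longrightarrow> (\<And>b. b < d \<Longrightarrow> \<xi> b = \<xi>' b) \<Longrightarrow> weight \<xi> w = weight \<xi>' w"
  by (induction w) auto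

text \<open>The transposed matrix sends \<xi> to the weights of the words \<open>\<zeta> b\<close>.
  The restriction b < d matters because \<open>toral_endo\<close> also assigns values to indices
  outside the alphabet.\<close>

lemma toral_endo_funpow:
  "b < d \<Longrightarrow> (toral_endo d \<zeta> ^^ n) \<xi> b = weight \<xi> (sw n b)"
proof (induction n arbitrary: b)
  case (Suc n)
  have "(toral_endo d \<zeta> ^^ Suc n) \<xi> b = weight ((toral_endo d \<zeta> ^^ n) \<xi>) (\<zeta> b)"
    using Suc.prems by (simp add: toral_endo_eq)
  also have "\<dots> = weight (\<lambda>b. weight \<xi> (sw n b)) (\<zeta> b)"
    by (rule weight_cong[OF zeta_letters]) (use Suc in auto)
  also have "\<dots> = weight \<xi> (sw (Suc n) b)"
    using weight_funpow[OF zeta_letters, of b \<xi> n] Suc.prems by (simp add: sw_Suc)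
  finally show ?case .
qed simp

text \<open>Cut the image of w into blocks \<open>sw n b\<close>, one for each letter b of w. A
  block contributes its own twisted sum times the phase of the blocks before it, and this phase is
  that of a prefix of w when b has weight \<open>weight \<xi> (sw n b)\<close>.\<close>

lemma twist_funpow:
  assumes "set w \<subseteq> {..<d}"
  shows "twist c \<xi> (subn n w)
    = (\<Sum>l<d. twist l (\<lambda>b. weight \<xi> (sw n b)) w * twist c \<xi> (sw n l))"
  using assms
proof (induction w)
  case (Cons a w)
  have "(\<Sum>l<d. twist l (\<lambda>b. weight \<xi> (sw n b)) (a # w) * twist c \<xi> (sw n l))
    = (\<Sum>l<d. (if l = a then twist c \<xi> (sw n l) else 0) + cis (- 2 * pi * weight \<xi> (sw n a)) *
         (twist l (\<lambda>b. weight \<xi> (sw n b)) w * twist c \<xi> (sw n l)))"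
    by (intro sum.cong) (auto simp: algebra_simps)
  also have "\<dots> = twist c \<xi> (sw n a) + cis (- 2 * pi * weight \<xi> (sw n a)) * twist c \<xi> (subn n w)"
    using Cons by (simp add: sum.distrib sum_distrib_left)
  finally show ?case by (simp add: sw_Cons twist_append)
qed simp

lemma twist_cong: "set w \<subseteq> {..<d} \<Longrightarrow> (\<And>b. b < d \<Longrightarrow> \<xi> b = \<xi>' b) \<Longrightarrow> twist c \<xi> w = twist c \<xi>' w"
  by (induction w) auto

lemma spectral_matrix_eq: "spectral_matrix d \<zeta> \<xi> = mat d d (\<lambda>(b, c). twist c \<xi> (\<zeta> b))"
  unfolding spectral_matrix_def twist_conv_sum exp_eq_cis ..

text \<open>The cocycle at time n is the spectral matrix of the n-th iterate of \<zeta>: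
  \<open>twist_funpow\<close> is the matrix product with one more factor, evaluated at E^n
  \<xi>.\<close>

lemma spectral_cocycle_eq: "spectral_cocycle d \<zeta> \<xi> n = mat d d (\<lambda>(b, c). twist c \<xi> (sw n b))"
proof (induction n)
  case 0
  show ?case by (intro eq_matI) auto
next
  case (Suc n)
  show ?case
  proof (intro eq_matI)
    fix b c assume "b < dim_row (mat d d (\<lambda>(b, c). twist c \<xi> (sw (Suc n) b)))"
      "c < dim_col (mat d d (\<lambda>(b, c). twist c \<xi> (sw (Suc n) b)))"
    then have bc: "b < d" "c < d" by auto
    have "spectral_cocycle d \<zeta> \<xi> (Suc n) $$ (b, c)
      = (\<Sum>l<d. twist l ((toral_endo d \<zeta> ^^ n) \<xi>) (\<zeta> b) * twist c \<xi> (sw n l))"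
      using bc by (simp add: Suc spectral_matrix_eq scalar_prod_def atLeast0LessThan)
    also have "\<dots> = (\<Sum>l<d. twist l (\<lambda>b. weight \<xi> (sw n b)) (\<zeta> b) * twist c \<xi> (sw n l))"
      using bc by (intro sum.cong refl arg_cong2[where f="(*)"] twist_cong zeta_letters toral_endo_funpow)
    also have "\<dots> = twist c \<xi> (sw (Suc n) b)"
      using twist_funpow[OF zeta_letters, of b c \<xi> n] bc by (simp add: sw_Suc)
    finally show "spectral_cocycle d \<zeta> \<xi> (Suc n) $$ (b, c) = mat d d (\<lambda>(b, c). twist c \<xi> (sw (Suc n) b)) $$ (b, c)"
      using bc by simp
  qed (auto simp: Suc spectral_matrix_eq)
qed

text \<open>Entry (i,j) of S^n, kept as a natural number so that positivity is the lower bound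
  1.\<close>

definition cnt :: "nat \<Rightarrow> nat \<Rightarrow> nat \<Rightarrow> nat" where
  "cnt n i j = count_list (sw n j) i"

lemma count_funpow:
  assumes "set w \<subseteq> {..<d}"
  shows "count_list (subn n w) i = (\<Sum>l<d. cnt n i l * count_list w l)"
  using assms
proof (induction w)
  case (Cons a w)
  have "(\<Sum>l<d. cnt n i l * count_list (a # w) l)
     = (\<Sum>l<d. (if l = a then cnt n i l else 0) + cnt n i l * count_list w l)"
    by (intro sum.cong) (auto simp: algebra_simps)
  also have "\<dots> = cnt n i a + (\<Sum>l<d. cnt n i l * count_list w l)"
    using Cons.prems by (simp add: sum.distrib)
  finally show ?case using Cons by (simp add: sw_Cons cnt_def)
qed simp

lemma cnt_add:
  assumes "j < d"
  shows "cnt (m + n) i j = (\<Sum>l<d. cnt m i l * cnt n l j)"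
  using count_funpow[OF sw_letters[OF assms], of m n i] by (simp add: cnt_def sw_add)

lemma cnt_0: "cnt 0 i j = of_bool (i = j)"
  by (auto simp: cnt_def)

lemma cnt_1: "cnt 1 i j = count_list (\<zeta> j) i"
  by (simp add: cnt_def sw_def subst_word_def)

lemma subst_matrix_pow:
  assumes "i < d" "j < d"
  shows "(subst_matrix d \<zeta> ^\<^sub>m n) $$ (i, j) = int (cnt n i j)"
  using assms
proof (induction n arbitrary: j)
  case 0
  then show ?case by (auto simp: cnt_0 subst_matrix_def)
next
  case (Suc n)
  have S: "subst_matrix d \<zeta> \<in> carrier_mat d d" by (simp add: subst_matrix_def)
  have "(subst_matrix d \<zeta> ^\<^sub>m n) \<in> carrier_mat d d" using S by (rule pow_carrier_mat)
  then have "(subst_matrix d \<zeta> ^\<^sub>m Suc n) $$ (i, j)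
     = (\<Sum>l<d. (subst_matrix d \<zeta> ^\<^sub>m n) $$ (i, l) * subst_matrix d \<zeta> $$ (l, j))"
    using Suc.prems S by (simp add: scalar_prod_def atLeast0LessThan)
  also have "\<dots> = (\<Sum>l<d. int (cnt n i l) * int (cnt 1 l j))"
    using Suc by (intro sum.cong) (auto simp: cnt_1[unfolded One_nat_def] subst_matrix_def)
  also have "\<dots> = int (cnt (Suc n) i j)"
    using cnt_add[of j n 1 i] Suc.prems by simp
  finally show ?case .
qed

lemma length_sw: "a < d \<Longrightarrow> length (sw n a) = (\<Sum>i<d. cnt n i a)"
  using sum_count_set[OF sw_letters, of a n] by (simp add: cnt_def)

end

section \<open>Growth of substituted words\<close>

text \<open>With w j = A^j (w 0), the hypothesis on p says p(A) (w 0) = 0, coordinate by coordinate.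
  Split off a root, p = (x - \<alpha>) q: either q(A) (w 0) = 0 and q has smaller degree, or this
  vector is an eigenvector for \<alpha>.\<close>

lemma eigenvalue_of_annihilator:
  fixes A :: "complex mat" and w :: "nat \<Rightarrow> complex vec" and p :: "complex poly"
  assumes A: "A \<in> carrier_mat d d" and w: "\<And>j. w j \<in> carrier_vec d"
    and step: "\<And>j. A *\<^sub>v w j = w (Suc j)" and w0: "w 0 \<noteq> 0\<^sub>v d"
    and "p \<noteq> 0" and "\<And>l. l < d \<Longrightarrow> (\<Sum>j\<le>degree p. coeff p j * w j $ l) = 0"
  shows "\<exists>\<alpha>. poly p \<alpha> = 0 \<and> eigenvalue A \<alpha>"
  using assms(5,6)
proof (induction "degree p" arbitrary: p)
  case 0
  then have "coeff p 0 \<noteq> 0" by (metis leading_coeff_0_iff)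
  then have "w 0 $ l = 0" if "l < d" for l using 0(1) 0(3)[OF that] by simp
  then have "w 0 = 0\<^sub>v d" using w by (intro eq_vecI) auto
  then show ?case using w0 by simp
next
  case (Suc n)
  then have "degree p \<noteq> 0" by simp
  then obtain \<alpha> where \<alpha>: "poly p \<alpha> = 0"
    using fundamental_theorem_of_algebra[of p] unfolding constant_degree by blast
  then obtain q where q: "p = [:- \<alpha>, 1:] * q" unfolding poly_eq_0_iff_dvd dvd_def by blast
  have q0: "q \<noteq> 0" using q Suc.prems by auto
  have deg: "degree p = Suc (degree q)"
    unfolding q using q0 by (subst degree_mult_eq) auto
  define v where "v = vec d (\<lambda>l. \<Sum>j\<le>degree q. coeff q j * w j $ l)"
  have v: "v \<in> carrier_vec d" by (simp add: v_def)
  show ?case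
  proof (cases "v = 0\<^sub>v d")
    case True
    then have "(\<Sum>j\<le>degree q. coeff q j * w j $ l) = 0" if "l < d" for l
      
    proof -
      have "v $ l = 0" unfolding True using that by simp
      then show ?thesis using that by (simp add: v_def)
    qed
    then obtain \<beta> where "poly q \<beta> = 0" "eigenvalue A \<beta>"
      using Suc.hyps(1)[of q] Suc.hyps(2) deg q0 by auto
    then show ?thesis using q by auto
  next
    case False
    have coeff_p: "coeff p j = (if j = 0 then 0 else coeff q (j - 1)) - \<alpha> * coeff q j" for j
      unfolding q by (cases j) auto
    have "A *\<^sub>v v = \<alpha> \<cdot>\<^sub>v v"
    proof (intro eq_vecI)
      fix l assume "l < dim_vec (\<alpha> \<cdot>\<^sub>v v)"
      then have l: "l < d" by (simp add: v_def)
      have "(\<Sum>j\<le>Suc (degree q). (if j = 0 then 0 else coeff q (j - 1)) * w j $ l)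
          - (\<Sum>j\<le>Suc (degree q). \<alpha> * coeff q j * w j $ l) = 0"
        using Suc.prems(2)[OF l] unfolding deg coeff_p
        by (simp only: left_diff_distrib sum_subtractf)
      moreover have "(\<Sum>j\<le>Suc (degree q). \<alpha> * coeff q j * w j $ l) = \<alpha> * v $ l"
        using l by (simp add: v_def sum_distrib_left mult.assoc coeff_eq_0)
      moreover have "(\<Sum>j\<le>Suc (degree q). (if j = 0 then 0 else coeff q (j - 1)) * w j $ l)
         = (\<Sum>j\<le>degree q. coeff q j * w (Suc j) $ l)"
        by (subst sum.atMost_Suc_shift) simp
      moreover have "(A *\<^sub>v v) $ l = (\<Sum>j\<le>degree q. coeff q j * w (Suc j) $ l)"
      proof -
        have "(A *\<^sub>v v) $ l = (\<Sum>i<d. A $$ (l, i) * (\<Sum>j\<le>degree q. coeff q j * w j $ i))"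
          using A l by (simp add: scalar_prod_def v_def atLeast0LessThan)
        also have "\<dots> = (\<Sum>j\<le>degree q. coeff q j * (\<Sum>i<d. A $$ (l, i) * w j $ i))"
          unfolding sum_distrib_left by (subst sum.swap) (simp add: mult_ac)
        also have "(\<lambda>j. \<Sum>i<d. A $$ (l, i) * w j $ i) = (\<lambda>j. w (Suc j) $ l)"
        proof
          fix j
          have "w (Suc j) $ l = (A *\<^sub>v w j) $ l" by (simp add: step)
          then show "(\<Sum>i<d. A $$ (l, i) * w j $ i) = w (Suc j) $ l"
            using A l carrier_vecD[OF w[of j]] by (simp add: scalar_prod_def atLeast0LessThan)
        qed
        finally show ?thesis .
      qed
      ultimately show "(A *\<^sub>v v) $ l = (\<alpha> \<cdot>\<^sub>v v) $ l" using l by (simp add: v_def)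
    qed (use A in \<open>auto simp: v_def\<close>)
    then have "eigenvalue A \<alpha>"
      using False v A by (auto simp: eigenvalue_def eigenvector_def)
    then show ?thesis using \<alpha> by blast
  qed
qed

text \<open>Every nonzero vector is cyclic. Otherwise a polynomial of degree below d annihilates it
  and has a root in common with the characteristic polynomial, against Bezout: the two are coprime
  over the rationals.\<close>

lemma cyclic_of_irreducible_char_poly:
  fixes A :: "rat mat" and w :: "nat \<Rightarrow> rat vec"
  assumes A: "A \<in> carrier_mat d d" and irr: "irreducible (char_poly A)"
    and w: "\<And>j. w j \<in> carrier_vec d" and step: "\<And>j. A *\<^sub>v w j = w (Suc j)" and w0: "w 0 \<noteq> 0\<^sub>v d"
    and y: "y \<in> carrier_vec d"
  shows "\<exists>x. \<forall>l<d. (\<Sum>j<d. w j $ l * x j) = y $ l"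
proof -
  \<comment> \<open>The Krylov matrix: its columns are the first d vectors of the orbit, and
    cyclicity is its invertibility.\<close>
  define K where "K = mat d d (\<lambda>(l, j). w j $ l)"
  have K: "K \<in> carrier_mat d d" by (simp add: K_def)
  show ?thesis
  proof (cases "det K = 0")
    case False
    from det_non_zero_imp_unit[OF K False, of "()"] obtain B
      where B: "B \<in> carrier_mat d d" "K * B = 1\<^sub>m d"
      unfolding Units_def ring_mat_def by auto
    define x where "x = B *\<^sub>v y"
    have x: "x \<in> carrier_vec d" using B y by (simp add: x_def)
    have "K *\<^sub>v x = y"
      unfolding x_def using K B y by (simp flip: assoc_mult_mat_vec)
    have "(\<Sum>j<d. w j $ l * x $ j) = y $ l" if "l < d" for l
    proof -
      have "y $ l = (K *\<^sub>v x) $ l" using \<open>K *\<^sub>v x = y\<close> by simp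
      also have "\<dots> = (\<Sum>j<d. w j $ l * x $ j)"
        using that carrier_vecD[OF x] by (simp add: K_def scalar_prod_def atLeast0LessThan)
      finally show ?thesis by simp
    qed
    then show ?thesis by (intro exI[of _ "\<lambda>j. x $ j"]) auto
  next
    case True
    then obtain x where x: "x \<in> carrier_vec d" "x \<noteq> 0\<^sub>v d" "K *\<^sub>v x = 0\<^sub>v d"
      using det_0_iff_vec_prod_zero[OF K] by auto
    \<comment> \<open>A kernel vector of the Krylov matrix lists the coefficients of a polynomial
      that annihilates w 0.\<close>
    define p where "p = Poly (map (\<lambda>j. x $ j) [0..<d])"
    have coeff_p: "coeff p j = (if j < d then x $ j else 0)" for j
      by (simp add: p_def coeff_Poly_eq nth_default_def)
    have "p \<noteq> 0"
    proof
      assume "p = 0"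
      then have "x $ j = 0" if "j < d" for j using coeff_p[of j] that by simp
      then show False using x by (auto intro!: eq_vecI)
    qed
    have d0: "d > 0" using x by (cases d) auto
    have "degree p < d"
      using coeff_p d0 by (intro degree_lessI) auto
    let ?\<chi> = "char_poly A"
    have deg\<chi>: "degree ?\<chi> = d" using degree_monic_char_poly[OF A] by simp
    have "\<not> ?\<chi> dvd p"
      using \<open>p \<noteq> 0\<close> \<open>degree p < d\<close> deg\<chi> dvd_imp_degree_le[of ?\<chi> p] by auto
    then have "coprime ?\<chi> p"
      using irr by (intro prime_elem_imp_coprime irreducible_imp_prime_elem)
    then obtain u v where uv: "u * ?\<chi> + v * p = 1"
      using bezout_coefficients_fst_snd[of ?\<chi> p] by (simp only: coprime_iff_gcd_eq_1)
    let ?h = "of_rat :: rat \<Rightarrow> complex"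
    let ?A = "map_mat ?h A"
    have A': "?A \<in> carrier_mat d d" using A by simp
    have "\<exists>\<alpha>. poly (map_poly ?h p) \<alpha> = 0 \<and> eigenvalue ?A \<alpha>"
    proof (rule eigenvalue_of_annihilator[OF A', of "\<lambda>j. map_vec ?h (w j)"])
      show "map_vec ?h (w j) \<in> carrier_vec d" for j using w by simp
      show "?A *\<^sub>v map_vec ?h (w j) = map_vec ?h (w (Suc j))" for j
        unfolding step[symmetric] by (rule of_rat_hom.mult_mat_vec_hom[OF A w, symmetric])
      show "map_vec ?h (w 0) \<noteq> 0\<^sub>v d"
      proof
        assume *: "map_vec ?h (w 0) = 0\<^sub>v d"
        have "w 0 $ l = 0" if "l < d" for l
          using arg_cong[OF *, of "\<lambda>v. v $ l"] that carrier_vecD[OF w[of 0]] by simp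
        then show False using w0 w[of 0] by (auto intro!: eq_vecI)
      qed
      show "map_poly ?h p \<noteq> 0" using \<open>p \<noteq> 0\<close> by simp
      fix l assume l: "l < d"
      have "(\<Sum>j\<le>degree p. coeff p j * w j $ l) = (\<Sum>j<d. coeff p j * w j $ l)"
        using \<open>degree p < d\<close> by (intro sum.mono_neutral_left) (auto simp: coeff_eq_0)
      also have "\<dots> = (\<Sum>j<d. w j $ l * x $ j)"
        by (intro sum.cong) (auto simp: coeff_p)
      also have "\<dots> = (K *\<^sub>v x) $ l"
        using l carrier_vecD[OF x(1)] by (simp add: K_def scalar_prod_def atLeast0LessThan)
      also have "\<dots> = 0" using x l by simp
      finally have "?h (\<Sum>j\<le>degree p. coeff p j * w j $ l) = 0" by simp
      then show "(\<Sum>j\<le>degree (map_poly ?h p). coeff (map_poly ?h p) j * map_vec ?h (w j) $ l) = 0"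
        using l carrier_vecD[OF w] by (simp add: of_rat_sum of_rat_mult)
    qed
    interpret h: map_poly_comm_ring_hom ?h ..
    from \<open>\<exists>\<alpha>. poly (map_poly ?h p) \<alpha> = 0 \<and> eigenvalue ?A \<alpha>\<close> obtain \<alpha> where \<alpha>: "poly (map_poly ?h p) \<alpha> = 0" "eigenvalue ?A \<alpha>" by blast
    then have "poly (map_poly ?h ?\<chi>) \<alpha> = 0"
      using eigenvalue_root_char_poly[OF A', of \<alpha>] of_rat_hom.char_poly_hom[OF A, where 'a = complex] by simp
    moreover have "poly (map_poly ?h (u * ?\<chi> + v * p)) \<alpha> = 1" unfolding uv by simp
    ultimately have False using \<alpha>(1)
      by (simp add: h.hom_add h.hom_mult)
    then show ?thesis ..
  qed
qed

section \<open>Lengths of iterated words and their exponential growth\<close>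

locale primitive_substitution = substitution +
  assumes prim: "primitive_subst d \<zeta>"
begin

lemma length_sw_add:
  assumes "j < d"
  shows "length (sw (m + n) j) = (\<Sum>l<d. length (sw m l) * cnt n l j)"
proof -
  have "length (sw (m + n) j) = (\<Sum>i<d. \<Sum>l<d. cnt m i l * cnt n l j)"
    using length_sw[OF assms] cnt_add[OF assms] by simp
  also have "\<dots> = (\<Sum>l<d. (\<Sum>i<d. cnt m i l) * cnt n l j)"
    by (subst sum.swap) (simp add: sum_distrib_right)
  finally show ?thesis using length_sw by simp
qed

lemma length_sw_pos: "j < d \<Longrightarrow> length (sw n j) > 0"
proof (induction n arbitrary: j)
  case (Suc n)
  have "set (\<zeta> j) \<subseteq> {..<d}" "\<zeta> j \<noteq> []" using zeta_letters zeta_nonempty Suc.prems by auto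
  then obtain a w where "\<zeta> j = a # w" "a < d" by (cases "\<zeta> j") auto
  then show ?case using Suc.IH[of a] by (simp add: sw_Suc sw_Cons)
qed simp

definition prim_exp :: nat where
  "prim_exp = (SOME k. k > 0 \<and> (\<forall>i<d. \<forall>j<d. cnt k i j > 0))"

lemma prim_exp: "prim_exp > 0" "i < d \<Longrightarrow> j < d \<Longrightarrow> cnt prim_exp i j > 0"
proof -
  obtain k where "k > 0" "\<forall>i<d. \<forall>j<d. (subst_matrix d \<zeta> ^\<^sub>m k) $$ (i, j) > 0"
    using prim by (auto simp: primitive_subst_def)
  then have "k > 0 \<and> (\<forall>i<d. \<forall>j<d. cnt k i j > 0)" using subst_matrix_pow by auto
  then have "prim_exp > 0 \<and> (\<forall>i<d. \<forall>j<d. cnt prim_exp i j > 0)" unfolding prim_exp_def by (rule someI)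
  then show "prim_exp > 0" "i < d \<Longrightarrow> j < d \<Longrightarrow> cnt prim_exp i j > 0" by auto
qed

text \<open>Split n into \<open>prim_exp\<close> and a rest: the entries of the first power are at
  least 1, and no column of the second vanishes because words stay nonempty.\<close>

lemma cnt_pos:
  assumes "n \<ge> prim_exp" "i < d" "j < d"
  shows "cnt n i j > 0"
proof -
  obtain m where n: "n = prim_exp + m" using assms le_Suc_ex by blast
  have "0 < (\<Sum>l<d. cnt m l j)" using length_sw_pos[of j m] length_sw assms by simp
  also have "\<dots> \<le> (\<Sum>l<d. cnt prim_exp i l * cnt m l j)"
    using prim_exp(2)[OF assms(2)] by (intro sum_mono) (simp add: Suc_leI)
  also have "\<dots> = cnt n i j" unfolding n using cnt_add assms by simp
  finally show ?thesis .
qed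

lemma sum_length_sw_le:
  assumes "b < d"
  shows "(\<Sum>l<d. length (sw n l)) \<le> length (sw (n + prim_exp) b)"
  unfolding length_sw_add[OF assms] using prim_exp(2)[OF _ assms] by (intro sum_mono) (simp add: Suc_leI)

lemma length_sw_mono: 
  assumes b: "b < d" and "n \<le> m"
  shows "length (sw n b) \<le> length (sw m b)"
  using \<open>n \<le> m\<close>
proof (induction m rule: dec_induct)
  case (step m)
  have "length (sw m b) = (\<Sum>l<d. 1 * cnt m l b)" using length_sw b by simp
  also have "\<dots> \<le> (\<Sum>l<d. length (sw 1 l) * cnt m l b)"
    using length_sw_pos by (intro sum_mono mult_right_mono) (auto simp: Suc_leI)
  also have "\<dots> = length (sw (Suc m) b)" using length_sw_add[of b 1 m] b by simp
  finally show ?case using step by simp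
qed auto

text \<open>After \<open>prim_exp\<close> steps the image of any letter contains both 0 and 1, which
  doubles the minimal length. This gives exponential growth without reference to
  eigenvalues.\<close>

lemma length_sw_doubling: "b < d \<Longrightarrow> 2 ^ t \<le> length (sw (prim_exp * t) b)"
proof (induction t arbitrary: b)
  case (Suc t)
  have "2 ^ Suc t \<le> (\<Sum>l<2. length (sw (prim_exp * t) l))"
    using Suc.IH[of 0] Suc.IH[of 1] d_pos by (simp add: numeral_2_eq_2)
  also have "\<dots> \<le> (\<Sum>l<d. length (sw (prim_exp * t) l))" using d_pos by (intro sum_mono2) auto
  also have "\<dots> \<le> length (sw (prim_exp * t + prim_exp) b)" by (rule sum_length_sw_le) fact
  finally show ?case by (simp add: algebra_simps)
qed simp

text \<open>Moduli of an eigenvector for an eigenvalue of maximal modulus r form a vector a \<ge> 0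
  with r a \<le> S a. Summing the coordinates of S^n a weights the lengths of the words
  \<open>sw n j\<close> by a j, so their weighted mean is at least r^n and some letter reaches
  it.\<close>

lemma length_sw_ge_eigenvalue:
  obtains j where "j < d" "PF_eigenvalue d \<zeta> ^ n \<le> length (sw n j)"
proof -
  let ?A = "map_mat complex_of_int (subst_matrix d \<zeta>)"
  have A: "?A \<in> carrier_mat d d" by (simp add: subst_matrix_def)
  have "PF_eigenvalue d \<zeta> \<in> norm ` spectrum ?A"
    unfolding PF_eigenvalue_def using spectral_radius_mem_max[OF A] d_pos by simp
  then obtain ev where ev: "eigenvalue ?A ev" "PF_eigenvalue d \<zeta> = cmod ev"
    by (auto simp: spectrum_def)
  then obtain v where v: "v \<in> carrier_vec d" "v \<noteq> 0\<^sub>v d" "?A *\<^sub>v v = ev \<cdot>\<^sub>v v"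
    using A by (auto simp: eigenvalue_def eigenvector_def)
  define a where "a i = cmod (v $ i)" for i
  have step: "cmod ev * a i \<le> (\<Sum>j<d. real (cnt 1 i j) * a j)" if "i < d" for i
  proof -
    have "ev * v $ i = (?A *\<^sub>v v) $ i" using v that by simp
    also have "\<dots> = (\<Sum>j<d. of_nat (cnt 1 i j) * v $ j)"
      using that carrier_vecD[OF v(1)] unfolding cnt_1
      by (simp add: scalar_prod_def atLeast0LessThan subst_matrix_def)
    finally have "cmod ev * a i = cmod (\<Sum>j<d. of_nat (cnt 1 i j) * v $ j)"
      unfolding a_def by (metis norm_mult)
    also have "\<dots> \<le> (\<Sum>j<d. real (cnt 1 i j) * a j)"
      unfolding a_def by (rule order_trans[OF norm_sum]) (simp add: norm_mult)
    finally show ?thesis .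
  qed
  have ind: "cmod ev ^ n * (\<Sum>j<d. a j) \<le> (\<Sum>j<d. real (length (sw n j)) * a j)"
  proof (induction n)
    case (Suc n)
    have "cmod ev ^ Suc n * (\<Sum>j<d. a j) \<le> cmod ev * (\<Sum>i<d. real (length (sw n i)) * a i)"
      using mult_left_mono[OF Suc, of "cmod ev"] by (simp add: mult.assoc)
    also have "\<dots> = (\<Sum>i<d. real (length (sw n i)) * (cmod ev * a i))"
      by (simp add: sum_distrib_left mult_ac)
    also have "\<dots> \<le> (\<Sum>i<d. real (length (sw n i)) * (\<Sum>j<d. real (cnt 1 i j) * a j))"
      using step by (intro sum_mono mult_left_mono) auto
    also have "\<dots> = (\<Sum>j<d. (\<Sum>i<d. real (length (sw n i) * cnt 1 i j)) * a j)"
      unfolding sum_distrib_left sum_distrib_right by (subst sum.swap) (simp add: mult_ac)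
    also have "\<dots> = (\<Sum>j<d. real (length (sw (Suc n) j)) * a j)"
    proof (intro sum.cong refl)
      fix j assume "j \<in> {..<d}"
      then show "(\<Sum>i<d. real (length (sw n i) * cnt 1 i j)) * a j = real (length (sw (Suc n) j)) * a j"
        using length_sw_add[of j n 1] by simp
    qed
    finally show ?case .
  qed simp
  have "\<exists>i<d. v $ i \<noteq> 0"
  proof (rule ccontr)
    assume "\<not> ?thesis"
    then have "v = 0\<^sub>v d" using v(1) by (intro eq_vecI) auto
    then show False using v by simp
  qed
  then obtain i where i: "i < d" "a i > 0" by (auto simp: a_def)
  have pos: "(\<Sum>j<d. a j) > 0" using i by (intro sum_pos2[of _ i]) (auto simp: a_def)
  have "\<exists>j<d. cmod ev ^ n \<le> real (length (sw n j))"
  proof (rule ccontr)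
    assume "\<not> ?thesis"
    then have less: "real (length (sw n j)) < cmod ev ^ n" if "j < d" for j using that by auto
    have "(\<Sum>j<d. real (length (sw n j)) * a j) < (\<Sum>j<d. cmod ev ^ n * a j)"
    proof (rule sum_strict_mono_ex1)
      show "\<forall>j\<in>{..<d}. real (length (sw n j)) * a j \<le> cmod ev ^ n * a j"
        using less by (auto simp: a_def intro!: mult_right_mono dest: less_imp_le)
      show "\<exists>j\<in>{..<d}. real (length (sw n j)) * a j < cmod ev ^ n * a j"
        using i less by (intro bexI[of _ i] mult_strict_right_mono) auto
    qed simp
    then show False using ind by (simp add: sum_distrib_left)
  qed
  then show ?thesis using that ev(2) by auto
qed

text \<open>If the Perron eigenvalue exceeds 1, it serves as \<Theta>. Instead of excluding the
  other case, one observes that it forces \<open>lyap\<close> to be negative, so that any \<Theta> >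
  1 with the required growth will do.\<close>

theorem growth_rate:
  assumes "lyap < ln (PF_eigenvalue d \<zeta>) / 2"
  obtains \<Theta> c where "\<Theta> > 1" "c > 0" "lyap < ln \<Theta> / 2"
    "\<And>n b. b < d \<Longrightarrow> c * \<Theta> ^ n \<le> length (sw n b)"
proof (cases "PF_eigenvalue d \<zeta> > 1")
  case True
  define \<theta> where "\<theta> = PF_eigenvalue d \<zeta>"
  have \<theta>: "\<theta> > 1" using True by (simp add: \<theta>_def)
  \<comment> \<open>Growth found for one letter j passes to all letters after
    \<open>prim_exp\<close> further steps; the constant pays for this delay.\<close>
  have "inverse (\<theta> ^ prim_exp) * \<theta> ^ n \<le> length (sw n b)" if b: "b < d" for n b
  proof (cases "n \<ge> prim_exp")
    case True
    then obtain m where n: "n = m + prim_exp" using le_Suc_ex by (metis add.commute)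
    obtain j where j: "j < d" "\<theta> ^ m \<le> length (sw m j)"
      using length_sw_ge_eigenvalue unfolding \<theta>_def by blast
    have "inverse (\<theta> ^ prim_exp) * \<theta> ^ n = \<theta> ^ m" using \<theta> by (simp add: n power_add)
    also have "\<dots> \<le> length (sw m j)" by fact
    also have "\<dots> \<le> real (\<Sum>l<d. length (sw m l))"
      using j member_le_sum[of j "{..<d}" "\<lambda>l. length (sw m l)"] by (intro of_nat_mono) simp
    also have "\<dots> \<le> length (sw n b)" unfolding n by (intro of_nat_mono sum_length_sw_le b)
    finally show ?thesis .
  next
    case False
    then have "\<theta> ^ n \<le> \<theta> ^ prim_exp" using \<theta> by (intro power_increasing) auto
    then have "inverse (\<theta> ^ prim_exp) * \<theta> ^ n \<le> 1" using \<theta> by (simp add: field_simps)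
    also have "1 \<le> real (length (sw n b))" using length_sw_pos[OF b, of n] by linarith
    finally show ?thesis .
  qed
  then show ?thesis using that[of \<theta> "inverse (\<theta> ^ prim_exp)"] \<theta> assms by (simp add: \<theta>_def)
next
  case False
  have "PF_eigenvalue d \<zeta> \<ge> 0"
  proof -
    have "map_mat complex_of_int (subst_matrix d \<zeta>) \<in> carrier_mat d d" by (simp add: subst_matrix_def)
    from spectral_radius_mem_max(1)[OF this] d_pos show ?thesis by (auto simp: PF_eigenvalue_def)
  qed
  \<comment> \<open>For the eigenvalue 0 this relies on the convention
    \<open>ln 0 = 0\<close>.\<close>
  then have "ln (PF_eigenvalue d \<zeta>) \<le> 0"
    using False by (cases "PF_eigenvalue d \<zeta> = 0") auto
  then have "lyap < 0" using assms by simp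
  \<comment> \<open>Chosen to match the doubling every \<open>prim_exp\<close> steps; the constant
    1/2 below absorbs rounding n down to a multiple of \<open>prim_exp\<close>.\<close>
  define \<Theta> where "\<Theta> = root prim_exp 2"
  have \<Theta>: "\<Theta> > 1" using prim_exp(1) by (simp add: \<Theta>_def)
  have "(1/2) * \<Theta> ^ n \<le> length (sw n b)" if b: "b < d" for n b
  proof -
    define t where "t = n div prim_exp"
    have "n \<le> prim_exp * Suc t"
      using prim_exp(1) dividend_less_times_div[of prim_exp n] by (simp add: t_def)
    then have "\<Theta> ^ n \<le> \<Theta> ^ (prim_exp * Suc t)" using \<Theta> by (intro power_increasing) auto
    also have "\<dots> = 2 * 2 ^ t" using prim_exp(1) by (simp only: power_mult \<Theta>_def real_root_pow_pos2) simp
    finally have "(1/2) * \<Theta> ^ n \<le> 2 ^ t" by simp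
    also have "\<dots> \<le> real (length (sw (prim_exp * t) b))"
      using length_sw_doubling[OF b, of t] by (metis of_nat_le_iff of_nat_numeral of_nat_power)
    also have "\<dots> \<le> length (sw n b)"
      using length_sw_mono[OF b, of "prim_exp * t" n] by (simp add: t_def)
    finally show ?thesis .
  qed
  moreover have "lyap < ln \<Theta> / 2"
    using \<open>lyap < 0\<close> ln_gt_zero[OF \<Theta>] by linarith
  ultimately show ?thesis using that[of \<Theta> "1/2"] \<Theta> by simp
qed

text \<open>The entries of S^K are at least 1, so each coordinate of the image of a positive vector
  is at least the old coordinate sum; with two or more coordinates the sum at least doubles.\<close>

lemma cnt_strict_cone:
  fixes v :: "nat \<Rightarrow> nat \<Rightarrow> int"
  assumes "K \<ge> prim_exp" and v: "\<And>i l. l < d \<Longrightarrow> v (Suc i) l = (\<Sum>j<d. int (cnt K l j) * v i j)"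
    and pos: "\<And>l. l < d \<Longrightarrow> v i0 l > 0" and "i \<ge> i0"
  shows "(\<Sum>l<d. v i l) > 0 \<and> (\<Sum>l<d. v i l) < (\<Sum>l<d. v (Suc i) l)"
proof -
  have ge: "(\<Sum>j<d. v i j) \<le> v (Suc i) l" if "l < d" "\<And>j. j < d \<Longrightarrow> v i j > 0" for l i
    unfolding v[OF that(1)]
  proof (intro sum_mono)
    fix j assume "j \<in> {..<d}"
    then show "v i j \<le> int (cnt K l j) * v i j"
      using that cnt_pos[OF assms(1), of l j] mult_right_mono[of 1 "int (cnt K l j)" "v i j"] by force
  qed
  have pos_i: "\<And>l. l < d \<Longrightarrow> v i l > 0"
    using \<open>i \<ge> i0\<close>
  proof (induction i rule: dec_induct)
    case (step i)
    have "0 < (\<Sum>j<d. v i j)" using step.IH d_pos by (intro sum_pos) (auto simp: lessThan_empty_iff)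
    then show ?case using ge[OF step.prems step.IH] by simp
  qed (use pos in auto)
  have sum_pos: "0 < (\<Sum>j<d. v i j)" using pos_i d_pos by (intro sum_pos) (auto simp: lessThan_empty_iff)
  have "(\<Sum>l<d. v i l) < (\<Sum>l<2::nat. (\<Sum>j<d. v i j))" using sum_pos by simp
  also have "\<dots> \<le> (\<Sum>l<2. v (Suc i) l)" using ge[OF _ pos_i] d_pos by (intro sum_mono) auto
  also have "\<dots> \<le> (\<Sum>l<d. v (Suc i) l)"
  proof (rule sum_mono2)
    show "0 \<le> v (Suc i) l" if "l \<in> {..<d} - {..<2}" for l
      using ge[OF _ pos_i, of l] sum_pos that by simp
  qed (use d_pos in auto)
  finally show ?thesis using sum_pos by simp
qed

text \<open>S^n applied to the all-ones vector. It stands in for the Perron eigenvector: every S^n z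
  is measured relative to it.\<close>

definition pf_row :: "nat \<Rightarrow> nat \<Rightarrow> real" where
  "pf_row n l = (\<Sum>j<d. real (cnt n l j))"

definition mat_act :: "nat \<Rightarrow> (nat \<Rightarrow> real) \<Rightarrow> nat \<Rightarrow> real" where
  "mat_act n z l = (\<Sum>j<d. real (cnt n l j) * z j)"

lemma mat_act_add: "mat_act (m + n) z l = mat_act m (mat_act n z) l"
proof -
  have "mat_act (m + n) z l = (\<Sum>j<d. \<Sum>q<d. real (cnt m l q) * real (cnt n q j) * z j)"
    unfolding mat_act_def by (intro sum.cong refl) (simp add: cnt_add sum_distrib_right)
  also have "\<dots> = mat_act m (mat_act n z) l"
    unfolding mat_act_def sum_distrib_left by (subst sum.swap) (simp add: mult.assoc)
  finally show ?thesis .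
qed

lemma pf_row_eq: "pf_row n l = mat_act n (\<lambda>_. 1) l"
  by (simp add: pf_row_def mat_act_def)

lemma mat_act_0: "l < d \<Longrightarrow> mat_act 0 z l = z l"
proof -
  assume "l < d"
  have "mat_act 0 z l = (\<Sum>j<d. if j = l then z j else 0)"
    unfolding mat_act_def by (intro sum.cong) (auto simp: cnt_0)
  then show ?thesis using \<open>l < d\<close> by simp
qed

lemma pf_row_pos:
  assumes "n = 0 \<or> n \<ge> prim_exp" "l < d"
  shows "pf_row n l > 0"
proof (cases "n = 0")
  case True
  then show ?thesis using assms by (simp add: pf_row_eq mat_act_0)
next
  case False
  then show ?thesis unfolding pf_row_def
    using assms cnt_pos[of n l] d_pos by (intro sum_pos) (auto simp: lessThan_empty_iff)
qed

section \<open>Contraction towards the Perron direction under a positive power S^K\<close>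

context
  fixes K :: nat
  assumes K: "K \<ge> prim_exp"
begin

abbreviation prow :: "nat \<Rightarrow> nat \<Rightarrow> real" where "prow i \<equiv> pf_row (K * i)"
abbreviation pact :: "nat \<Rightarrow> (nat \<Rightarrow> real) \<Rightarrow> nat \<Rightarrow> real" where "pact i \<equiv> mat_act (K * i)"

definition cbound :: real where
  "cbound = (\<Sum>l<d. \<Sum>j<d. real (cnt K l j))"

lemma cnt_le_cbound:
  assumes "l < d" "j < d" shows "real (cnt K l j) \<le> cbound"
proof -
  have "real (cnt K l j) \<le> (\<Sum>j<d. real (cnt K l j))"
    using assms by (intro member_le_sum) auto
  also have "\<dots> \<le> cbound" unfolding cbound_def
    using assms by (intro member_le_sum[of l "{..<d}" "\<lambda>l. \<Sum>j<d. real (cnt K l j)"]) (auto intro!: sum_nonneg)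
  finally show ?thesis .
qed

lemma one_le_cnt: "l < d \<Longrightarrow> j < d \<Longrightarrow> 1 \<le> real (cnt K l j)"
  using cnt_pos[OF K, of l j] by linarith

lemma one_le_cbound: "1 \<le> cbound"
  using one_le_cnt[of 0 0] cnt_le_cbound[of 0 0] d_pos by linarith

lemma pf_row_K_pos: "l < d \<Longrightarrow> prow i l > 0"
  using K by (intro pf_row_pos) (cases i; auto)

lemma mat_act_Suc: "pact (Suc i) z l = (\<Sum>j<d. real (cnt K l j) * pact i z j)"
  using mat_act_add[of K "K * i" z l] by (simp add: mat_act_def)

lemma pf_row_Suc_le:
  assumes "l < d" shows "prow (Suc i) l \<le> cbound * (\<Sum>j<d. prow i j)"
  unfolding pf_row_eq mat_act_Suc sum_distrib_left
  using cnt_le_cbound[OF assms] pf_row_K_pos by (intro sum_mono mult_right_mono) (auto simp: pf_row_eq less_imp_le)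

lemma pf_row_Suc_ge:
  assumes "l < d" shows "(\<Sum>j<d. prow i j) \<le> prow (Suc i) l"
  unfolding pf_row_eq mat_act_Suc
proof (rule sum_mono)
  fix j assume "j \<in> {..<d}"
  then show "pact i (\<lambda>_. 1) j \<le> real (cnt K l j) * pact i (\<lambda>_. 1) j"
    using mult_right_mono[OF one_le_cnt[OF assms, of j], of "pact i (\<lambda>_. 1) j"]
      pf_row_K_pos[of j i] by (simp add: pf_row_eq)
qed

text \<open>One application of S^K, whose entries lie between 1 and \<open>cbound\<close>, makes all
  coordinates comparable; for i = 0 they all equal 1.\<close>

lemma pf_row_comparable:
  assumes "l < d" "l' < d"
  shows "prow i l' \<le> cbound * prow i l"
proof (cases i)
  case 0
  then show ?thesis using assms one_le_cbound by (simp add: pf_row_eq mat_act_0)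
next
  case (Suc i)
  have "prow (Suc i) l' \<le> cbound * (\<Sum>j<d. prow i j)" by (rule pf_row_Suc_le) fact
  also have "\<dots> \<le> cbound * prow (Suc i) l"
    using one_le_cbound assms by (intro mult_left_mono pf_row_Suc_ge) auto
  finally show ?thesis unfolding Suc .
qed

text \<open>Doeblin's argument: one step moves all ratios towards the ratio of the letter 0 by a fixed proportion.\<close>
lemma ratio_oscillation:
  obtains \<delta> D where "0 < \<delta>" "\<delta> \<le> 1"
    "\<And>i. \<exists>a b. b - a \<le> (1 - \<delta>) ^ i * D \<and>
       (\<forall>l<d. a * prow i l \<le> pact i z l \<and> pact i z l \<le> b * prow i l)"
proof -
  \<comment> \<open>Chosen so that \<open>\<delta> * prow (Suc i) l \<le> prow i 0\<close>: one
    factor \<open>cbound\<close> for the step, and \<open>d * cbound\<close> for comparing d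
    coordinates with coordinate 0.\<close>
  define \<delta> where "\<delta> = 1 / (cbound * (d * cbound))"
  have "cbound * (d * cbound) \<ge> 1"
    using mult_mono[of 1 cbound 1 "d * cbound"] mult_mono[of 1 "real d" 1 cbound] one_le_cbound d_pos by auto
  then have \<delta>: "0 < \<delta>" "\<delta> \<le> 1" by (auto simp: \<delta>_def field_simps)
  have minor: "\<delta> * prow (Suc i) l \<le> real (cnt K l 0) * prow i 0" if "l < d" for i l
  proof -
    have "prow (Suc i) l \<le> cbound * (\<Sum>j<d. prow i j)" by (rule pf_row_Suc_le) fact
    also have "\<dots> \<le> cbound * (\<Sum>j<d. cbound * prow i 0)"
      using one_le_cbound d_pos by (intro mult_left_mono sum_mono pf_row_comparable) auto
    finally have "\<delta> * prow (Suc i) l \<le> \<delta> * (cbound * (d * cbound) * prow i 0)"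
      using \<delta> by (intro mult_left_mono) (auto simp: mult_ac)
    also have "\<dots> = 1 * prow i 0"
    proof -
      have "\<delta> * (cbound * (d * cbound)) = 1"
        using one_le_cbound d_pos by (simp add: \<delta>_def)
      then show ?thesis by (simp only: mult.assoc[symmetric])
    qed
    also have "\<dots> \<le> real (cnt K l 0) * prow i 0"
      using pf_row_K_pos[of 0 i] d_pos one_le_cnt[OF that, of 0] by (intro mult_right_mono) auto
    finally show ?thesis .
  qed
  define B where "B = (\<Sum>l<d. \<bar>z l\<bar>)"
  have "\<exists>a b. b - a \<le> (1 - \<delta>) ^ i * (2 * B) \<and>
       (\<forall>l<d. a * prow i l \<le> pact i z l \<and> pact i z l \<le> b * prow i l)" for i
  proof (induction i)
    case 0
    have "\<bar>z l\<bar> \<le> B" if "l < d" for l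
      using that unfolding B_def by (intro member_le_sum) auto
    then show ?case
      by (intro exI[of _ "- B"] exI[of _ B]) (auto simp: pf_row_eq mat_act_0 abs_le_iff minus_le_iff)
  next
    case (Suc i)
    then obtain a b where ab: "b - a \<le> (1 - \<delta>) ^ i * (2 * B)"
      and a: "\<And>l. l < d \<Longrightarrow> a * prow i l \<le> pact i z l"
      and b: "\<And>l. l < d \<Longrightarrow> pact i z l \<le> b * prow i l" by blast
    define r where "r = pact i z 0 / prow i 0"
    have p0: "prow i 0 > 0" using pf_row_K_pos d_pos by simp
    have r: "pact i z 0 = r * prow i 0" using p0 by (simp add: r_def)
    \<comment> \<open>Stated for arbitrary a, z and r, so that the upper bound follows from the same
      estimate applied to -b, -z and -r.\<close>
    have step: "(a + \<delta> * (r - a)) * prow (Suc i) l \<le> pact (Suc i) z l"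
      if l: "l < d" and a: "\<And>j. j < d \<Longrightarrow> a * prow i j \<le> pact i z j" and r: "pact i z 0 = r * prow i 0" for l a z r
    proof -
      have "a \<le> r" using a[of 0] d_pos p0 by (simp add: r)
      have "real (cnt K l 0) * (pact i z 0 - a * prow i 0) \<le> (\<Sum>j<d. real (cnt K l j) * (pact i z j - a * prow i j))"
        using d_pos a by (intro member_le_sum) auto
      also have "\<dots> = pact (Suc i) z l - a * prow (Suc i) l"
        unfolding pf_row_eq mat_act_Suc by (simp add: right_diff_distrib sum_subtractf sum_distrib_left mult_ac)
      finally have "(r - a) * (real (cnt K l 0) * prow i 0) \<le> pact (Suc i) z l - a * prow (Suc i) l"
        by (simp add: r algebra_simps)
      moreover have "(r - a) * (\<delta> * prow (Suc i) l) \<le> (r - a) * (real (cnt K l 0) * prow i 0)"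
        using minor[OF l] \<open>a \<le> r\<close> by (intro mult_left_mono) auto
      ultimately show ?thesis by (simp add: algebra_simps)
    qed
    have neg: "mat_act n (\<lambda>j. - z j) l = - mat_act n z l" for n l by (simp add: mat_act_def sum_negf)
    have lower: "(a + \<delta> * (r - a)) * prow (Suc i) l \<le> pact (Suc i) z l" if "l < d" for l
      by (rule step[OF that a r])
    have upper: "pact (Suc i) z l \<le> (b - \<delta> * (b - r)) * prow (Suc i) l" if "l < d" for l
      using step[of l "- b" "\<lambda>j. - z j" "- r"] b r that by (simp add: neg algebra_simps)
    have "(b - \<delta> * (b - r)) - (a + \<delta> * (r - a)) = (1 - \<delta>) * (b - a)" by (simp add: algebra_simps)
    also have "\<dots> \<le> (1 - \<delta>) * ((1 - \<delta>) ^ i * (2 * B))" using ab \<delta> by (intro mult_left_mono) auto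
    finally show ?case
      using lower upper by (intro exI[of _ "a + \<delta> * (r - a)"] exI[of _ "b - \<delta> * (b - r)"]) (simp add: mult.assoc)
  qed
  then show ?thesis using that[of \<delta> "2 * B"] \<delta> by blast
qed

text \<open>Says that z has no component along the Perron direction.\<close>

definition small :: "(nat \<Rightarrow> real) \<Rightarrow> bool" where
  "small z \<longleftrightarrow> (\<forall>l<d. (\<lambda>i. pact i z l / prow i l) \<longlonglongrightarrow> 0)"

text \<open>The interval [a,b] of ratios from \<open>ratio_oscillation\<close> then always contains
  0, and its length tends to 0.\<close>

lemma small_of_sign_changes:
  assumes "\<And>i. \<exists>l<d. pact i z l \<le> 0" "\<And>i. \<exists>l<d. pact i z l \<ge> 0"
  shows "small z"
  unfolding small_def
proof (intro allI impI)
  fix l assume l: "l < d"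
  obtain \<delta> D where \<delta>: "0 < \<delta>" "\<delta> \<le> 1"
    and osc: "\<And>i. \<exists>a b. b - a \<le> (1 - \<delta>) ^ i * D \<and>
       (\<forall>l<d. a * prow i l \<le> pact i z l \<and> pact i z l \<le> b * prow i l)"
    by (rule ratio_oscillation[of z]) blast
  have bound: "norm (pact i z l / prow i l) \<le> (1 - \<delta>) ^ i * D" for i
  proof -
    obtain a b where ab: "b - a \<le> (1 - \<delta>) ^ i * D"
      "\<forall>l<d. a * prow i l \<le> pact i z l \<and> pact i z l \<le> b * prow i l"
      using osc by blast
    obtain l1 l2 where "l1 < d" "pact i z l1 \<le> 0" "l2 < d" "pact i z l2 \<ge> 0"
      using assms by blast
    then have "a * prow i l1 \<le> 0" "0 \<le> b * prow i l2" using ab(2) by fastforce+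
    then have "a \<le> 0" "b \<ge> 0"
      using pf_row_K_pos[OF \<open>l1 < d\<close>, of i] pf_row_K_pos[OF \<open>l2 < d\<close>, of i]
      by (auto simp: mult_le_0_iff zero_le_mult_iff)
    moreover have "a \<le> pact i z l / prow i l" "pact i z l / prow i l \<le> b"
      using ab(2) l pf_row_K_pos[OF l, of i] by (auto simp: field_simps)
    ultimately show ?thesis using ab(1) by (auto simp: abs_le_iff)
  qed
  have "(\<lambda>i. (1 - \<delta>) ^ i * D) \<longlonglongrightarrow> 0"
    using \<delta> by (intro tendsto_mult_left_zero LIMSEQ_power_zero) auto
  then show "(\<lambda>i. pact i z l / prow i l) \<longlonglongrightarrow> 0"
    by (rule Lim_null_comparison[rotated]) (use bound in auto)
qed

text \<open>S commutes with its powers, and exchanging the denominators of two coordinates costs at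
  most a factor \<open>cbound\<close>. Together with \<open>small_sum\<close> the small vectors thus
  form an invariant subspace.\<close>

lemma small_mat_act_1:
  assumes "small z" shows "small (mat_act 1 z)"
  unfolding small_def
proof (intro allI impI)
  fix l assume l: "l < d"
  have bound: "norm (pact i (mat_act 1 z) l / prow i l)
     \<le> (\<Sum>q<d. real (cnt 1 l q) * (cbound * \<bar>pact i z q / prow i q\<bar>))" for i
  proof -
    have "pact i (mat_act 1 z) l = mat_act 1 (pact i z) l"
      using mat_act_add[of "K * i" 1 z l] mat_act_add[of 1 "K * i" z l] by (simp add: add.commute)
    then have "norm (pact i (mat_act 1 z) l / prow i l)
       = \<bar>\<Sum>q<d. real (cnt 1 l q) * (pact i z q / prow i l)\<bar>"
      by (simp only: mat_act_def[of 1] sum_divide_distrib times_divide_eq_right real_norm_def)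
    also have "\<dots> \<le> (\<Sum>q<d. \<bar>real (cnt 1 l q) * (pact i z q / prow i l)\<bar>)" by (rule sum_abs)
    also have "\<dots> \<le> (\<Sum>q<d. real (cnt 1 l q) * (cbound * \<bar>pact i z q / prow i q\<bar>))"
    proof (rule sum_mono)
      fix q assume "q \<in> {..<d}"
      then have q: "q < d" by simp
      have "prow i q \<le> cbound * prow i l" by (rule pf_row_comparable[OF l q])
      then have "1 / prow i l \<le> cbound / prow i q"
        using pf_row_K_pos[OF l, of i] pf_row_K_pos[OF q, of i] by (simp add: field_simps)
      then have "\<bar>pact i z q\<bar> * (1 / prow i l) \<le> \<bar>pact i z q\<bar> * (cbound / prow i q)"
        by (rule mult_left_mono) simp
      then have "\<bar>pact i z q / prow i l\<bar> \<le> cbound * \<bar>pact i z q / prow i q\<bar>"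
        using pf_row_K_pos[OF l, of i] pf_row_K_pos[OF q, of i] by (simp add: abs_divide mult.commute)
      then show "\<bar>real (cnt 1 l q) * (pact i z q / prow i l)\<bar>
        \<le> real (cnt 1 l q) * (cbound * \<bar>pact i z q / prow i q\<bar>)"
        by (simp only: abs_mult abs_of_nat) (intro mult_left_mono; simp)
    qed
    finally show ?thesis .
  qed
  have "(\<lambda>i. \<Sum>q<d. real (cnt 1 l q) * (cbound * \<bar>pact i z q / prow i q\<bar>)) \<longlonglongrightarrow> 0"
    using assms unfolding small_def
    by (intro tendsto_null_sum tendsto_mult_right_zero tendsto_rabs_zero) auto
  then show "(\<lambda>i. pact i (mat_act 1 z) l / prow i l) \<longlonglongrightarrow> 0"
    by (rule Lim_null_comparison[rotated]) (use bound in auto)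
qed

lemma small_sum:
  assumes "\<And>p. p < n \<Longrightarrow> small (z p)"
  shows "small (\<lambda>l. \<Sum>p<n. z p l * x p)"
  unfolding small_def
proof (intro allI impI)
  fix l assume l: "l < d"
  have "pact i (\<lambda>l. \<Sum>p<n. z p l * x p) l / prow i l
     = (\<Sum>p<n. pact i (z p) l / prow i l * x p)" for i
    unfolding mat_act_def sum_distrib_left sum_distrib_right sum_divide_distrib
    by (subst sum.swap) (simp add: mult_ac)
  moreover have "(\<lambda>i. \<Sum>p<n. pact i (z p) l / prow i l * x p) \<longlonglongrightarrow> 0"
    using assms l unfolding small_def by (intro tendsto_null_sum tendsto_mult_left_zero) auto
  ultimately show "(\<lambda>i. pact i (\<lambda>l. \<Sum>p<n. z p l * x p) l / prow i l) \<longlonglongrightarrow> 0" by simp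
qed

lemma mat_act_cong: "(\<And>j. j < d \<Longrightarrow> z j = z' j) \<Longrightarrow> mat_act n z l = mat_act n z' l"
  unfolding mat_act_def by (intro sum.cong) auto

lemma not_small_one: "\<not> (small z \<and> (\<forall>l<d. z l = 1))"
proof
  assume *: "small z \<and> (\<forall>l<d. z l = 1)"
  have "pact i z 0 / prow i 0 = 1" for i
    using mat_act_cong[of z "\<lambda>_. 1" "K * i" 0] * pf_row_K_pos[of 0 i] d_pos by (simp add: pf_row_eq)
  moreover have "(\<lambda>i. pact i z 0 / prow i 0) \<longlonglongrightarrow> 0"
    using * d_pos unfolding small_def by simp
  ultimately have "(\<lambda>_::nat. 1::real) \<longlonglongrightarrow> 0" by (simp only:)
  then show False by (simp add: LIMSEQ_const_iff)
qed

text \<open>An invariant subspace containing a nonzero integer vector contains, by cyclicity, the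
  all-ones vector; but the ratios of that vector are constantly 1.\<close>

lemma not_small_int:
  fixes m :: "nat \<Rightarrow> int"
  assumes irr: "irreducible (char_poly (map_mat rat_of_int (subst_matrix d \<zeta>)))"
    and m: "\<exists>j<d. m j \<noteq> 0"
  shows "\<not> small (\<lambda>j. real_of_int (m j))"
proof
  assume small: "small (\<lambda>j. real_of_int (m j))"
  let ?A = "map_mat rat_of_int (subst_matrix d \<zeta>)"
  have A: "?A \<in> carrier_mat d d" by (simp add: subst_matrix_def)
  define w where "w n = vec d (\<lambda>l. \<Sum>j<d. rat_of_int (int (cnt n l j) * m j))" for n
  have "\<exists>x. \<forall>l<d. (\<Sum>j<d. w j $ l * x j) = vec d (\<lambda>_. 1) $ l"
  proof (rule cyclic_of_irreducible_char_poly[OF A irr])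
    show "w j \<in> carrier_vec d" for j by (simp add: w_def)
    show "?A *\<^sub>v w n = w (Suc n)" for n
    proof (rule eq_vecI)
      fix l assume "l < dim_vec (w (Suc n))"
      then have l: "l < d" by (simp add: w_def)
      have "(?A *\<^sub>v w n) $ l = (\<Sum>q<d. \<Sum>j<d. rat_of_int (int (cnt 1 l q) * int (cnt n q j) * m j))"
        using l by (simp add: w_def scalar_prod_def atLeast0LessThan subst_matrix_def cnt_1[unfolded One_nat_def]
            sum_distrib_left mult.assoc)
      also have "\<dots> = (\<Sum>j<d. rat_of_int (int (\<Sum>q<d. cnt 1 l q * cnt n q j) * m j))"
        by (subst sum.swap) (simp add: sum_distrib_right)
      also have "\<dots> = w (Suc n) $ l"
        using l cnt_add[of _ 1 n l] by (simp add: w_def)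
      finally show "(?A *\<^sub>v w n) $ l = w (Suc n) $ l" .
    qed (simp add: w_def subst_matrix_def)
    have w0: "w 0 $ l = rat_of_int (m l)" if "l < d" for l
      using that by (simp add: w_def cnt_0 of_bool_def if_distrib[of "\<lambda>x. x * _"] if_distrib[of int] if_distrib[of rat_of_int] cong: if_cong)
    show "w 0 \<noteq> 0\<^sub>v d"
    proof
      assume "w 0 = 0\<^sub>v d"
      then have "m l = 0" if "l < d" for l using w0[OF that] that by simp
      then show False using m by auto
    qed
  qed simp
  then obtain x where x: "\<And>l. l < d \<Longrightarrow> (\<Sum>j<d. w j $ l * x j) = 1" by auto
  define z where "z p = mat_act p (\<lambda>j. real_of_int (m j))" for p
  have "small (z p)" for p
  proof (induction p)
    case 0
    have "mat_act n (z 0) l = mat_act n (\<lambda>j. real_of_int (m j)) l" for n l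
      by (rule mat_act_cong) (simp add: z_def mat_act_0)
    then show ?case using small by (simp add: small_def)
  next
    case (Suc p)
    have "z (Suc p) = mat_act 1 (z p)"
      using mat_act_add[of 1 p] by (auto simp: z_def fun_eq_iff)
    then show ?case using small_mat_act_1[OF Suc] by simp
  qed
  then have "small (\<lambda>l. \<Sum>p<d. z p l * of_rat (x p))" by (intro small_sum)
  moreover have "(\<Sum>p<d. z p l * of_rat (x p)) = 1" if l: "l < d" for l
  proof -
    have "z p l = of_rat (w p $ l)" for p
      using l by (simp add: z_def w_def mat_act_def of_rat_sum of_rat_mult)
    then have "(\<Sum>p<d. z p l * of_rat (x p)) = of_rat (\<Sum>p<d. w p $ l * x p)"
      by (simp add: of_rat_sum of_rat_mult)
    then show ?thesis using x[OF l] by simp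
  qed
  ultimately show False using not_small_one by blast
qed

text \<open>The sum is the coordinate sum of S^(K n) m. As m is not small, some iterate is strictly
  positive or strictly negative in all coordinates, and from there \<open>cnt_strict_cone\<close>
  applies to it or to its negative.\<close>

theorem length_combination_growth:
  fixes m :: "nat \<Rightarrow> int"
  assumes irr: "irreducible (char_poly (map_mat rat_of_int (subst_matrix d \<zeta>)))"
    and m: "\<exists>j<d. m j \<noteq> 0"
  shows "\<exists>n0. \<forall>n\<ge>n0. \<bar>\<Sum>b<d. m b * int (length (sw (K * n) b))\<bar>
     < \<bar>\<Sum>b<d. m b * int (length (sw (K * Suc n) b))\<bar>"
proof -
  define v where "v i l = (\<Sum>j<d. int (cnt (K * i) l j) * m j)" for i l
  have v_Suc: "v (Suc i) l = (\<Sum>j<d. int (cnt K l j) * v i j)" for i l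
  proof -
    have "v (Suc i) l = (\<Sum>j<d. \<Sum>q<d. int (cnt K l q) * int (cnt (K * i) q j) * m j)"
      unfolding v_def using cnt_add[of _ K "K * i" l] by (intro sum.cong) (auto simp: sum_distrib_right)
    also have "\<dots> = (\<Sum>j<d. int (cnt K l j) * v i j)"
      unfolding v_def sum_distrib_left by (subst sum.swap) (simp add: mult.assoc)
    finally show ?thesis .
  qed
  have sum_v: "(\<Sum>b<d. m b * int (length (sw (K * n) b))) = (\<Sum>l<d. v n l)" for n
    unfolding v_def by (subst sum.swap) (auto simp: length_sw sum_distrib_left mult.commute intro!: sum.cong)
  have real_v: "real_of_int (v i l) = pact i (\<lambda>j. real_of_int (m j)) l" for i l
    by (simp add: v_def mat_act_def)
  have "\<exists>i. (\<forall>l<d. v i l > 0) \<or> (\<forall>l<d. v i l < 0)"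
  proof (rule ccontr)
    assume "\<not> ?thesis"
    then have *: "\<exists>l<d. v i l \<le> 0" "\<exists>l<d. v i l \<ge> 0" for i by (meson not_less)+
    have "small (\<lambda>j. real_of_int (m j))"
      by (rule small_of_sign_changes) (use * in \<open>auto simp flip: real_v\<close>)
    then show False using not_small_int[OF irr m] by blast
  qed
  then obtain i0 where i0: "(\<forall>l<d. v i0 l > 0) \<or> (\<forall>l<d. v i0 l < 0)" ..
  show ?thesis
  proof (intro exI[of _ i0] allI impI)
    fix n assume n: "n \<ge> i0"
    from i0 show "\<bar>\<Sum>b<d. m b * int (length (sw (K * n) b))\<bar>
     < \<bar>\<Sum>b<d. m b * int (length (sw (K * Suc n) b))\<bar>"
    proof
      assume "\<forall>l<d. v i0 l > 0"
      then show ?thesis unfolding sum_v using cnt_strict_cone[OF K, of v i0 n] v_Suc n by simp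
    next
      assume neg: "\<forall>l<d. v i0 l < 0"
      have "- v (Suc i) l = (\<Sum>j<d. int (cnt K l j) * - v i j)" for i l
        unfolding v_Suc by (simp add: sum_negf)
      with cnt_strict_cone[OF K, of "\<lambda>i l. - v i l" i0 n] neg n
      show ?thesis unfolding sum_v by (simp add: sum_negf)
    qed
  qed
qed

end

end

section \<open>Equidistribution of integer sequences\<close>

lemma has_bochner_integral_cos_period:
  fixes k :: int
  shows "has_bochner_integral lborel (\<lambda>t. cos (2 * pi * k * t) * indicator {0..1} t) (of_bool (k = 0))"
proof (cases "k = 0")
  case True
  have "has_bochner_integral lborel (\<lambda>t::real. 1 * indicator {0..1} t :: real) ((1::real) - 0)"
    by (rule has_bochner_integral_FTC_Icc_real[where F = "\<lambda>t. t" and f = "\<lambda>_. 1"])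
       (auto intro!: derivative_eq_intros)
  then show ?thesis using True by simp
next
  case False
  have "has_bochner_integral lborel (\<lambda>t. cos (2 * pi * k * t) * indicator {0..1} t)
     (sin (2 * pi * k * 1) / (2 * pi * k) - sin (2 * pi * k * 0) / (2 * pi * k))"
    by (rule has_bochner_integral_FTC_Icc_real[where F = "\<lambda>t. sin (2 * pi * k * t) / (2 * pi * k)"])
       (use False in \<open>auto intro!: derivative_eq_intros continuous_intros\<close>)
  then show ?thesis using False by simp
qed

lemma has_bochner_integral_sin_period:
  fixes k :: int
  shows "has_bochner_integral lborel (\<lambda>t. sin (2 * pi * k * t) * indicator {0..1} t) 0"
proof (cases "k = 0")
  case False
  have "has_bochner_integral lborel (\<lambda>t. sin (2 * pi * k * t) * indicator {0..1} t)
     ((- cos (2 * pi * k * 1)) / (2 * pi * k) - (- cos (2 * pi * k * 0)) / (2 * pi * k))"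
    by (rule has_bochner_integral_FTC_Icc_real[where F = "\<lambda>t. (- cos (2 * pi * k * t)) / (2 * pi * k)"])
       (use False in \<open>auto intro!: derivative_eq_intros continuous_intros\<close>)
  then show ?thesis using False by simp
qed (simp add: has_bochner_integral_zero)

lemma has_bochner_integral_cis_period:
  fixes k :: int
  shows "has_bochner_integral lborel (\<lambda>t. indicator {0..1} t *\<^sub>R cis (2 * pi * k * t)) (of_bool (k = 0))"
proof -
  have "has_bochner_integral lborel (\<lambda>t. complex_of_real (cos (2 * pi * k * t) * indicator {0..1} t)
      + \<i> * complex_of_real (sin (2 * pi * k * t) * indicator {0..1} t))
      (complex_of_real (of_bool (k = 0)) + \<i> * complex_of_real 0)"
    by (intro has_bochner_integral_add has_bochner_integral_mult_right has_bochner_integral_of_real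
        has_bochner_integral_cos_period has_bochner_integral_sin_period)
  moreover have "(\<lambda>t. complex_of_real (cos (2 * pi * k * t) * indicator {0..1} t)
      + \<i> * complex_of_real (sin (2 * pi * k * t) * indicator {0..1} t))
     = (\<lambda>t. indicator {0..1} t *\<^sub>R cis (2 * pi * k * t))"
    by (auto simp: fun_eq_iff complex_eq_iff)
  moreover have "complex_of_real (of_bool (k = 0)) + \<i> * complex_of_real 0 = of_bool (k = 0)" by simp
  ultimately show ?thesis by (simp only:)
qed

lemma norm_sum_cis_sq:
  "(cmod (\<Sum>n<N. cis (x n)))\<^sup>2 = (\<Sum>m<N. \<Sum>n<N. cos (x m - x n))"
proof -
  have "(cmod (\<Sum>n<N. cis (x n)))\<^sup>2 = (\<Sum>n<N. cos (x n))\<^sup>2 + (\<Sum>n<N. sin (x n))\<^sup>2"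
    by (simp add: cmod_power2 Re_sum Im_sum)
  also have "\<dots> = (\<Sum>m<N. \<Sum>n<N. cos (x m - x n))"
    by (simp add: power2_eq_square sum_product cos_diff sum.distrib)
  finally show ?thesis .
qed

text \<open>From n0 on, the strict growth of the absolute values lets each value occur at most once;
  the first n0 indices are simply counted.\<close>

lemma coincidence_card:
  fixes b :: "nat \<Rightarrow> int"
  assumes "\<And>n. n \<ge> n0 \<Longrightarrow> \<bar>b n\<bar> < \<bar>b (Suc n)\<bar>"
  shows "card {n. n < N \<and> b n = v} \<le> n0 + 1"
proof -
  have less: "\<bar>b m\<bar> < \<bar>b n\<bar>" if "m \<ge> n0" "m < n" for m n
    using that(2)
  proof (induction n)
    case (Suc n)
    then show ?case using assms[of n] that(1) by (cases "m = n") auto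
  qed simp
  have "card {n. n \<ge> n0 \<and> n < N \<and> b n = v} \<le> 1"
  proof -
    have "m = n" if "m \<ge> n0" "n \<ge> n0" "b m = v" "b n = v" for m n
      using less[of m n] less[of n m] that by (cases m n rule: linorder_cases) auto
    then show ?thesis
      by (simp add: card_le_Suc0_iff_eq)
  qed
  moreover have "{n. n < N \<and> b n = v} \<subseteq> {..<n0} \<union> {n. n \<ge> n0 \<and> n < N \<and> b n = v}" by auto
  then have "card {n. n < N \<and> b n = v} \<le> card ({..<n0} \<union> {n. n \<ge> n0 \<and> n < N \<and> b n = v})"
    by (intro card_mono) auto
  moreover have "\<dots> \<le> n0 + card {n. n \<ge> n0 \<and> n < N \<and> b n = v}"
    using card_Un_le[of "{..<n0}" "{n. n \<ge> n0 \<and> n < N \<and> b n = v}"] by simp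
  ultimately show ?thesis by linarith
qed

text \<open>By orthogonality the integral counts the pairs (m,n) with b m = b n, and for each m
  there are at most n0 + 1 of them.\<close>

lemma weyl_second_moment:
  fixes b :: "nat \<Rightarrow> int"
  assumes "\<And>n. n \<ge> n0 \<Longrightarrow> \<bar>b n\<bar> < \<bar>b (Suc n)\<bar>"
  shows "(\<integral>\<^sup>+ t. ennreal ((cmod (\<Sum>n<N. cis (2 * pi * b n * t)))\<^sup>2 * indicator {0..1} t) \<partial>lborel)
     \<le> ennreal (real N * (real n0 + 1))"
proof -
  have eq: "(cmod (\<Sum>n<N. cis (2 * pi * b n * t)))\<^sup>2 * indicator {0..1} t
     = (\<Sum>m<N. \<Sum>n<N. cos (2 * pi * (b m - b n) * t) * indicator {0..1} t)" for t
    by (cases "t \<in> {0..1}"; subst norm_sum_cis_sq) (simp_all add: algebra_simps)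
  have "has_bochner_integral lborel (\<lambda>t. (cmod (\<Sum>n<N. cis (2 * pi * b n * t)))\<^sup>2 * indicator {0..1} t)
     (\<Sum>m<N. \<Sum>n<N. of_bool (b m - b n = 0))"
    unfolding eq using has_bochner_integral_cos_period[of "b m - b n" for m n]
    by (intro has_bochner_integral_sum) auto
  then have "(\<integral>\<^sup>+ t. ennreal ((cmod (\<Sum>n<N. cis (2 * pi * b n * t)))\<^sup>2 * indicator {0..1} t) \<partial>lborel)
     = ennreal (\<Sum>m<N. \<Sum>n<N. of_bool (b m - b n = 0))"
    by (subst nn_integral_eq_integral) (auto simp: has_bochner_integral_iff)
  also have "\<dots> \<le> ennreal (\<Sum>m<N. real n0 + 1)"
  proof (intro ennreal_leI sum_mono)
    fix m
    have "(\<Sum>n<N. of_bool (b m - b n = 0)) = real (card {n. n < N \<and> b n = b m})"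
    proof -
      have "(\<Sum>n<N. of_bool (b m - b n = 0)) = (\<Sum>n\<in>{n. n < N \<and> b n = b m}. 1::real)"
        by (intro sum.mono_neutral_cong_right) auto
      then show ?thesis by simp
    qed
    also have "\<dots> \<le> real n0 + 1" using coincidence_card[of n0 b N "b m", OF assms] by simp
    finally show "(\<Sum>n<N. of_bool (b m - b n = 0)) \<le> real n0 + 1" .
  qed
  finally show ?thesis by simp
qed

text \<open>As in the Davenport--Erdos--LeVeque theorem: the second moment is summable along the squares, and
  the gaps between consecutive squares are negligible.\<close>
theorem weyl_ae:
  fixes b :: "nat \<Rightarrow> int"
  assumes "\<And>n. n \<ge> n0 \<Longrightarrow> \<bar>b n\<bar> < \<bar>b (Suc n)\<bar>"
  shows "AE t in lborel. t \<in> {0..1} \<longrightarrow> (\<lambda>N. (\<Sum>n<N. cis (2 * pi * b n * t)) / of_nat N) \<longlonglongrightarrow> 0"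
proof -
  define s where "s N t = (\<Sum>n<N. cis (2 * pi * b n * t))" for N t
  define X where "X k t = (cmod (s ((Suc k)\<^sup>2) t))\<^sup>2 / real (Suc k) ^ 4 * indicator {0..1} t" for k t
  have [measurable]: "s N \<in> borel_measurable borel" for N
    unfolding s_def by (intro borel_measurable_continuous_onI continuous_intros)
  have [measurable]: "X k \<in> borel_measurable borel" for k unfolding X_def by measurable
  have X_nonneg: "X k t \<ge> 0" for k t by (simp add: X_def)
  have "(\<integral>\<^sup>+ t. ennreal (X k t) \<partial>lborel) \<le> ennreal ((real n0 + 1) * inverse (real (Suc k) ^ 2))" for k
  proof -
    have "(\<integral>\<^sup>+ t. ennreal (X k t) \<partial>lborel)
       = (\<integral>\<^sup>+ t. ennreal (inverse (real (Suc k) ^ 4)) * ennreal ((cmod (s ((Suc k)\<^sup>2) t))\<^sup>2 * indicator {0..1} t) \<partial>lborel)"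
      by (intro nn_integral_cong) (auto simp: X_def ennreal_mult[symmetric] field_simps)
    also have "\<dots> = ennreal (inverse (real (Suc k) ^ 4)) * (\<integral>\<^sup>+ t. ennreal ((cmod (s ((Suc k)\<^sup>2) t))\<^sup>2 * indicator {0..1} t) \<partial>lborel)"
      by (intro nn_integral_cmult) measurable
    also have "\<dots> \<le> ennreal (inverse (real (Suc k) ^ 4)) * ennreal (real ((Suc k)\<^sup>2) * (real n0 + 1))"
      unfolding s_def by (intro mult_left_mono weyl_second_moment assms) auto
    also have "\<dots> = ennreal ((real n0 + 1) * inverse (real (Suc k) ^ 2))"
    proof -
      have "inverse (x ^ 4) * (x\<^sup>2 * c) = c * inverse (x\<^sup>2)" if "x > 0" for x c :: real
        using that by (simp add: field_simps power4_eq_xxxx power2_eq_square)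
      from this[of "real (Suc k)"] show ?thesis
        by (subst ennreal_mult[symmetric]) (auto simp del: of_nat_Suc)
    qed
    finally show ?thesis .
  qed
  then have "(\<Sum>k. \<integral>\<^sup>+ t. ennreal (X k t) \<partial>lborel) \<le> (\<Sum>k. ennreal ((real n0 + 1) * inverse (real (Suc k) ^ 2)))"
    by (intro suminf_le) auto
  also have "\<dots> < \<infinity>"
  proof -
    have "summable (\<lambda>k. (real n0 + 1) * inverse (real (Suc k) ^ 2))"
      using inverse_power_summable[of 2, where 'a = real] by (intro summable_mult, subst summable_Suc_iff) auto
    then show ?thesis by (subst suminf_ennreal2) auto
  qed
  finally have "(\<integral>\<^sup>+ t. (\<Sum>k. ennreal (X k t)) \<partial>lborel) \<noteq> \<infinity>"
    by (subst nn_integral_suminf) auto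
  then have "AE t in lborel. (\<Sum>k. ennreal (X k t)) \<noteq> \<infinity>"
    by (intro nn_integral_noteq_infinite) auto
  then show ?thesis
  proof eventually_elim
    case (elim t)
    show ?case
    proof
      assume t: "t \<in> {0..1}"
      have "(\<lambda>k. X k t) \<longlonglongrightarrow> 0"
        using elim X_nonneg by (intro summable_LIMSEQ_zero summable_suminf_not_top) auto
      then have "(\<lambda>k. sqrt (X k t)) \<longlonglongrightarrow> sqrt 0" by (intro tendsto_intros)
      moreover have "sqrt (X k t) = cmod (s ((Suc k)\<^sup>2) t) / real (Suc k) ^ 2" for k
        using t by (simp add: X_def real_sqrt_divide power4_eq_xxxx real_sqrt_mult power2_eq_square del: of_nat_Suc)
      ultimately have "(\<lambda>k. cmod (s ((Suc k)\<^sup>2) t) / real (Suc k) ^ 2) \<longlonglongrightarrow> 0" by simp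
      then have "(\<lambda>k. cmod (s (k\<^sup>2) t) / real k ^ 2) \<longlonglongrightarrow> 0"
        by (subst (asm) filterlim_sequentially_Suc)
      moreover have "(\<lambda>k. 2 * real k / real k ^ 2) \<longlonglongrightarrow> 0"
      proof -
        have "(\<lambda>k. 2 * (1 / real k)) \<longlonglongrightarrow> 2 * 0" by (intro tendsto_mult tendsto_const lim_1_over_n)
        moreover have "2 * (1 / real k) = 2 * real k / real k ^ 2" for k by (simp add: power2_eq_square)
        ultimately show ?thesis by simp
      qed
      ultimately have L: "(\<lambda>k. cmod (s (k\<^sup>2) t) / real k ^ 2 + 2 * real k / real k ^ 2) \<longlonglongrightarrow> 0"
        using tendsto_add by fastforce
      have "filterlim floor_sqrt at_top at_top"
        unfolding filterlim_at_top
        by (auto intro!: le_floor_sqrtI eventually_mono[OF eventually_ge_at_top])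
      from filterlim_compose[OF L this] have lim: "(\<lambda>N. cmod (s ((floor_sqrt N)\<^sup>2) t) / real (floor_sqrt N) ^ 2
           + 2 * real (floor_sqrt N) / real (floor_sqrt N) ^ 2) \<longlonglongrightarrow> 0"
        .
      have bound: "norm (s N t / of_nat N) \<le> cmod (s ((floor_sqrt N)\<^sup>2) t) / real (floor_sqrt N) ^ 2
           + 2 * real (floor_sqrt N) / real (floor_sqrt N) ^ 2" if "N > 0" for N
      proof -
        define k where "k = floor_sqrt N"
        have k: "k > 0" "k\<^sup>2 \<le> N" "N < (Suc k)\<^sup>2"
          using that Suc_floor_sqrt_power2_gt[of N] by (auto simp: k_def)
        have "s N t = s (k\<^sup>2) t + (\<Sum>n=k\<^sup>2..<N. cis (2 * pi * b n * t))"
          using k(2) unfolding s_def by (metis lessThan_atLeast0 sum.atLeastLessThan_concat zero_le)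
        moreover have "cmod (\<Sum>n=k\<^sup>2..<N. cis (2 * pi * b n * t)) \<le> real (N - k\<^sup>2)"
          using sum_norm_le[of "{k\<^sup>2..<N}" "\<lambda>n. cis (2 * pi * b n * t)" "\<lambda>_. 1"] by simp
        moreover have "N - k\<^sup>2 \<le> 2 * k" using k(3) by (simp add: power2_eq_square)
        ultimately have "cmod (s N t) \<le> cmod (s (k\<^sup>2) t) + 2 * real k"
          using norm_triangle_ineq[of "s (k\<^sup>2) t" "\<Sum>n=k\<^sup>2..<N. cis (2 * pi * b n * t)"]
            of_nat_mono[of "N - k\<^sup>2" "2 * k", where 'a = real] by simp
        then have "cmod (s N t) / real N \<le> (cmod (s (k\<^sup>2) t) + 2 * real k) / real (k\<^sup>2)"
          using k by (intro frac_le) auto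
        then show ?thesis by (simp add: norm_divide k_def add_divide_distrib)
      qed
      show "(\<lambda>N. (\<Sum>n<N. cis (2 * pi * b n * t)) / of_nat N) \<longlonglongrightarrow> 0"
        unfolding s_def[symmetric]
        by (rule Lim_null_comparison[OF _ lim]) (use bound in \<open>auto intro!: eventually_mono[OF eventually_gt_at_top[of 0]]\<close>)
    qed
  qed
qed

section \<open>Herglotz's theorem\<close>

text \<open>N times the Fejer mean of the Fourier series with coefficients c. Its nonnegativity is
  positive definiteness tested on vectors of exponentials.\<close>

definition toeplitz_form :: "(int \<Rightarrow> complex) \<Rightarrow> nat \<Rightarrow> real \<Rightarrow> complex" where
  "toeplitz_form c N t = (\<Sum>m<N. \<Sum>n<N. cis (- 2 * pi * of_int (int m - int n) * t) * c (int m - int n))"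

lemma continuous_on_toeplitz_form [continuous_intros]: "continuous_on A (toeplitz_form c N)"
  unfolding toeplitz_form_def by (intro continuous_intros)

lemma exp_eq_cis_int: "exp (2 * pi * \<i> * of_int n * complex_of_real t) = cis (2 * pi * n * t)"
  by (simp add: cis_conv_exp mult_ac)

lemma toeplitz_form_fourier:
  "has_bochner_integral lborel (\<lambda>t. indicator {0..1} t *\<^sub>R (cis (2 * pi * of_int k * t) * toeplitz_form c N t))
     (c k * of_nat (\<Sum>m<N. \<Sum>n<N. of_bool (int m - int n = k)))"
proof -
  have eq: "indicator {0..1} t *\<^sub>R (cis (2 * pi * of_int k * t) * toeplitz_form c N t)
     = (\<Sum>m<N. \<Sum>n<N. c (int m - int n) * (indicator {0..1} t *\<^sub>R cis (2 * pi * of_int (k - (int m - int n)) * t)))" for t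
  proof -
    have "cis (2 * pi * of_int k * t) * (cis (- 2 * pi * of_int j * t) * c j) = c j * cis (2 * pi * of_int (k - j) * t)" for j
      by (simp add: cis_mult mult.assoc[symmetric]) (simp add: algebra_simps)
    then show ?thesis
      unfolding toeplitz_form_def sum_distrib_left scaleR_sum_right
      by (intro sum.cong refl) (simp only: mult_scaleR_right)
  qed
  have "c k * of_nat (\<Sum>m<N. \<Sum>n<N. of_bool (int m - int n = k))
     = (\<Sum>m<N. \<Sum>n<N. c (int m - int n) * of_bool (k - (int m - int n) = 0))"
    unfolding of_nat_sum sum_distrib_left by (intro sum.cong refl) auto
  then show ?thesis
    unfolding eq
    by (simp only:) (intro has_bochner_integral_sum has_bochner_integral_mult_right has_bochner_integral_cis_period)
qed

text \<open>For each m at most one n qualifies, and exactly one does unless m is within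
  \<open>\<bar>k\<bar>\<close> of an end. The bound is crude; all that matters is that the ratio to
  N tends to 1.\<close>

lemma count_diff_bounds:
  "\<bar>real (\<Sum>m<N. \<Sum>n<N. of_bool (int m - int n = k)) - real N\<bar> \<le> 2 * real_of_int \<bar>k\<bar>"
proof -
  define J where "J = nat \<bar>k\<bar>"
  have inner: "(\<Sum>n<N. of_bool (int m - int n = k)) = (of_bool (int m - k \<ge> 0 \<and> int m - k < int N) :: nat)" for m
  proof -
    have "(\<Sum>n<N. of_bool (int m - int n = k)) = (\<Sum>n\<in>{n. n < N \<and> int m - int n = k}. 1::nat)"
      by (intro sum.mono_neutral_cong_right) auto
    also have "{n. n < N \<and> int m - int n = k} = (if int m - k \<ge> 0 \<and> int m - k < int N then {nat (int m - k)} else {})"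
      by auto
    finally show ?thesis by auto
  qed
  let ?A = "{m. m < N \<and> int m - k \<ge> 0 \<and> int m - k < int N}"
  have "(\<Sum>m<N. \<Sum>n<N. of_bool (int m - int n = k)) = (\<Sum>m\<in>?A. 1::nat)"
    unfolding inner by (intro sum.mono_neutral_cong_right) auto
  then have eq: "(\<Sum>m<N. \<Sum>n<N. of_bool (int m - int n = k)) = card ?A" by simp
  have "card ?A \<le> card {..<N}" by (intro card_mono) auto
  moreover have "card {..<N} \<le> card (?A \<union> {..<J} \<union> {N-J..<N})"
    by (intro card_mono) (auto simp: J_def)
  moreover have "card (?A \<union> {..<J} \<union> {N-J..<N}) \<le> card ?A + J + (N - (N - J))"
    using card_Un_le[of "?A \<union> {..<J}" "{N-J..<N}"] card_Un_le[of ?A "{..<J}"] by simp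
  moreover have "N - (N - J) \<le> J" by simp
  ultimately have "card ?A \<le> N" "N \<le> card ?A + 2 * J" by auto
  then have "\<bar>real (card ?A) - real N\<bar> \<le> 2 * real J" by linarith
  then show ?thesis unfolding eq by (simp add: J_def)
qed

lemma count_diff_ratio:
  "(\<lambda>N. real (\<Sum>m<Suc N. \<Sum>n<Suc N. of_bool (int m - int n = k)) / real (Suc N)) \<longlonglongrightarrow> 1"
proof (rule LIM_zero_cancel, rule Lim_null_comparison)
  show "\<forall>\<^sub>F N in sequentially. norm (real (\<Sum>m<Suc N. \<Sum>n<Suc N. of_bool (int m - int n = k)) / real (Suc N) - 1)
      \<le> 2 * real_of_int \<bar>k\<bar> * inverse (real (Suc N))"
  proof (intro always_eventually allI)
    fix N
    define x where "x = real (\<Sum>m<Suc N. \<Sum>n<Suc N. of_bool (int m - int n = k))"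
    have "x / real (Suc N) - 1 = (x - real (Suc N)) * inverse (real (Suc N))" by (simp add: field_simps)
    then have "norm (x / real (Suc N) - 1) = \<bar>x - real (Suc N)\<bar> * inverse (real (Suc N))"
      by (simp add: abs_mult)
    also have "\<dots> \<le> 2 * real_of_int \<bar>k\<bar> * inverse (real (Suc N))"
      unfolding x_def by (intro mult_right_mono count_diff_bounds) auto
    finally show "norm (real (\<Sum>m<Suc N. \<Sum>n<Suc N. of_bool (int m - int n = k)) / real (Suc N) - 1)
      \<le> 2 * real_of_int \<bar>k\<bar> * inverse (real (Suc N))" unfolding x_def .
  qed
  show "(\<lambda>N. 2 * real_of_int \<bar>k\<bar> * inverse (real (Suc N))) \<longlonglongrightarrow> 0"
    using tendsto_mult[OF tendsto_const LIMSEQ_inverse_real_of_nat] by fastforce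
qed

lemma count_diff_zero: "(\<Sum>m<N. \<Sum>n<N. of_bool (int m - int n = 0)) = N"
proof -
  have "(\<Sum>n<N. of_bool (int m - int n = 0)) = (1::nat)" if "m < N" for m
  proof -
    have "(\<Sum>n<N. of_bool (int m - int n = 0)) = (\<Sum>n\<in>{m}. 1::nat)"
      using that by (intro sum.mono_neutral_cong_right) auto
    then show ?thesis by simp
  qed
  then show ?thesis by simp
qed

text \<open>Normalized Fejer means are probability densities on [0,1] whose k-th coefficient tends
  to c k / c 0. Tightness supplies a weak limit along a subsequence, and integer characters are
  bounded and continuous, so the limit has exactly these coefficients.\<close>

theorem herglotz:
  fixes c :: "int \<Rightarrow> complex"
  assumes psd: "\<And>N t. Im (toeplitz_form c N t) = 0 \<and> Re (toeplitz_form c N t) \<ge> 0"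
    and zero: "c 0 = 0 \<Longrightarrow> (\<And>n. c n = 0)"
  shows "\<exists>\<sigma>::real measure. sets \<sigma> = sets borel \<and> finite_measure \<sigma> \<and> emeasure \<sigma> (UNIV - {0..<1}) = 0 \<and>
     (\<forall>n::int. integrable \<sigma> (\<lambda>t. cis (2 * pi * n * t)) \<and> (\<integral>t. cis (2 * pi * n * t) \<partial>\<sigma>) = c n)"
proof (cases "c 0 = 0")
  case True
  \<comment> \<open>Division by c 0 is impossible here; by \<open>zero\<close> the null measure
    represents c.\<close>
  show ?thesis
    by (rule exI[of _ "null_measure borel"])
       (use zero[OF True] in \<open>auto intro!: finite_measureI simp: integral_null_measure intro!: borel_measurable_continuous_onI continuous_intros\<close>)
next
  case False
  have "toeplitz_form c 1 t = c 0" for t by (simp add: toeplitz_form_def)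
  then have c0: "Im (c 0) = 0" "Re (c 0) \<ge> 0" using psd[of 1 0] by auto
  define C where "C = Re (c 0)"
  have c0_eq: "c 0 = complex_of_real C" using c0 by (simp add: C_def complex_eq_iff)
  have C: "C > 0" using c0 False by (auto simp: C_def complex_eq_iff)
  define p where "p N t = Re (toeplitz_form c (Suc N) t) / (real (Suc N) * C) * indicator {0..1} t" for N t
  have p_nonneg: "p N t \<ge> 0" for N t using psd C by (auto simp: p_def)
  have [measurable]: "p N \<in> borel_measurable borel" for N
    unfolding p_def
    using C by (intro borel_measurable_times borel_measurable_indicator borel_measurable_continuous_onI[of "\<lambda>t. Re (toeplitz_form c (Suc N) t) / (real (Suc N) * C)"])
       (auto intro!: continuous_intros simp del: of_nat_Suc)
  define M where "M N = density lborel (\<lambda>t. ennreal (p N t))" for N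
  define r where "r k N = real (\<Sum>m<Suc N. \<Sum>n<Suc N. of_bool (int m - int n = k)) / real (Suc N)" for k N
  have fourier: "has_bochner_integral lborel (\<lambda>t. p N t *\<^sub>R cis (2 * pi * of_int k * t)) (c k / C * r k N)" for k N
  proof -
    have "p N t *\<^sub>R cis (2 * pi * of_int k * t)
       = (indicator {0..1} t *\<^sub>R (cis (2 * pi * of_int k * t) * toeplitz_form c (Suc N) t)) / (real (Suc N) * C)" for t
    proof -
      have "toeplitz_form c (Suc N) t = complex_of_real (Re (toeplitz_form c (Suc N) t))"
        using psd by (simp add: complex_eq_iff)
      then show ?thesis by (simp add: p_def scaleR_conv_of_real mult_ac)
    qed
    moreover have "c k / C * r k N = c k * of_nat (\<Sum>m<Suc N. \<Sum>n<Suc N. of_bool (int m - int n = k)) / (real (Suc N) * C)"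
      by (simp add: r_def field_simps del: sum.lessThan_Suc of_nat_sum of_nat_Suc)
    ultimately show ?thesis
      using toeplitz_form_fourier[of k c "Suc N"] by (simp only:) (intro has_bochner_integral_divide_zero)
  qed
  have r0: "r 0 N = 1" for N
    unfolding r_def count_diff_zero by simp
  have "has_bochner_integral lborel (\<lambda>t. complex_of_real (p N t)) (complex_of_real 1)" for N
    using fourier[of N 0] C by (simp add: c0_eq r0 scaleR_conv_of_real)
  then have p_int: "has_bochner_integral lborel (p N) 1" for N
    using has_bochner_integral_Re by fastforce
  have M_sets [simp, measurable_cong]: "sets (M N) = sets borel" and M_space [simp]: "space (M N) = UNIV" for N
    by (auto simp: M_def)
  have "emeasure (M N) (space (M N)) = 1" for N
    using p_int[of N] nn_integral_eq_integral[of lborel "p N"] p_nonneg[of N]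
    by (simp add: M_def emeasure_density has_bochner_integral_iff)
  then have prob: "prob_space (M N)" for N by (rule prob_spaceI)
  have rd: "real_distribution (M N)" for N
    unfolding real_distribution_def real_distribution_axioms_def using prob by simp
  have "measure (M N) {-1<..1} = 1" for N
  proof -
    interpret prob_space "M N" by (rule prob)
    have "AE x in M N. x \<in> {-1<..1}"
      unfolding M_def by (subst AE_density, measurable) (auto simp: p_def split: split_indicator)
    then show ?thesis by (intro prob_eq_1[THEN iffD2]) auto
  qed
  then have "tight M"
    unfolding tight_def using rd by (intro conjI allI impI exI[of _ "-1"] exI[of _ 1]) auto
  from tight_imp_convergent_subsubsequence[OF this strict_mono_id] obtain s \<nu>
    where s: "strict_mono s" and \<nu>: "real_distribution \<nu>" "weak_conv_m (M \<circ> id \<circ> s) \<nu>" by blast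
  interpret \<nu>: real_distribution \<nu> by fact
  have int_\<nu>: "(\<integral>t. cis (2 * pi * of_int k * t) \<partial>\<nu>) = c k / C" for k :: int
  proof (rule LIMSEQ_unique)
    show "(\<lambda>n. \<integral>t. cis (2 * pi * of_int k * t) \<partial>(M \<circ> id \<circ> s) n) \<longlonglongrightarrow> (\<integral>t. cis (2 * pi * of_int k * t) \<partial>\<nu>)"
    proof (rule weak_conv_imp_integral_bdd_continuous_conv[OF _ \<nu>, where B = 1])
      have "continuous_on UNIV (\<lambda>t. cis (2 * pi * of_int k * t))" by (intro continuous_intros)
      then show "isCont (\<lambda>t. cis (2 * pi * of_int k * t)) x" for x
        by (simp add: continuous_on_eq_continuous_at)
    qed (use rd in auto)
    have "(\<integral>t. cis (2 * pi * of_int k * t) \<partial>M N) = c k / C * r k N" for N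
      using fourier[of N k] unfolding M_def
      by (subst integral_density) (auto simp: p_nonneg has_bochner_integral_iff intro!: borel_measurable_continuous_onI continuous_intros)
    moreover have "(\<lambda>n. c k / C * complex_of_real (r k (s n))) \<longlonglongrightarrow> c k / C * complex_of_real 1"
      by (intro tendsto_mult tendsto_const tendsto_of_real LIMSEQ_subseq_LIMSEQ[of "r k" 1 s, unfolded o_def] s)
         (unfold r_def[abs_def], rule count_diff_ratio)
    ultimately show "(\<lambda>n. \<integral>t. cis (2 * pi * of_int k * t) \<partial>(M \<circ> id \<circ> s) n) \<longlonglongrightarrow> c k / C" by simp
  qed
  \<comment> \<open>The weak limit may charge the point 1. Folding by \<open>frac\<close> moves its
    mass into [0,1) and is invisible to characters of integer frequency.\<close>
  define \<rho> where "\<rho> = distr \<nu> borel frac"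
  define \<sigma> where "\<sigma> = density \<rho> (\<lambda>_. ennreal C)"
  have [measurable]: "(frac :: real \<Rightarrow> real) \<in> borel_measurable borel"
    unfolding frac_def by measurable
  interpret \<rho>: prob_space \<rho> unfolding \<rho>_def by (rule \<nu>.prob_space_distr) simp
  have [simp, measurable_cong]: "sets \<rho> = sets borel" by (simp add: \<rho>_def)
  have [simp]: "space \<rho> = UNIV" by (simp add: \<rho>_def)
  have cis_meas [measurable]: "(\<lambda>t. cis (2 * pi * of_int n * t)) \<in> borel_measurable borel" for n :: int
    by (intro borel_measurable_continuous_onI continuous_intros)
  have int_\<rho>: "integrable \<rho> (\<lambda>t. cis (2 * pi * of_int n * t))" for n :: int
    by (rule \<rho>.integrable_const_bound[where B = 1]) auto
  have frac_cis: "cis (2 * pi * of_int n * frac t) = cis (2 * pi * of_int n * t)" for n :: int and t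
  proof -
    have "cis (2 * pi * of_int n * frac t) = cis (2 * pi * of_int n * t) * cis (2 * pi * of_int (- n * \<lfloor>t\<rfloor>))"
      by (simp add: cis_mult frac_def algebra_simps)
    then show ?thesis by (simp only: cis_multiple_2pi[OF Ints_of_int] mult_1_right)
  qed
  show ?thesis
  proof (intro exI[of _ \<sigma>] conjI allI)
    show "sets \<sigma> = sets borel" by (simp add: \<sigma>_def)
    show "finite_measure \<sigma>"
      by (rule finite_measureI) (simp add: \<sigma>_def emeasure_density nn_integral_cmult ennreal_mult_less_top \<rho>.emeasure_space_1[simplified])
    have "emeasure \<rho> (UNIV - {0..<1}) = 0"
      unfolding \<rho>_def by (subst emeasure_distr) (auto simp: frac_lt_1 vimage_def not_le)
    then show "emeasure \<sigma> (UNIV - {0..<1}) = 0"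
      by (simp add: \<sigma>_def emeasure_density nn_integral_cmult)
    fix n :: int
    show "integrable \<sigma> (\<lambda>t. cis (2 * pi * of_int n * t))"
      unfolding \<sigma>_def using C by (subst integrable_density) (auto intro!: int_\<rho>)
    have "(\<integral>t. cis (2 * pi * of_int n * t) \<partial>\<sigma>) = C * (\<integral>t. cis (2 * pi * of_int n * t) \<partial>\<rho>)"
      unfolding \<sigma>_def using C by (subst integral_density) (auto simp: scaleR_conv_of_real)
    also have "(\<integral>t. cis (2 * pi * of_int n * t) \<partial>\<rho>) = c n / C"
      unfolding \<rho>_def by (subst integral_distr) (auto simp: frac_cis int_\<nu>)
    finally show "(\<integral>t. cis (2 * pi * of_int n * t) \<partial>\<sigma>) = c n" using C by simp
  qed
qed

section \<open>Trigonometric polynomials and the Lyapunov exponent\<close>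

text \<open>A closure under three rules in place of explicit finite sums: integrability and
  equidistribution are checked on characters and pass through the two linear rules.\<close>

inductive trig_fun :: "nat \<Rightarrow> ((nat \<Rightarrow> real) \<Rightarrow> complex) \<Rightarrow> bool" for d where
  character: "trig_fun d (\<lambda>\<xi>. cis (2 * pi * (\<Sum>i<d. of_int (m i) * \<xi> i)))"
| add: "trig_fun d f \<Longrightarrow> trig_fun d g \<Longrightarrow> trig_fun d (\<lambda>\<xi>. f \<xi> + g \<xi>)"
| cmult: "trig_fun d f \<Longrightarrow> trig_fun d (\<lambda>\<xi>. c * f \<xi>)"

lemma trig_fun_const: "trig_fun d (\<lambda>_. c)"
  using trig_fun.cmult[OF trig_fun.character[of d "\<lambda>_. 0"], of c] by simp

lemma trig_fun_character_mult:
  assumes "trig_fun d g"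
  shows "trig_fun d (\<lambda>\<xi>. cis (2 * pi * (\<Sum>i<d. of_int (m i) * \<xi> i)) * g \<xi>)"
  using assms
proof induction
  case (character m')
  have "(\<lambda>\<xi>. cis (2 * pi * (\<Sum>i<d. of_int (m i) * \<xi> i)) * cis (2 * pi * (\<Sum>i<d. of_int (m' i) * \<xi> i)))
     = (\<lambda>\<xi>. cis (2 * pi * (\<Sum>i<d. of_int ((\<lambda>i. m i + m' i) i) * \<xi> i)))"
    by (simp add: cis_mult algebra_simps sum.distrib)
  then show ?case using trig_fun.character[of d "\<lambda>i. m i + m' i"] by simp
next
  case (add f g)
  then show ?case using trig_fun.add by (simp add: distrib_left)
next
  case (cmult f c)
  then show ?case using trig_fun.cmult[OF cmult.IH, of c] by (simp add: mult.left_commute)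
qed

lemma trig_fun_mult:
  assumes "trig_fun d f" "trig_fun d g"
  shows "trig_fun d (\<lambda>\<xi>. f \<xi> * g \<xi>)"
  using assms(1)
proof induction
  case (character m)
  show ?case by (rule trig_fun_character_mult) fact
next
  case (add f g)
  then show ?case using trig_fun.add by (simp add: distrib_right)
next
  case (cmult f c)
  then show ?case using trig_fun.cmult[OF cmult.IH, of c] by (simp add: mult.assoc)
qed

lemma trig_fun_cnj:
  assumes "trig_fun d f"
  shows "trig_fun d (\<lambda>\<xi>. cnj (f \<xi>))"
  using assms
proof induction
  case (character m)
  show ?case using trig_fun.character[of d "\<lambda>i. - m i"] by (simp add: cis_cnj sum_negf)
next
  case (add f g)
  then show ?case using trig_fun.add by simp
next
  case (cmult f c)
  then show ?case using trig_fun.cmult[OF cmult.IH, of "cnj c"] by simp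
qed

lemma trig_fun_sum: "(\<And>j. j \<in> A \<Longrightarrow> trig_fun d (f j)) \<Longrightarrow> trig_fun d (\<lambda>\<xi>. \<Sum>j\<in>A. f j \<xi>)"
  by (induction A rule: infinite_finite_induct) (auto intro: trig_fun_const trig_fun.add)

lemma trig_fun_power: "trig_fun d f \<Longrightarrow> trig_fun d (\<lambda>\<xi>. f \<xi> ^ n)"
  by (induction n) (auto intro: trig_fun_const trig_fun_mult)

lemma trig_fun_twist:
  assumes "set w \<subseteq> {..<d}"
  shows "trig_fun d (\<lambda>\<xi>. twist c \<xi> w)"
  using assms
proof (induction w)
  case (Cons a w)
  then have a: "a < d" by simp
  have "(\<Sum>i<d. of_int (if i = a then - 1 else 0) * \<xi> i) = - \<xi> a" for \<xi> :: "nat \<Rightarrow> real"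
  proof -
    have "(\<Sum>i<d. of_int (if i = a then - 1 else 0) * \<xi> i) = (\<Sum>i<d. if i = a then - \<xi> i else 0)"
      by (intro sum.cong) auto
    then show ?thesis using a by simp
  qed
  then have "trig_fun d (\<lambda>\<xi>. cis (- 2 * pi * \<xi> a))"
    using trig_fun.character[of d "\<lambda>i. if i = a then - 1 else 0"] by simp
  then show ?case using Cons by (auto intro!: trig_fun.add trig_fun_const trig_fun_mult)
qed (simp add: trig_fun_const)

text \<open>Haar measure on the torus is modelled as Lebesgue measure on R^d weighted by the unit
  cube, in line with the Lyapunov exponent being stated for almost every point of R^d.\<close>

definition cube_ind :: "nat \<Rightarrow> (nat \<Rightarrow> real) \<Rightarrow> real" where
  "cube_ind d \<xi> = (\<Prod>i<d. indicator {0..1} (\<xi> i))"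

abbreviation leb :: "nat \<Rightarrow> (nat \<Rightarrow> real) measure" where
  "leb d \<equiv> PiM {..<d} (\<lambda>_. lborel)"

lemma cube_ind_character:
  "cube_ind d \<xi> *\<^sub>R cis (2 * pi * (\<Sum>i<d. of_int (m i) * \<xi> i))
     = (\<Prod>i<d. indicator {0..1} (\<xi> i) *\<^sub>R cis (2 * pi * of_int (m i) * \<xi> i))"
proof -
  have "cis (2 * pi * (\<Sum>i<d. of_int (m i) * \<xi> i)) = (\<Prod>i<d. cis (2 * pi * of_int (m i) * \<xi> i))"
    by (induction d) (auto simp: cis_mult[symmetric] algebra_simps)
  then show ?thesis by (simp add: cube_ind_def scaleR_conv_of_real prod.distrib)
qed

lemma integral_character:
  "has_bochner_integral (leb d) (\<lambda>\<xi>. cube_ind d \<xi> *\<^sub>R cis (2 * pi * (\<Sum>i<d. of_int (m i) * \<xi> i)))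
     (of_bool (\<forall>i<d. m i = 0))"
proof -
  interpret product_sigma_finite "\<lambda>_::nat. lborel :: real measure" ..
  have int: "integrable lborel (\<lambda>t. indicator {0..1} t *\<^sub>R cis (2 * pi * real_of_int (m i) * t))" for i
    using has_bochner_integral_cis_period[of "m i"] by (simp add: has_bochner_integral_iff)
  have "(\<integral>\<xi>. (\<Prod>i<d. indicator {0..1} (\<xi> i) *\<^sub>R cis (2 * pi * of_int (m i) * \<xi> i)) \<partial>leb d)
     = (\<Prod>i<d. \<integral>t. indicator {0..1} t *\<^sub>R cis (2 * pi * of_int (m i) * t) \<partial>lborel)"
    by (rule product_integral_prod) (use int in auto)
  also have "\<dots> = (\<Prod>i<d. of_bool (m i = 0))"
    using has_bochner_integral_cis_period by (intro prod.cong refl) (simp add: has_bochner_integral_iff)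
  also have "\<dots> = of_bool (\<forall>i<d. m i = 0)"
    by (cases "\<forall>i<d. m i = 0") (auto intro!: prod_zero)
  moreover have "integrable (leb d) (\<lambda>\<xi>. \<Prod>i<d. indicator {0..1} (\<xi> i) *\<^sub>R cis (2 * pi * of_int (m i) * \<xi> i))"
    by (rule product_integrable_prod) (use int in auto)
  ultimately show ?thesis unfolding cube_ind_character by (simp add: has_bochner_integral_iff)
qed

lemma trig_fun_integrable: "trig_fun d f \<Longrightarrow> integrable (leb d) (\<lambda>\<xi>. cube_ind d \<xi> *\<^sub>R f \<xi>)"
proof (induction rule: trig_fun.induct)
  case (character m)
  show ?case using integral_character by (auto simp: has_bochner_integral_iff)
next
  case (cmult f c)
  then show ?case using integrable_mult_right[OF cmult.IH, of c] by (simp only: mult_scaleR_right)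
qed (simp add: scaleR_right_distrib)

lemma cube_ind_integral: "has_bochner_integral (leb d) (cube_ind d) 1"
proof -
  have "has_bochner_integral (leb d) (\<lambda>\<xi>. complex_of_real (cube_ind d \<xi>)) (complex_of_real 1)"
    using integral_character[of d "\<lambda>_. 0"] by (simp add: scaleR_conv_of_real)
  from has_bochner_integral_Re[OF this] show ?thesis by simp
qed

lemma cube_ind_nonneg: "0 \<le> cube_ind d \<xi>" and cube_ind_le_1: "cube_ind d \<xi> \<le> 1"
  by (auto simp: cube_ind_def intro!: prod_nonneg prod_le_1)

lemma twist_measurable [measurable (raw)]:
  assumes "set w \<subseteq> {..<d}"
  shows "(\<lambda>\<xi>. twist c \<xi> w) \<in> borel_measurable (leb d)"
  using assms
proof (induction w)
  case (Cons a w)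
  have [measurable]: "cis \<in> borel_measurable borel" by (intro borel_measurable_continuous_onI continuous_intros)
  have [measurable]: "(\<lambda>\<xi>. \<xi> a) \<in> borel_measurable (leb d)" using Cons.prems by simp
  have [measurable]: "(\<lambda>\<xi>. twist c \<xi> w) \<in> borel_measurable (leb d)" using Cons by simp
  show ?case by simp
qed simp

lemma cube_ind_measurable [measurable]: "cube_ind d \<in> borel_measurable (leb d)"
  using cube_ind_integral by (auto simp: has_bochner_integral_iff)

section \<open>A continuous logarithmic majorant of the cocycle norm, its mean and its orbit
  averages\<close>

context primitive_substitution
begin

definition snorm :: "nat \<Rightarrow> (nat \<Rightarrow> real) \<Rightarrow> real" where
  "snorm n \<xi> = (\<Sum>b<d. \<Sum>c<d. cmod (twist c \<xi> (sw n b)))"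

text \<open>The squared Hilbert-Schmidt norm of the cocycle; unlike \<open>snorm\<close> it is a
  trigonometric polynomial.\<close>

definition sq_norm :: "nat \<Rightarrow> (nat \<Rightarrow> real) \<Rightarrow> real" where
  "sq_norm n \<xi> = (\<Sum>b<d. \<Sum>c<d. (cmod (twist c \<xi> (sw n b)))\<^sup>2)"

text \<open>A majorant of the logarithm of \<open>snorm\<close>. The summand 1 keeps it continuous
  and nonnegative where the cocycle vanishes; d^2 is the Cauchy-Schwarz constant for d^2
  entries.\<close>

definition gfun :: "nat \<Rightarrow> (nat \<Rightarrow> real) \<Rightarrow> real" where
  "gfun n \<xi> = ln (1 + (real d)\<^sup>2 * sq_norm n \<xi>) / 2"

lemma snorm_nonneg: "snorm n \<xi> \<ge> 0" and sq_norm_nonneg: "sq_norm n \<xi> \<ge> 0"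
  by (auto simp: snorm_def sq_norm_def intro!: sum_nonneg)

lemma gfun_nonneg: "gfun n \<xi> \<ge> 0"
  using sq_norm_nonneg[of n \<xi>] by (simp add: gfun_def)

lemma mat_norm1_cocycle: "mat_norm1 (spectral_cocycle d \<zeta> \<xi> n) = snorm n \<xi>"
  by (simp add: mat_norm1_def spectral_cocycle_eq snorm_def)

lemma sum_squares_le_square_sum:
  fixes f :: "'b \<Rightarrow> real" assumes "finite A" "\<And>x. x \<in> A \<Longrightarrow> f x \<ge> 0"
  shows "(\<Sum>x\<in>A. (f x)\<^sup>2) \<le> (\<Sum>x\<in>A. f x)\<^sup>2"
proof -
  have "(\<Sum>x\<in>A. f x * f x) \<le> (\<Sum>x\<in>A. f x * (\<Sum>y\<in>A. f y))"
    using assms by (intro sum_mono mult_left_mono member_le_sum) auto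
  then show ?thesis by (simp add: power2_eq_square sum_distrib_right)
qed

lemma sq_norm_le: "sq_norm n \<xi> \<le> (snorm n \<xi>)\<^sup>2"
proof -
  have "sq_norm n \<xi> = (\<Sum>x\<in>{..<d} \<times> {..<d}. (cmod (twist (snd x) \<xi> (sw n (fst x))))\<^sup>2)"
    by (simp add: sq_norm_def sum.cartesian_product case_prod_unfold)
  also have "\<dots> \<le> (\<Sum>x\<in>{..<d} \<times> {..<d}. cmod (twist (snd x) \<xi> (sw n (fst x))))\<^sup>2"
    by (intro sum_squares_le_square_sum) auto
  also have "\<dots> = (snorm n \<xi>)\<^sup>2"
    by (simp add: snorm_def sum.cartesian_product case_prod_unfold)
  finally show ?thesis .
qed

lemma snorm_le: "(snorm n \<xi>)\<^sup>2 \<le> (real d)\<^sup>2 * sq_norm n \<xi>"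
proof -
  have "snorm n \<xi> = (\<Sum>x\<in>{..<d} \<times> {..<d}. cmod (twist (snd x) \<xi> (sw n (fst x))))"
    by (simp add: snorm_def sum.cartesian_product case_prod_unfold)
  then have "(snorm n \<xi>)\<^sup>2 \<le> (\<Sum>x\<in>{..<d} \<times> {..<d}. (cmod (twist (snd x) \<xi> (sw n (fst x))))\<^sup>2) * card ({..<d} \<times> {..<d})"
    using sum_squared_le_sum_of_squares[of "\<lambda>x. cmod (twist (snd x) \<xi> (sw n (fst x)))" "{..<d} \<times> {..<d}"] by simp
  also have "\<dots> = (real d)\<^sup>2 * sq_norm n \<xi>"
    by (simp add: sq_norm_def sum.cartesian_product case_prod_unfold power2_eq_square)
  finally show ?thesis .
qed

lemma snorm_le_exp_gfun: "snorm n \<xi> \<le> exp (gfun n \<xi>)"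
proof -
  have pos: "1 + (real d)\<^sup>2 * sq_norm n \<xi> > 0" using sq_norm_nonneg[of n \<xi>] by (simp add: add_pos_nonneg)
  have "(snorm n \<xi>)\<^sup>2 \<le> (exp (gfun n \<xi>))\<^sup>2"
    using snorm_le[of n \<xi>] pos by (simp add: gfun_def flip: exp_of_nat_mult)
  then show ?thesis by (rule power2_le_imp_le) simp
qed

text \<open>Compared with the truncated logarithm, \<open>gfun\<close> loses only a constant
  independent of n, which disappears after division by n.\<close>

lemma gfun_le: "gfun n \<xi> \<le> ln (1 + real d) + max 0 (ln (snorm n \<xi>))"
proof -
  define N where "N = snorm n \<xi>"
  have N: "N \<ge> 0" by (simp add: N_def snorm_nonneg)
  have "1 + (real d)\<^sup>2 * sq_norm n \<xi> \<le> 1 + (real d)\<^sup>2 * N\<^sup>2"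
    using sq_norm_le[of n \<xi>] by (simp add: N_def mult_left_mono)
  also have "\<dots> \<le> (1 + real d * N)\<^sup>2"
    using N by (simp add: power2_sum power_mult_distrib)
  finally have "ln (1 + (real d)\<^sup>2 * sq_norm n \<xi>) \<le> ln ((1 + real d * N)\<^sup>2)"
    using sq_norm_nonneg[of n \<xi>] by (intro ln_mono) (auto simp: add_pos_nonneg)
  also have "\<dots> = 2 * ln (1 + real d * N)" using N by (simp add: ln_realpow add_pos_nonneg)
  finally have "gfun n \<xi> \<le> ln (1 + real d * N)" by (simp add: gfun_def)
  also have "\<dots> \<le> ln (1 + real d) + max 0 (ln N)"
  proof (cases "N \<le> 1")
    case True
    then have "ln (1 + real d * N) \<le> ln (1 + real d)"
      using N mult_left_mono[OF True, of "real d"] by (intro ln_mono) (auto simp: add_pos_nonneg)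
    then show ?thesis by simp
  next
    case False
    then have "ln (1 + real d * N) \<le> ln ((1 + real d) * N)"
      using N by (intro ln_mono) (auto simp: add_pos_nonneg algebra_simps)
    also have "\<dots> = ln (1 + real d) + ln N" using False by (intro ln_mult_pos) auto
    finally show ?thesis using False by simp
  qed
  finally show ?thesis unfolding N_def .
qed

definition Lmax :: nat where "Lmax = (\<Sum>a<d. length (\<zeta> a))"

lemma length_zeta_le: "a < d \<Longrightarrow> length (\<zeta> a) \<le> Lmax"
  unfolding Lmax_def by (intro member_le_sum) auto

lemma Lmax_pos: "Lmax \<ge> 1"
  using length_zeta_le[of 0] zeta_nonempty[of 0] d_pos by (cases "\<zeta> 0") auto

lemma length_sw_le: "b < d \<Longrightarrow> length (sw n b) \<le> Lmax ^ n"
proof (induction n arbitrary: b)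
  case (Suc n)
  have "length (sw (Suc n) b) = (\<Sum>l<d. length (sw n l) * cnt 1 l b)"
    using length_sw_add[of b n 1] Suc.prems by simp
  also have "\<dots> \<le> (\<Sum>l<d. Lmax ^ n * cnt 1 l b)"
    using Suc.IH by (intro sum_mono mult_right_mono) auto
  also have "\<dots> = Lmax ^ n * length (sw 1 b)"
    using length_sw[OF Suc.prems, of 1] by (simp add: sum_distrib_left)
  also have "length (sw 1 b) = length (\<zeta> b)" by (simp add: sw_def subst_word_def)
  also have "Lmax ^ n * length (\<zeta> b) \<le> Lmax ^ n * Lmax"
    using length_zeta_le[OF Suc.prems] by (intro mult_left_mono) auto
  finally show ?case by (simp add: mult.commute)
qed simp

lemma snorm_upper: "snorm n \<xi> \<le> real d * real Lmax ^ n"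
proof -
  have "snorm n \<xi> \<le> (\<Sum>b<d. real Lmax ^ n)"
    unfolding snorm_def
  proof (rule sum_mono)
    fix b assume "b \<in> {..<d}"
    then have b: "b < d" by simp
    have "(\<Sum>c<d. cmod (twist c \<xi> (sw n b))) \<le> (\<Sum>c<d. real (cnt n c b))"
      unfolding cnt_def by (intro sum_mono norm_twist_le)
    also have "\<dots> = real (length (sw n b))" using length_sw[OF b] by simp
    also have "\<dots> \<le> real (Lmax ^ n)" using length_sw_le[OF b] by (intro of_nat_mono)
    finally show "(\<Sum>c<d. cmod (twist c \<xi> (sw n b))) \<le> real Lmax ^ n" by simp
  qed
  then show ?thesis by simp
qed

lemma snorm_measurable [measurable]: "snorm n \<in> borel_measurable (leb d)"
proof -
  have "(\<lambda>\<xi>. twist c \<xi> (sw n b)) \<in> borel_measurable (leb d)" if "b < d" for b c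
    using sw_letters[OF that] by (rule twist_measurable)
  then show ?thesis unfolding snorm_def[abs_def]
    by (intro borel_measurable_sum borel_measurable_norm) auto
qed

lemma sq_norm_measurable [measurable]: "sq_norm n \<in> borel_measurable (leb d)"
proof -
  have "(\<lambda>\<xi>. twist c \<xi> (sw n b)) \<in> borel_measurable (leb d)" if "b < d" for b c
    using sw_letters[OF that] by (rule twist_measurable)
  then show ?thesis unfolding sq_norm_def[abs_def]
    by (intro borel_measurable_sum borel_measurable_power borel_measurable_norm) auto
qed

lemma gfun_measurable [measurable]: "gfun n \<in> borel_measurable (leb d)"
  unfolding gfun_def[abs_def] by measurable

lemma max_ln_snorm_le: "max 0 (ln (snorm n \<xi>)) \<le> ln d + n * ln Lmax"
proof -
  have nn: "ln (real d) \<ge> 0" "real n * ln (real Lmax) \<ge> 0"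
    using d_pos Lmax_pos by auto
  show ?thesis
  proof (cases "snorm n \<xi> = 0")
    case False
    then have "snorm n \<xi> > 0" using snorm_nonneg[of n \<xi>] by simp
    then have "ln (snorm n \<xi>) \<le> ln (real d * real Lmax ^ n)" using snorm_upper by (intro ln_mono)
    also have "\<dots> = ln d + n * ln Lmax"
      using d_pos Lmax_pos by (subst ln_mult_pos) (auto simp: ln_realpow)
    finally show ?thesis using nn by simp
  qed (use nn in simp)
qed

lemma gfun_integrable: "integrable (leb d) (\<lambda>\<xi>. cube_ind d \<xi> * gfun n \<xi>)"
proof (rule Bochner_Integration.integrable_bound)
  show "integrable (leb d) (\<lambda>\<xi>. (ln (1 + real d) + (ln d + n * ln Lmax)) * cube_ind d \<xi>)"
    using cube_ind_integral by (auto simp: has_bochner_integral_iff)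
  show "AE \<xi> in leb d. norm (cube_ind d \<xi> * gfun n \<xi>) \<le> norm ((ln (1 + real d) + (ln d + n * ln Lmax)) * cube_ind d \<xi>)"
  proof (rule AE_I2)
    fix \<xi>
    have "gfun n \<xi> \<le> ln (1 + real d) + (ln d + n * ln Lmax)"
      using gfun_le[of n \<xi>] max_ln_snorm_le[of n \<xi>] by linarith
    from mult_left_mono[OF this cube_ind_nonneg[of d \<xi>]]
    have "cube_ind d \<xi> * gfun n \<xi> \<le> (ln (1 + real d) + (ln d + n * ln Lmax)) * cube_ind d \<xi>"
      by (simp only: mult.commute)
    then show "norm (cube_ind d \<xi> * gfun n \<xi>) \<le> norm ((ln (1 + real d) + (ln d + n * ln Lmax)) * cube_ind d \<xi>)"
      using cube_ind_nonneg[of d \<xi>] gfun_nonneg[of n \<xi>]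
        mult_right_mono[OF abs_ge_self[of "ln (1 + real d) + (ln d + n * ln Lmax)"], of "cube_ind d \<xi>"]
      by (simp add: abs_mult)
  qed
qed measurable

text \<open>Truncating the logarithm at 0 turns Fatou's lemma into dominated convergence and makes the
  integrand continuous; the truncated exponent still is below the threshold because that is positive.\<close>
lemma integral_gfun_less:
  assumes lyap: "top_lyapunov_is d \<zeta> lyap" "lyap < \<beta>" "\<beta> > 0"
  shows "\<exists>K\<ge>prim_exp. (\<integral>\<xi>. cube_ind d \<xi> * gfun K \<xi> \<partial>leb d) < K * \<beta>"
proof -
  \<comment> \<open>By \<open>gfun_le\<close> this dominates \<open>gfun n \<xi> / n\<close> for n >
    0, and it converges to the truncated exponent. It is uniformly bounded since
    \<open>snorm\<close> grows at most exponentially.\<close>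
  define h where "h n \<xi> = (ln (1 + real d) + max 0 (ln (snorm n \<xi>))) / n" for n \<xi>
  have h_meas [measurable]: "h n \<in> borel_measurable (leb d)" for n
    unfolding h_def[abs_def] by measurable
  define B where "B = ln (1 + real d) + ln d + ln Lmax"
  have nn: "ln (real d) \<ge> 0" "ln (real Lmax) \<ge> 0" "ln (1 + real d) \<ge> 0"
    using d_pos Lmax_pos by auto
  have h_bound: "0 \<le> h n \<xi>" "h n \<xi> \<le> B" for n \<xi>
  proof -
    show "0 \<le> h n \<xi>" using nn by (simp add: h_def)
    show "h n \<xi> \<le> B"
    proof (cases "n = 0")
      case False
      have "ln (1 + real d) + max 0 (ln (snorm n \<xi>)) \<le> (ln (1 + real d) + ln d) * 1 + n * ln Lmax"
        using max_ln_snorm_le[of n \<xi>] by simp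
      also have "\<dots> \<le> (ln (1 + real d) + ln d) * n + n * ln Lmax"
        using nn False by (intro add_right_mono mult_left_mono) auto
      also have "\<dots> = n * B" by (simp add: B_def algebra_simps)
      finally show ?thesis using False by (simp add: h_def divide_le_eq mult.commute)
    qed (use nn in \<open>simp add: h_def B_def\<close>)
  qed
  have lim: "AE \<xi> in leb d. (\<lambda>n. cube_ind d \<xi> * h n \<xi>) \<longlonglongrightarrow> cube_ind d \<xi> * max 0 lyap"
    using lyap(1) unfolding top_lyapunov_is_def mat_norm1_cocycle
  proof eventually_elim
    case (elim \<xi>)
    have "(\<lambda>n. ln (1 + real d) / real n + max 0 (ln (snorm n \<xi>) / real n)) \<longlonglongrightarrow> 0 + max 0 lyap"
      by (intro tendsto_add tendsto_max tendsto_const elim lim_const_over_n)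
    moreover have "h n \<xi> = ln (1 + real d) / real n + max 0 (ln (snorm n \<xi>) / real n)" for n
      by (simp add: h_def add_divide_distrib max_def divide_le_0_iff zero_le_divide_iff)
    ultimately show ?case by (intro tendsto_mult tendsto_const) simp
  qed
  have "(\<lambda>n. \<integral>\<xi>. cube_ind d \<xi> * h n \<xi> \<partial>leb d) \<longlonglongrightarrow> (\<integral>\<xi>. cube_ind d \<xi> * max 0 lyap \<partial>leb d)"
  proof (rule integral_dominated_convergence[OF _ _ _ lim])
    show "integrable (leb d) (\<lambda>\<xi>. cube_ind d \<xi> * B)"
      using cube_ind_integral by (auto simp: has_bochner_integral_iff)
    show "AE \<xi> in leb d. norm (cube_ind d \<xi> * h n \<xi>) \<le> cube_ind d \<xi> * B" for n
      using h_bound cube_ind_nonneg by (auto simp: abs_mult intro!: mult_left_mono)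
  qed measurable
  moreover have "(\<integral>\<xi>. cube_ind d \<xi> * max 0 lyap \<partial>leb d) = max 0 lyap"
    using cube_ind_integral by (simp add: has_bochner_integral_iff)
  moreover have "max 0 lyap < \<beta>" using lyap by simp
  ultimately have "\<forall>\<^sub>F n in sequentially. (\<integral>\<xi>. cube_ind d \<xi> * h n \<xi> \<partial>leb d) < \<beta>"
    by (intro order_tendstoD) auto
  \<comment> \<open>The additional demand on n makes S^n positive, as the growth of the frequencies
    requires.\<close>
  then have "\<forall>\<^sub>F n in sequentially. (\<integral>\<xi>. cube_ind d \<xi> * h n \<xi> \<partial>leb d) < \<beta> \<and> n \<ge> prim_exp"
    by (intro eventually_conj eventually_ge_at_top)
  then obtain K where K: "(\<integral>\<xi>. cube_ind d \<xi> * h K \<xi> \<partial>leb d) < \<beta>" "K \<ge> prim_exp"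
    using eventually_happens'[OF sequentially_bot] by blast
  then have "K > 0" using prim_exp(1) by simp
  have "(\<integral>\<xi>. cube_ind d \<xi> * gfun K \<xi> \<partial>leb d) \<le> (\<integral>\<xi>. K * (cube_ind d \<xi> * h K \<xi>) \<partial>leb d)"
  proof (rule integral_mono[OF gfun_integrable])
    have "integrable (leb d) (\<lambda>\<xi>. cube_ind d \<xi> * h K \<xi>)"
    proof (rule Bochner_Integration.integrable_bound)
      show "integrable (leb d) (\<lambda>\<xi>. cube_ind d \<xi> * B)"
        using cube_ind_integral by (auto simp: has_bochner_integral_iff)
      show "AE \<xi> in leb d. norm (cube_ind d \<xi> * h K \<xi>) \<le> norm (cube_ind d \<xi> * B)"
      proof (rule AE_I2)
        fix \<xi>
        have "\<bar>h K \<xi>\<bar> \<le> \<bar>B\<bar>" using h_bound[of K \<xi>] by linarith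
        then show "norm (cube_ind d \<xi> * h K \<xi>) \<le> norm (cube_ind d \<xi> * B)"
          by (simp add: abs_mult mult_left_mono)
      qed
    qed measurable
    then show "integrable (leb d) (\<lambda>\<xi>. K * (cube_ind d \<xi> * h K \<xi>))" by simp
    show "cube_ind d \<xi> * gfun K \<xi> \<le> K * (cube_ind d \<xi> * h K \<xi>)" for \<xi>
      using mult_left_mono[OF gfun_le[of K \<xi>] cube_ind_nonneg[of d \<xi>]] \<open>K > 0\<close> by (simp add: h_def)
  qed
  also have "\<dots> = K * (\<integral>\<xi>. cube_ind d \<xi> * h K \<xi> \<partial>leb d)" by simp
  also have "\<dots> < K * \<beta>" using K \<open>K > 0\<close> by simp
  finally show ?thesis using K by blast
qed

text \<open>A lift of E^(K i) (t,...,t): in \<open>toral_endo_funpow\<close> the weight of a word at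
  a constant point is t times its length.\<close>

definition orbit :: "nat \<Rightarrow> real \<Rightarrow> nat \<Rightarrow> nat \<Rightarrow> real" where
  "orbit K t i b = t * real (length (sw (K * i) b))"

abbreviation gsum :: "nat \<Rightarrow> real \<Rightarrow> nat \<Rightarrow> real" where
  "gsum K t N \<equiv> \<Sum>j<N. gfun K (orbit K t j)"

text \<open>Along the orbit a nontrivial character is a pure exponential in t with integer frequency
  B i, and \<open>length_combination_growth\<close> makes B admissible for \<open>weyl_ae\<close>.
  The null set may depend on f, which does no harm since \<open>gfun_orbit_average\<close> uses a
  single f.\<close>

lemma trig_fun_equidistributed:
  assumes irr: "irreducible (char_poly (map_mat rat_of_int (subst_matrix d \<zeta>)))"
    and K: "K \<ge> prim_exp" and f: "trig_fun d f"
  shows "AE t in lborel. t \<in> {0..1} \<longrightarrow>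
    (\<lambda>N. (\<Sum>i<N. f (orbit K t i)) / of_nat N) \<longlonglongrightarrow> (\<integral>\<xi>. cube_ind d \<xi> *\<^sub>R f \<xi> \<partial>leb d)"
  using f
proof induction
  case (character m)
  have J: "(\<integral>\<xi>. cube_ind d \<xi> *\<^sub>R cis (2 * pi * (\<Sum>i<d. of_int (m i) * \<xi> i)) \<partial>leb d) = of_bool (\<forall>i<d. m i = 0)"
    using integral_character by (simp add: has_bochner_integral_iff)
  show ?case
  proof (cases "\<forall>i<d. m i = 0")
    case True
    have "(\<lambda>N. (\<Sum>i<N. 1) / of_nat N :: complex) \<longlonglongrightarrow> 1"
      by (rule tendsto_eventually) (auto intro!: eventually_mono[OF eventually_gt_at_top[of 0]])
    then show ?thesis unfolding J using True by simp
  next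
    case False
    define B where "B i = (\<Sum>b<d. m b * int (length (sw (K * i) b)))" for i
    obtain n0 where n0: "\<And>n. n \<ge> n0 \<Longrightarrow> \<bar>B n\<bar> < \<bar>B (Suc n)\<bar>"
      using length_combination_growth[OF K irr, of m] False unfolding B_def by auto
    have "(\<Sum>b<d. of_int (m b) * orbit K t i b) = of_int (B i) * t" for t i
      by (simp add: orbit_def B_def sum_distrib_right sum_distrib_left mult_ac)
    moreover have "of_bool (\<forall>i<d. m i = 0) = (0::complex)" using False by simp
    ultimately show ?thesis unfolding J using weyl_ae[of n0 B, OF n0] by (simp only: mult.assoc)
  qed
next
  case (add f g)
  have J: "(\<integral>\<xi>. cube_ind d \<xi> *\<^sub>R (f \<xi> + g \<xi>) \<partial>leb d)
     = (\<integral>\<xi>. cube_ind d \<xi> *\<^sub>R f \<xi> \<partial>leb d) + (\<integral>\<xi>. cube_ind d \<xi> *\<^sub>R g \<xi> \<partial>leb d)"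
    using trig_fun_integrable add.hyps by (simp add: scaleR_right_distrib)
  from add.IH show ?case
    by eventually_elim (auto simp: J sum.distrib add_divide_distrib intro: tendsto_add)
next
  case (cmult f c)
  have J: "(\<integral>\<xi>. cube_ind d \<xi> *\<^sub>R (c * f \<xi>) \<partial>leb d) = c * (\<integral>\<xi>. cube_ind d \<xi> *\<^sub>R f \<xi> \<partial>leb d)"
    by (simp only: mult_scaleR_right[symmetric] integral_mult_right_zero)
  from cmult.IH show ?case
  proof eventually_elim
    case (elim t)
    have "(\<Sum>i<N. c * f (orbit K t i)) / of_nat N = c * ((\<Sum>i<N. f (orbit K t i)) / of_nat N)" for N
      by (simp add: sum_distrib_left)
    then show ?case
      unfolding J by (simp only:) (intro impI tendsto_mult tendsto_const, use elim in blast)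
  qed
qed

text \<open>On the bounded range of \<open>sq_norm\<close> the logarithm is uniformly close to a
  polynomial, and a polynomial in \<open>sq_norm\<close> is again a trigonometric polynomial, to
  which equidistribution applies.\<close>

theorem gfun_orbit_average:
  assumes irr: "irreducible (char_poly (map_mat rat_of_int (subst_matrix d \<zeta>)))"
    and K: "K \<ge> prim_exp" and c: "(\<integral>\<xi>. cube_ind d \<xi> * gfun K \<xi> \<partial>leb d) < c"
  shows "AE t in lborel. t \<in> {0..1} \<longrightarrow> (\<exists>N0. \<forall>N\<ge>N0. gsum K t N \<le> c * N)"
proof -
  define I where "I = (\<integral>\<xi>. cube_ind d \<xi> * gfun K \<xi> \<partial>leb d)"
  \<comment> \<open>One third each for the mean of the polynomial, for the convergence of its orbit
    averages and for the pointwise error along the orbit.\<close>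
  define \<epsilon> where "\<epsilon> = (c - I) / 3"
  have \<epsilon>: "\<epsilon> > 0" using c by (simp add: \<epsilon>_def I_def)
  define C where "C = (real d * real Lmax ^ K)\<^sup>2"
  have sq: "sq_norm K \<xi> \<in> {0..C}" for \<xi>
  proof -
    have "(snorm K \<xi>)\<^sup>2 \<le> C" unfolding C_def using snorm_upper snorm_nonneg by (intro power_mono)
    then show ?thesis using sq_norm_le[of K \<xi>] sq_norm_nonneg[of K \<xi>] by simp
  qed
  have "continuous_on {0..C} (\<lambda>y. ln (1 + (real d)\<^sup>2 * y) / 2)"
    by (intro continuous_intros) (auto simp: add_nonneg_eq_0_iff)
  then obtain g where "real_polynomial_function g"
    and g: "\<And>y. y \<in> {0..C} \<Longrightarrow> \<bar>ln (1 + (real d)\<^sup>2 * y) / 2 - g y\<bar> < \<epsilon>"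
    using Stone_Weierstrass_real_polynomial_function[of "{0..C}" _ \<epsilon>] \<epsilon> by (metis compact_Icc)
  then obtain a n where g_eq: "g = (\<lambda>x. \<Sum>i\<le>n. a i * x ^ i)"
    by (auto simp: real_polynomial_function_iff_sum)
  define f where "f \<xi> = complex_of_real (g (sq_norm K \<xi>))" for \<xi>
  have close: "\<bar>gfun K \<xi> - g (sq_norm K \<xi>)\<bar> < \<epsilon>" for \<xi>
    using g[OF sq] by (simp add: gfun_def)
  have "trig_fun d (\<lambda>\<xi>. complex_of_real (sq_norm K \<xi>))"
  proof -
    have "trig_fun d (\<lambda>\<xi>. \<Sum>b<d. \<Sum>c<d. twist c \<xi> (sw K b) * cnj (twist c \<xi> (sw K b)))"
      using sw_letters by (intro trig_fun_sum trig_fun_mult trig_fun_cnj trig_fun_twist) auto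
    then show ?thesis by (simp only: sq_norm_def of_real_sum complex_norm_square)
  qed
  then have f_trig: "trig_fun d f"
    unfolding f_def g_eq of_real_sum of_real_mult of_real_power
    by (intro trig_fun_sum trig_fun.cmult trig_fun_power)
  have int_f: "integrable (leb d) (\<lambda>\<xi>. cube_ind d \<xi> * g (sq_norm K \<xi>))"
    using integrable_Re[OF trig_fun_integrable[OF f_trig]] by (simp add: f_def)
  have J: "(\<integral>\<xi>. cube_ind d \<xi> *\<^sub>R f \<xi> \<partial>leb d) = complex_of_real (\<integral>\<xi>. cube_ind d \<xi> * g (sq_norm K \<xi>) \<partial>leb d)"
    unfolding f_def scaleR_conv_of_real of_real_mult[symmetric] by (rule integral_complex_of_real)
  have "(\<integral>\<xi>. cube_ind d \<xi> * g (sq_norm K \<xi>) \<partial>leb d) \<le> (\<integral>\<xi>. cube_ind d \<xi> * gfun K \<xi> + \<epsilon> * cube_ind d \<xi> \<partial>leb d)"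
  proof (rule integral_mono[OF int_f])
    show "integrable (leb d) (\<lambda>\<xi>. cube_ind d \<xi> * gfun K \<xi> + \<epsilon> * cube_ind d \<xi>)"
      using gfun_integrable cube_ind_integral by (auto simp: has_bochner_integral_iff)
    fix \<xi>
    have "g (sq_norm K \<xi>) \<le> gfun K \<xi> + \<epsilon>" using close[of \<xi>] by linarith
    from mult_left_mono[OF this cube_ind_nonneg[of d \<xi>]]
    show "cube_ind d \<xi> * g (sq_norm K \<xi>) \<le> cube_ind d \<xi> * gfun K \<xi> + \<epsilon> * cube_ind d \<xi>"
      by (simp add: algebra_simps)
  qed
  also have "\<dots> = I + \<epsilon>"
    using gfun_integrable[of K] cube_ind_integral by (simp add: has_bochner_integral_iff I_def)
  finally have J_le: "(\<integral>\<xi>. cube_ind d \<xi> * g (sq_norm K \<xi>) \<partial>leb d) \<le> I + \<epsilon>" .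
  from trig_fun_equidistributed[OF irr K f_trig] show ?thesis
  proof eventually_elim
    case (elim t)
    show ?case
    proof
      assume "t \<in> {0..1}"
      with elim have "(\<lambda>N. (\<Sum>i<N. f (orbit K t i)) / of_nat N) \<longlonglongrightarrow> (\<integral>\<xi>. cube_ind d \<xi> *\<^sub>R f \<xi> \<partial>leb d)" by blast
      from tendsto_Re[OF this]
      have "(\<lambda>N. (\<Sum>i<N. g (sq_norm K (orbit K t i))) / real N) \<longlonglongrightarrow> (\<integral>\<xi>. cube_ind d \<xi> * g (sq_norm K \<xi>) \<partial>leb d)"
        unfolding J by (simp add: f_def Re_divide_of_nat)
      moreover have "(\<integral>\<xi>. cube_ind d \<xi> * g (sq_norm K \<xi>) \<partial>leb d) < I + 2 * \<epsilon>" using J_le \<epsilon> by simp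
      ultimately have "\<forall>\<^sub>F N in sequentially. (\<Sum>i<N. g (sq_norm K (orbit K t i))) / real N < I + 2 * \<epsilon>"
        by (rule order_tendstoD)
      then have "\<forall>\<^sub>F N in sequentially. gsum K t N \<le> c * N"
        using eventually_gt_at_top[of 0]
      proof eventually_elim
        case (elim N)
        have "gsum K t N \<le> (\<Sum>i<N. g (sq_norm K (orbit K t i)) + \<epsilon>)"
        proof (rule sum_mono)
          fix i show "gfun K (orbit K t i) \<le> g (sq_norm K (orbit K t i)) + \<epsilon>"
            using close[of "orbit K t i"] by linarith
        qed
        also have "\<dots> \<le> (I + 2 * \<epsilon>) * N + \<epsilon> * N"
          using elim by (simp add: sum.distrib divide_less_eq mult.commute)
        also have "\<dots> = c * N" by (simp add: \<epsilon>_def field_simps)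
        finally show ?case .
      qed
      then show "\<exists>N0. \<forall>N\<ge>N0. gsum K t N \<le> c * N"
        by (simp add: eventually_sequentially)
    qed
  qed
qed

end

section \<open>Twisted sums along words\<close>

text \<open>Windows that stick out at the right end are truncated.\<close>
fun wsum :: "(nat list \<Rightarrow> complex) \<Rightarrow> nat \<Rightarrow> real \<Rightarrow> nat list \<Rightarrow> complex" where
  "wsum g l t [] = 0"
| "wsum g l t (a # w) = g (take l (a # w)) + cis (- 2 * pi * t) * wsum g l t w"

text \<open>Cut u at a block boundary: complete blocks coming from w1, then a prefix u' of the next
  block. The rest r of that block is recorded because \<open>wsum_two_block_bound\<close> goes on
  reading from there.\<close>

lemma (in substitution) prefix_concat_decomp:
  assumes "subn n w = u @ v"
  shows "\<exists>w1 w2 u'. w = w1 @ w2 \<and> u = subn n w1 @ u' \<and>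
    (u' = [] \<and> w2 = [] \<or> (\<exists>b w3 r. w2 = b # w3 \<and> subn n [b] = u' @ r \<and>
        r @ subn n w3 = v))"
  using assms
proof (induction w arbitrary: u)
  case Nil
  then have "u = []" by simp
  then show ?case by (intro exI[of _ "[]"]) simp
next
  case (Cons a w)
  have "subn n [a] @ subn n w = u @ v"
    using Cons.prems by (simp add: subst_word_funpow_Cons[of n \<zeta> a w])
  then obtain z where "subn n [a] = u @ z \<and> z @ subn n w = v
      \<or> subn n [a] @ z = u \<and> subn n w = z @ v"
    unfolding append_eq_append_conv2 by blast
  then show ?case
  proof
    assume "subn n [a] = u @ z \<and> z @ subn n w = v"
    then show ?thesis
      by (intro exI[of _ "[]"] exI[of _ "a # w"] exI[of _ u] conjI disjI2 exI[of _ a] exI[of _ w] exI[of _ z]) simp_all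
  next
    assume *: "subn n [a] @ z = u \<and> subn n w = z @ v"
    then have "subn n w = z @ v" by simp
    from Cons.IH[OF this] obtain w1 w2 u' where w12: "w = w1 @ w2" "z = subn n w1 @ u'"
        "u' = [] \<and> w2 = [] \<or> (\<exists>b w3 r. w2 = b # w3 \<and> subn n [b] = u' @ r \<and>
          r @ subn n w3 = v)" by blast
    show ?thesis
    proof (intro exI conjI)
      show "a # w = (a # w1) @ w2" using w12(1) by simp
      show "u = subn n (a # w1) @ u'"
        unfolding subst_word_funpow_Cons[of n \<zeta> a w1] using * w12(2) by simp
    qed (rule w12(3))
  qed
qed

locale window_function =
  fixes g :: "nat list \<Rightarrow> complex" and l :: nat and B :: real
  assumes g_bound: "cmod (g w) \<le> B"
begin

lemma B_nonneg: "B \<ge> 0"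
  using g_bound[of "[]"] norm_ge_zero[of "g []"] by linarith

text \<open>Only windows that start within the last l letters of u can see v, and each changes by at
  most 2 B. The minimum is the form the induction needs: 2 B per letter until l letters are
  reached.\<close>

lemma wsum_append_min:
  "cmod (wsum g l t (u @ v) - (wsum g l t u + cis (- 2 * pi * (t * length u)) * wsum g l t v)) \<le> 2 * B * min (length u) l"
proof (induction u)
  case (Cons a u)
  define D where "D = wsum g l t (u @ v) - (wsum g l t u + cis (- 2 * pi * (t * length u)) * wsum g l t v)"
  define e where "e = g (take l (a # u @ v)) - g (take l (a # u))"
  have "cis (- 2 * pi * (t * length (a # u))) = cis (- 2 * pi * t) * cis (- 2 * pi * (t * length u))"
    by (simp add: cis_mult algebra_simps)
  then have eq: "wsum g l t ((a # u) @ v) - (wsum g l t (a # u) + cis (- 2 * pi * (t * length (a # u))) * wsum g l t v)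
    = e + cis (- 2 * pi * t) * D"
    by (simp only: append_Cons wsum.simps D_def e_def) (simp only: algebra_simps)
  have D: "cmod D \<le> 2 * B * min (length u) l" unfolding D_def by (rule Cons)
  have tri: "cmod (e + cis (- 2 * pi * t) * D) \<le> cmod e + cmod D"
    by (rule order_trans[OF norm_triangle_ineq]) (simp add: norm_mult)
  show ?case
  proof (cases "l \<le> length (a # u)")
    case True
    then have "e = 0" by (cases l) (auto simp: e_def)
    then have "cmod (e + cis (- 2 * pi * t) * D) \<le> 2 * B * min (length u) l" using tri D by simp
    also have "\<dots> \<le> 2 * B * min (length (a # u)) l" using B_nonneg by (intro mult_left_mono) auto
    finally show ?thesis unfolding eq .
  next
    case False
    have "cmod e \<le> cmod (g (take l (a # u @ v))) + cmod (g (take l (a # u)))"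
      unfolding e_def by (rule norm_triangle_ineq4)
    also have "\<dots> \<le> 2 * B" using g_bound[of "take l (a # u @ v)"] g_bound[of "take l (a # u)"] by linarith
    finally have "cmod (e + cis (- 2 * pi * t) * D) \<le> 2 * B + 2 * B * min (length u) l" using tri D by linarith
    also have "\<dots> = 2 * B * min (length (a # u)) l" using False by (simp add: algebra_simps)
    finally show ?thesis unfolding eq .
  qed
qed simp

text \<open>The price of one junction between two words, whatever their lengths.\<close>

definition err :: real where "err = 2 * B * l"

lemma err_nonneg: "err \<ge> 0" using B_nonneg by (simp add: err_def)

lemma wsum_append:
  "cmod (wsum g l t (u @ v) - (wsum g l t u + cis (- 2 * pi * (t * length u)) * wsum g l t v)) \<le> err"
  using wsum_append_min[of t u v] B_nonneg mult_left_mono[of "real (min (length u) l)" "real l" "2 * B"]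
  unfolding err_def by simp

lemma norm_wsum_append_le: "cmod (wsum g l t (u @ v)) \<le> cmod (wsum g l t u) + cmod (wsum g l t v) + err"
proof -
  define D where "D = wsum g l t (u @ v) - (wsum g l t u + cis (- 2 * pi * (t * length u)) * wsum g l t v)"
  have "wsum g l t (u @ v) = D + (wsum g l t u + cis (- 2 * pi * (t * length u)) * wsum g l t v)"
    by (simp add: D_def)
  then have "cmod (wsum g l t (u @ v)) \<le> cmod D + (cmod (wsum g l t u) + cmod (cis (- 2 * pi * (t * length u)) * wsum g l t v))"
    using norm_triangle_ineq[of D "wsum g l t u + cis (- 2 * pi * (t * length u)) * wsum g l t v"]
      norm_triangle_ineq[of "wsum g l t u" "cis (- 2 * pi * (t * length u)) * wsum g l t v"] by simp
  then show ?thesis using wsum_append[of t u v] unfolding D_def by (simp add: norm_mult)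
qed

lemma norm_wsum_suffix_le: "cmod (wsum g l t v) \<le> cmod (wsum g l t (u @ v)) + cmod (wsum g l t u) + err"
proof -
  define D where "D = wsum g l t (u @ v) - (wsum g l t u + cis (- 2 * pi * (t * length u)) * wsum g l t v)"
  have eq: "cis (- 2 * pi * (t * length u)) * wsum g l t v = wsum g l t (u @ v) - wsum g l t u - D"
    by (simp add: D_def)
  have "cmod (wsum g l t v) = cmod (cis (- 2 * pi * (t * length u)) * wsum g l t v)" by (simp add: norm_mult)
  also have "\<dots> \<le> cmod (wsum g l t (u @ v)) + cmod (wsum g l t u) + cmod D"
    unfolding eq using norm_triangle_ineq4[of "wsum g l t (u @ v) - wsum g l t u" D]
      norm_triangle_ineq4[of "wsum g l t (u @ v)" "wsum g l t u"] by linarith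
  finally show ?thesis using wsum_append[of t u v] unfolding D_def by linarith
qed

end

section \<open>Twisted sums over blocks, prefixes of blocks and arbitrary words of the
  language\<close>

locale substitution_window = primitive_substitution + window_function
begin

text \<open>The block decomposition of \<open>twist_funpow\<close>, now with one junction error per
  letter of w.\<close>

lemma wsum_subst:
  assumes "set w \<subseteq> {..<d}"
  shows "cmod (wsum g l t (subn n w)
     - (\<Sum>c<d. twist c (\<lambda>b. t * length (sw n b)) w * wsum g l t (sw n c))) \<le> err * length w"
  using assms
proof (induction w)
  case (Cons a w)
  let ?\<xi> = "\<lambda>b. t * length (sw n b)"
  let ?S = "\<lambda>w. \<Sum>c<d. twist c ?\<xi> w * wsum g l t (sw n c)"
  let ?z = "cis (- 2 * pi * (t * length (sw n a)))"
  let ?W = "wsum g l t (subn n w)"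
  have "?S (a # w) = (\<Sum>c<d. (if c = a then wsum g l t (sw n c) else 0) + ?z * (twist c ?\<xi> w * wsum g l t (sw n c)))"
    by (intro sum.cong) (auto simp: algebra_simps)
  also have "\<dots> = wsum g l t (sw n a) + ?z * ?S w"
    using Cons.prems by (simp add: sum.distrib sum_distrib_left)
  finally have S: "?S (a # w) = wsum g l t (sw n a) + ?z * ?S w" .
  have "wsum g l t (subn n (a # w)) - ?S (a # w)
    = (wsum g l t (sw n a @ subn n w) - (wsum g l t (sw n a) + ?z * ?W)) + ?z * (?W - ?S w)"
    unfolding S sw_Cons by (simp only: algebra_simps)
  also have "cmod \<dots> \<le> err + err * length w"
  proof (rule norm_triangle_mono)
    show "cmod (wsum g l t (sw n a @ subn n w) - (wsum g l t (sw n a) + ?z * ?W)) \<le> err"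
      by (rule wsum_append)
    show "cmod (?z * (?W - ?S w)) \<le> err * length w" using Cons by (simp add: norm_mult)
  qed
  finally show ?case by (simp add: algebra_simps)
qed simp

definition psum :: "nat \<Rightarrow> real \<Rightarrow> nat \<Rightarrow> real" where
  "psum K t i = (\<Sum>a<d. cmod (wsum g l t (sw (K * i) a)))"

lemma psum_nonneg: "psum K t i \<ge> 0" by (simp add: psum_def sum_nonneg)

lemma wsum_le_psum: "a < d \<Longrightarrow> cmod (wsum g l t (sw (K * i) a)) \<le> psum K t i"
  unfolding psum_def by (rule member_le_sum) auto

text \<open>K cocycle steps at once: a block of level K (i + 1) is cut into blocks of level K i
  along the word \<open>sw K a\<close>. The coefficients are a row of the cocycle at
  \<open>orbit K t i\<close>, and \<open>gfun\<close> bounds its norm.\<close>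

lemma psum_Suc:
  "psum K t (Suc i) \<le> exp (gfun K (orbit K t i)) * psum K t i + err * (d * Lmax ^ K)"
proof -
  have "psum K t (Suc i) \<le> (\<Sum>a<d. (\<Sum>c<d. cmod (twist c (orbit K t i) (sw K a))) * psum K t i + err * real (Lmax ^ K))"
    unfolding psum_def[of K t "Suc i"]
  proof (rule sum_mono)
    fix a assume "a \<in> {..<d}"
    then have a: "a < d" by simp
    let ?S = "\<Sum>c<d. twist c (orbit K t i) (sw K a) * wsum g l t (sw (K * i) c)"
    have "cmod (wsum g l t (sw (K * Suc i) a) - ?S) \<le> err * length (sw K a)"
      using wsum_subst[OF sw_letters[OF a], of t "K * i" K] sw_add[of "K * i" K a]
      by (simp add: orbit_def[abs_def] add.commute)
    also have "\<dots> \<le> err * real (Lmax ^ K)"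
      using err_nonneg length_sw_le[OF a, of K] by (intro mult_left_mono of_nat_mono) auto
    finally have "cmod (wsum g l t (sw (K * Suc i) a)) \<le> cmod ?S + err * real (Lmax ^ K)"
      using norm_triangle_sub[of "wsum g l t (sw (K * Suc i) a)" ?S] by linarith
    also have "cmod ?S \<le> (\<Sum>c<d. cmod (twist c (orbit K t i) (sw K a)) * psum K t i)"
      by (rule order_trans[OF norm_sum]) (auto simp: norm_mult intro!: sum_mono mult_left_mono wsum_le_psum)
    finally show "cmod (wsum g l t (sw (K * Suc i) a)) \<le>
      (\<Sum>c<d. cmod (twist c (orbit K t i) (sw K a))) * psum K t i + err * real (Lmax ^ K)"
      by (simp add: sum_distrib_right)
  qed
  also have "\<dots> = snorm K (orbit K t i) * psum K t i + err * (d * Lmax ^ K)"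
    by (simp add: sum.distrib snorm_def sum_distrib_right)
  also have "\<dots> \<le> exp (gfun K (orbit K t i)) * psum K t i + err * (d * Lmax ^ K)"
    using snorm_le_exp_gfun psum_nonneg by (intro add_right_mono mult_right_mono)
  finally show ?thesis .
qed

lemma psum_0: "psum K t 0 \<le> d * B"
proof -
  have "psum K t 0 \<le> (\<Sum>a<d. B)" unfolding psum_def
    by (intro sum_mono) (use g_bound in auto)
  then show ?thesis by simp
qed

text \<open>As \<open>gfun\<close> is nonnegative, an error made at an early level is amplified by
  no more than the full product \<open>exp (gsum K t i)\<close>; the errors therefore add up only
  linearly in i.\<close>

lemma psum_bound:
  "psum K t i \<le> exp (gsum K t i) * (d * B + i * (err * (d * Lmax ^ K)))"
proof (induction i)
  case 0
  then show ?case using psum_0 by simp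
next
  case (Suc i)
  let ?C = "err * (d * Lmax ^ K)"
  let ?E = "exp (gsum K t (Suc i))"
  have C: "?C \<ge> 0" using err_nonneg by simp
  have "?E \<ge> 1" using gfun_nonneg by (simp add: sum_nonneg add_nonneg_nonneg)
  have "psum K t (Suc i) \<le> exp (gfun K (orbit K t i)) * psum K t i + ?C" by (rule psum_Suc)
  also have "\<dots> \<le> exp (gfun K (orbit K t i)) * (exp (gsum K t i) * (d * B + i * ?C)) + ?E * ?C"
    using Suc C \<open>?E \<ge> 1\<close> mult_right_mono[OF \<open>?E \<ge> 1\<close> C] by (intro add_mono mult_left_mono) auto
  also have "\<dots> = ?E * (d * B + Suc i * ?C)"
    by (simp add: exp_add algebra_simps)
  finally show ?case .
qed

text \<open>Budget for a prefix of a block: at each lower level at most \<open>Lmax ^ K\<close>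
  complete blocks, with 2 \<open>err\<close> for the junctions among them and the one to the broken
  block; B is for the letter left at level 0.\<close>

definition qsum :: "nat \<Rightarrow> real \<Rightarrow> nat \<Rightarrow> real" where
  "qsum K t i = B + (\<Sum>j<i. Lmax ^ K * (psum K t j + 2 * err))"

lemma qsum_nonneg: "qsum K t i \<ge> 0"
  using B_nonneg psum_nonneg err_nonneg by (auto simp: qsum_def intro!: add_nonneg_nonneg sum_nonneg)

lemma wsum_prefix_bound:
  assumes "a < d" "sw (K * i) a = u @ v"
  shows "cmod (wsum g l t u) \<le> qsum K t i"
  using assms
proof (induction i arbitrary: a u v)
  case 0
  then have "u = [] \<or> u = [a]" by (cases u) auto
  then show ?case using g_bound B_nonneg by (auto simp: qsum_def)
next
  case (Suc i)
  have sw: "sw (K * Suc i) a = subn (K * i) (sw K a)"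
    using sw_add[of "K * i" K a] by (simp add: add.commute)
  obtain w1 w2 u' where w: "sw K a = w1 @ w2" "u = subn (K * i) w1 @ u'"
    and u': "u' = [] \<and> w2 = [] \<or> (\<exists>b w3 r. w2 = b # w3 \<and> subn (K * i) [b] = u' @ r \<and>
        r @ subn (K * i) w3 = v)"
    using prefix_concat_decomp[OF Suc.prems(2)[unfolded sw]] by blast
  have w1: "set w1 \<subseteq> {..<d}" and w2: "set w2 \<subseteq> {..<d}" using sw_letters[OF Suc.prems(1), of K] w by auto
  have len: "length w1 \<le> Lmax ^ K" using length_sw_le[OF Suc.prems(1), of K] w by simp
  have u'_bound: "cmod (wsum g l t u') \<le> qsum K t i"
    using u'
  proof
    assume "u' = [] \<and> w2 = []" then show ?thesis using qsum_nonneg by simp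
  next
    assume "\<exists>b w3 r. w2 = b # w3 \<and> subn (K * i) [b] = u' @ r \<and>
        r @ subn (K * i) w3 = v"
    then obtain b w3 r where "w2 = b # w3" "sw (K * i) b = u' @ r" by (auto simp: sw_def)
    then show ?thesis using Suc.IH[of b u' r] w2 by simp
  qed
  let ?\<xi> = "\<lambda>b. t * length (sw (K * i) b)"
  let ?S = "\<Sum>c<d. twist c ?\<xi> w1 * wsum g l t (sw (K * i) c)"
  have "cmod ?S \<le> (\<Sum>c<d. real (count_list w1 c) * psum K t i)"
    by (rule order_trans[OF norm_sum])
       (auto simp: norm_mult intro!: sum_mono mult_mono wsum_le_psum norm_twist_le)
  also have "\<dots> = length w1 * psum K t i"
    using sum_count_set[OF w1] by (simp flip: sum_distrib_right of_nat_sum)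
  finally have "cmod (wsum g l t (subn (K * i) w1)) \<le> length w1 * psum K t i + err * length w1"
    using wsum_subst[OF w1, of t "K * i"]
      norm_triangle_sub[of "wsum g l t (subn (K * i) w1)" ?S] by linarith
  also have "\<dots> = length w1 * (psum K t i + err)" by (simp add: algebra_simps)
  also have "\<dots> \<le> real (Lmax ^ K) * (psum K t i + err)"
    using len psum_nonneg err_nonneg by (intro mult_right_mono of_nat_mono) (auto intro: add_nonneg_nonneg)
  finally have "cmod (wsum g l t u) \<le> real (Lmax ^ K) * (psum K t i + err) + qsum K t i + err"
    unfolding w(2) using norm_wsum_append_le[of t "subn (K * i) w1" u'] u'_bound by linarith
  also have "\<dots> \<le> real (Lmax ^ K) * (psum K t i + err) + qsum K t i + real (Lmax ^ K) * err"
    using err_nonneg Lmax_pos mult_right_mono[of 1 "real (Lmax ^ K)" err] by simp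
  also have "\<dots> = qsum K t (Suc i)" by (simp add: qsum_def algebra_simps)
  finally show ?case .
qed

text \<open>A factor is the difference of the two prefixes x @ u and x.\<close>

lemma wsum_factor_bound:
  assumes "a < d" "sw (K * i) a = x @ u @ v"
  shows "cmod (wsum g l t u) \<le> 2 * qsum K t i + err"
  using wsum_prefix_bound[OF assms(1), of K i "x @ u" v t] wsum_prefix_bound[OF assms(1), of K i x "u @ v" t]
    norm_wsum_suffix_le[of t u x] assms by simp

text \<open>A word no longer than any block meets at most two of them. It is then a factor of one
  block, or a suffix of one (2 \<open>qsum\<close> + \<open>err\<close>) followed by a prefix of the
  next (\<open>qsum\<close>), joined at the price of one more \<open>err\<close>.\<close>

lemma wsum_two_block_bound:
  assumes w: "set w \<subseteq> {..<d}" and W: "subn (K * i) w = X @ W @ Y"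
    and len: "\<And>b. b < d \<Longrightarrow> length W \<le> length (sw (K * i) b)"
  shows "cmod (wsum g l t W) \<le> 3 * qsum K t i + 2 * err"
proof -
  obtain w1 w2 x where w12: "w = w1 @ w2" "X = subn (K * i) w1 @ x"
    and x: "x = [] \<and> w2 = [] \<or> (\<exists>b w3 r. w2 = b # w3 \<and> subn (K * i) [b] = x @ r \<and>
        r @ subn (K * i) w3 = W @ Y)"
    using prefix_concat_decomp[OF W] by blast
  note nn = qsum_nonneg[of K t i] err_nonneg
  from x show ?thesis
  proof
    assume "x = [] \<and> w2 = []"
    then have "W = []" using W w12 by simp
    then show ?thesis using nn by simp
  next
    assume "\<exists>b w3 r. w2 = b # w3 \<and> subn (K * i) [b] = x @ r \<and>
        r @ subn (K * i) w3 = W @ Y"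
    then obtain b w3 r where b: "w2 = b # w3" "sw (K * i) b = x @ r"
      "r @ subn (K * i) w3 = W @ Y" by (auto simp: sw_def)
    have bd: "b < d" and w3: "set w3 \<subseteq> {..<d}" using w w12 b by auto
    from b(3) obtain z where "r = W @ z \<and> z @ subn (K * i) w3 = Y \<or>
        r @ z = W \<and> subn (K * i) w3 = z @ Y"
      by (auto simp: append_eq_append_conv2)
    then show ?thesis
    proof
      assume "r = W @ z \<and> z @ subn (K * i) w3 = Y"
      then show ?thesis using wsum_factor_bound[OF bd, of K i x W z t] b(2) nn by simp
    next
      assume rz: "r @ z = W \<and> subn (K * i) w3 = z @ Y"
      have r: "cmod (wsum g l t r) \<le> 2 * qsum K t i + err"
        using wsum_factor_bound[OF bd, of K i x r "[]" t] b(2) by simp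
      have z: "cmod (wsum g l t z) \<le> qsum K t i"
      proof (cases w3)
        case Nil
        then show ?thesis using rz nn by simp
      next
        case (Cons c w4)
        then have c: "c < d" using w3 by simp
        have "sw (K * i) c @ subn (K * i) w4 = z @ Y"
          using rz Cons by (simp add: sw_Cons)
        moreover have "length z \<le> length (sw (K * i) c)" using len[OF c] rz by auto
        ultimately have "sw (K * i) c = z @ drop (length z) (sw (K * i) c)"
          by (metis append_eq_append_conv_if append_eq_conv_conj)
        then show ?thesis by (rule wsum_prefix_bound[OF c])
      qed
      have "cmod (wsum g l t (r @ z)) \<le> 3 * qsum K t i + 2 * err"
        using norm_wsum_append_le[of t r z] r z by linarith
      then show ?thesis using rz by simp
    qed
  qed
qed

text \<open>Iterates commute: a occurs in the image of 0 under \<open>prim_exp + n\<close> steps,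
  and applying m more steps equals applying n steps to another word. So a word of the language can
  be cut into blocks of any prescribed level n, whatever m it came from.\<close>

lemma sublist_higher_level:
  assumes "a < d" "sublist W (sw m a)"
  obtains w X Y where "set w \<subseteq> {..<d}" "subn n w = X @ W @ Y"
proof -
  have "cnt (prim_exp + n) a 0 > 0" using cnt_pos[of "prim_exp + n" a 0] assms d_pos by simp
  then have "a \<in> set (sw (prim_exp + n) 0)" by (metis cnt_def count_notin not_less0)
  then obtain p q where pq: "sw (prim_exp + n) 0 = p @ a # q" by (meson split_list)
  have "sublist W (subn m (sw (prim_exp + n) 0))"
  proof -
    obtain ps ss where "sw m a = ps @ W @ ss" using assms(2) by (auto simp: sublist_def)
    then have "subn m (sw (prim_exp + n) 0)
        = (subn m p @ ps) @ W @ (ss @ subn m q)"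
      by (simp add: pq subst_word_funpow_append sw_Cons)
    then show ?thesis unfolding sublist_def by blast
  qed
  also have "subn m (sw (prim_exp + n) 0) = subn n (sw (m + prim_exp) 0)"
    by (simp flip: sw_add add: add_ac)
  finally obtain X Y where "subn n (sw (m + prim_exp) 0) = X @ W @ Y"
    by (auto simp: sublist_def)
  then show ?thesis using that sw_letters[of 0 "m + prim_exp"] d_pos by simp
qed

text \<open>C depends on N0 but not on t: the first N0 values of \<open>gfun\<close> are bounded by
  a constant H, and afterwards the hypothesis takes over. One factor 1 + i stems from the errors in
  \<open>psum_bound\<close>, the other from the sum over levels in \<open>qsum\<close>.\<close>

theorem wsum_growth:
  assumes c: "c \<ge> 0"
  obtains C where "C \<ge> 0"
    "\<And>t i W m a. (\<And>N. N \<ge> N0 \<Longrightarrow> gsum K t N \<le> c * N) \<Longrightarrow> a < d \<Longrightarrow> sublist W (sw m a)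
      \<Longrightarrow> (\<And>b. b < d \<Longrightarrow> length W \<le> length (sw (K * i) b)) \<Longrightarrow>
      cmod (wsum g l t W) \<le> C * (1 + real i)\<^sup>2 * exp (c * i)"
proof -
  define H where "H = ln (1 + real d) + (ln d + K * ln Lmax)"
  have H0: "H \<ge> 0" using d_pos Lmax_pos by (simp add: H_def)
  have gH: "gfun K \<xi> \<le> H" for \<xi>
    using gfun_le[of K \<xi>] max_ln_snorm_le[of K \<xi>] unfolding H_def by linarith
  define C0 where "C0 = err * (d * Lmax ^ K)"
  define D where "D = exp (N0 * H) * (d * B + C0)"
  define L where "L = real (Lmax ^ K)"
  have nn: "C0 \<ge> 0" "D \<ge> 0" "L \<ge> 0"
    using err_nonneg B_nonneg by (auto simp: C0_def D_def L_def)
  define C where "C = 3 * (B + L * (D + 2 * err)) + 2 * err"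
  have "C \<ge> 0" using nn B_nonneg err_nonneg by (simp add: C_def)
  moreover have "cmod (wsum g l t W) \<le> C * (1 + real i)\<^sup>2 * exp (c * i)"
    if avg: "\<And>N. N \<ge> N0 \<Longrightarrow> gsum K t N \<le> c * N" and "a < d" "sublist W (sw m a)"
      and len: "\<And>b. b < d \<Longrightarrow> length W \<le> length (sw (K * i) b)" for t i W m a
  proof -
    have avg': "gsum K t n \<le> N0 * H + c * n" for n
    proof (cases "n \<ge> N0")
      case True
      then show ?thesis using avg[OF True] mult_nonneg_nonneg[OF of_nat_0_le_iff[of N0] H0] by linarith
    next
      case False
      have "gsum K t n \<le> (\<Sum>j<n. H)" using gH by (rule sum_mono)
      also have "\<dots> \<le> N0 * H" using False H0 by (simp add: mult_right_mono)
      finally show ?thesis using c by (simp add: add_increasing2)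
    qed
    have p: "psum K t j \<le> D * (1 + real i) * exp (c * i)" if "j \<le> i" for j
    proof -
      have "psum K t j \<le> exp (gsum K t j) * (d * B + j * C0)"
        unfolding C0_def by (rule psum_bound)
      also have "\<dots> \<le> exp (N0 * H + c * i) * ((d * B + C0) * (1 + real i))"
      proof (rule mult_mono)
        have "c * j \<le> c * i" using c that by (intro mult_left_mono) auto
        then show "exp (gsum K t j) \<le> exp (N0 * H + c * i)" using avg'[of j] by simp
        have "real j * C0 \<le> real i * C0" using that nn by (intro mult_right_mono) auto
        moreover have "0 \<le> d * B * real i" using B_nonneg by simp
        ultimately show "d * B + j * C0 \<le> (d * B + C0) * (1 + real i)"
          using nn by (simp add: algebra_simps)
      qed (use B_nonneg nn in auto)
      also have "\<dots> = D * (1 + real i) * exp (c * i)" by (simp add: D_def exp_add)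
      finally show ?thesis .
    qed
    define E where "E = (1 + real i) * exp (c * i)"
    have E: "E \<ge> 1" using c mult_mono[of 1 "1 + real i" 1 "exp (c * i)"] by (simp add: E_def)
    have "qsum K t i \<le> B + (\<Sum>j<i. L * ((D + 2 * err) * E))"
      unfolding qsum_def
    proof (intro add_left_mono sum_mono)
      fix j assume "j \<in> {..<i}"
      then have "psum K t j \<le> D * E" using p[of j] by (simp add: E_def mult.assoc)
      moreover have "2 * err \<le> 2 * err * E" using E err_nonneg mult_left_mono[of 1 E "2 * err"] by simp
      ultimately have "psum K t j + 2 * err \<le> (D + 2 * err) * E" by (simp add: distrib_right)
      then show "Lmax ^ K * (psum K t j + 2 * err) \<le> L * ((D + 2 * err) * E)"
        unfolding L_def by (simp add: mult_left_mono)
    qed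
    also have "\<dots> = B + real i * (L * ((D + 2 * err) * E))" by simp
    also have "\<dots> \<le> (1 + real i) * (B * E) + (1 + real i) * (L * ((D + 2 * err) * E))"
    proof (rule add_mono)
      have "B * 1 \<le> B * E" using E B_nonneg by (intro mult_left_mono)
      also have "\<dots> \<le> (1 + real i) * (B * E)"
        using B_nonneg E mult_right_mono[of 1 "1 + real i" "B * E"] by simp
      finally show "B \<le> (1 + real i) * (B * E)" by simp
      show "real i * (L * ((D + 2 * err) * E)) \<le> (1 + real i) * (L * ((D + 2 * err) * E))"
        using nn err_nonneg E by (intro mult_right_mono) auto
    qed
    also have "\<dots> = (B + L * (D + 2 * err)) * ((1 + real i) * E)" by (simp add: algebra_simps)
    finally have q: "qsum K t i \<le> (B + L * (D + 2 * err)) * ((1 + real i) * E)" .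
    have E2: "(1 + real i) * E \<ge> 1" using E mult_mono[of 1 "1 + real i" 1 E] by simp
    obtain w X Y where w: "set w \<subseteq> {..<d}" "subn (K * i) w = X @ W @ Y"
      using sublist_higher_level[OF \<open>a < d\<close> \<open>sublist W (sw m a)\<close>] by blast
    have "cmod (wsum g l t W) \<le> 3 * qsum K t i + 2 * err"
      by (rule wsum_two_block_bound[OF w len])
    also have "\<dots> \<le> 3 * ((B + L * (D + 2 * err)) * ((1 + real i) * E)) + 2 * err * ((1 + real i) * E)"
      using q E2 err_nonneg mult_left_mono[of 1 "(1 + real i) * E" "2 * err"] by simp
    also have "\<dots> = C * ((1 + real i) * E)" by (simp add: C_def algebra_simps)
    also have "\<dots> = C * (1 + real i)\<^sup>2 * exp (c * i)" by (simp add: E_def power2_eq_square)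
    finally show ?thesis .
  qed
  ultimately show ?thesis using that by blast
qed

end

section \<open>Spectral measures of stationary processes\<close>

lemma norm_add_sq_le: "(cmod (x + y))\<^sup>2 \<le> 2 * (cmod x)\<^sup>2 + 2 * (cmod y)\<^sup>2"
proof -
  have "(cmod (x + y))\<^sup>2 \<le> (cmod x + cmod y)\<^sup>2" by (intro power_mono norm_triangle_ineq) auto
  also have "\<dots> \<le> 2 * (cmod x)\<^sup>2 + 2 * (cmod y)\<^sup>2"
    using sum_squares_bound[of "cmod x" "cmod y"] by (simp add: power2_sum)
  finally show ?thesis .
qed

lemma borel_measurable_cnj [measurable]: "cnj \<in> borel_measurable borel"
  by (intro borel_measurable_continuous_onI continuous_intros)

lemma has_bochner_integral_mono:
  fixes f g :: "'a \<Rightarrow> real"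
  assumes "has_bochner_integral M f x" "has_bochner_integral M g y" "\<And>a. f a \<le> g a"
  shows "x \<le> y"
  using assms integral_mono[of M f g] by (auto simp: has_bochner_integral_iff)

definition sqint :: "'a measure \<Rightarrow> ('a \<Rightarrow> complex) \<Rightarrow> bool" where
  "sqint M f \<longleftrightarrow> f \<in> borel_measurable M \<and> integrable M (\<lambda>x. (cmod (f x))\<^sup>2)"

lemma sqint_mult:
  assumes "sqint M f" "sqint M g"
  shows "integrable M (\<lambda>x. f x * cnj (g x))"
proof (rule Bochner_Integration.integrable_bound)
  have [measurable]: "f \<in> borel_measurable M" "g \<in> borel_measurable M" using assms by (auto simp: sqint_def)
  show "integrable M (\<lambda>x. (cmod (f x))\<^sup>2 + (cmod (g x))\<^sup>2)" using assms by (auto simp: sqint_def)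
  show "AE x in M. norm (f x * cnj (g x)) \<le> norm ((cmod (f x))\<^sup>2 + (cmod (g x))\<^sup>2)"
  proof (rule AE_I2)
    fix x
    have "2 * (cmod (f x) * cmod (g x)) \<le> (cmod (f x))\<^sup>2 + (cmod (g x))\<^sup>2"
      using sum_squares_bound[of "cmod (f x)" "cmod (g x)"] by (simp add: mult.assoc)
    moreover have "0 \<le> cmod (f x) * cmod (g x)" by simp
    ultimately have "cmod (f x) * cmod (g x) \<le> (cmod (f x))\<^sup>2 + (cmod (g x))\<^sup>2" by linarith
    then show "norm (f x * cnj (g x)) \<le> norm ((cmod (f x))\<^sup>2 + (cmod (g x))\<^sup>2)"
      by (simp add: norm_mult)
  qed
  show "(\<lambda>x. f x * cnj (g x)) \<in> borel_measurable M" by measurable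
qed

lemma sqint_add:
  assumes "sqint M f" "sqint M g"
  shows "sqint M (\<lambda>x. f x + g x)"
  unfolding sqint_def
proof (intro conjI)
  have [measurable]: "f \<in> borel_measurable M" "g \<in> borel_measurable M" using assms by (auto simp: sqint_def)
  show "(\<lambda>x. f x + g x) \<in> borel_measurable M" by measurable
  show "integrable M (\<lambda>x. (cmod (f x + g x))\<^sup>2)"
  proof (rule Bochner_Integration.integrable_bound)
    show "integrable M (\<lambda>x. 2 * (cmod (f x))\<^sup>2 + 2 * (cmod (g x))\<^sup>2)" using assms by (auto simp: sqint_def)
  qed (use norm_add_sq_le in \<open>auto\<close>)
qed

lemma sqint_cmult: "sqint M f \<Longrightarrow> sqint M (\<lambda>x. c * f x)"
  by (auto simp: sqint_def norm_mult power_mult_distrib)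

lemma sqint_diff: "sqint M f \<Longrightarrow> sqint M g \<Longrightarrow> sqint M (\<lambda>x. f x - g x)"
  using sqint_add[of M f "\<lambda>x. - 1 * g x"] sqint_cmult[of M g "- 1"] by simp

lemma sqint_sum: "(\<And>i. i \<in> A \<Longrightarrow> sqint M (f i)) \<Longrightarrow> sqint M (\<lambda>x. \<Sum>i\<in>A. f i x)"
proof (induction A rule: infinite_finite_induct)
  case (insert a A)
  then show ?case using sqint_add[of M "f a" "\<lambda>x. \<Sum>i\<in>A. f i x"] by simp
qed (auto simp: sqint_def)

section \<open>Correlations, twisted Birkhoff sums and the spectral measure\<close>

locale stationary = prob_space \<mu> for \<mu> :: "(int \<Rightarrow> nat) measure" +
  assumes sets_mu: "sets \<mu> = sets seq_space"
    and stat: "distr \<mu> \<mu> (shift_pow n) = \<mu>"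
begin

lemma space_mu [simp]: "space \<mu> = UNIV"
  using sets_eq_imp_space_eq[OF sets_mu] by (simp add: seq_space_def space_PiM)

lemma shift_measurable [measurable]: "shift_pow n \<in> measurable \<mu> \<mu>"
proof -
  have "shift_pow n \<in> measurable seq_space seq_space"
    unfolding shift_pow_def seq_space_def
    by (intro measurable_PiM_single') (auto simp: space_PiM)
  then show ?thesis using sets_mu measurable_cong_sets by blast
qed

lemma shift_pow_add: "shift_pow m (shift_pow n x) = shift_pow (m + n) x"
  by (simp add: shift_pow_def fun_eq_iff add.assoc)

lemma shift_pow_0 [simp]: "shift_pow 0 x = x" by (simp add: shift_pow_def)

lemma integrable_shift:
  fixes F :: "(int \<Rightarrow> nat) \<Rightarrow> 'b::{banach, second_countable_topology}"
  assumes "integrable \<mu> F" shows "integrable \<mu> (\<lambda>x. F (shift_pow n x))"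
  using assms integrable_distr[OF shift_measurable[of n], of F] by (simp add: stat)

lemma integral_shift:
  fixes F :: "(int \<Rightarrow> nat) \<Rightarrow> 'b::{banach, second_countable_topology}"
  assumes "F \<in> borel_measurable \<mu>" shows "(\<integral>x. F (shift_pow n x) \<partial>\<mu>) = (\<integral>x. F x \<partial>\<mu>)"
  using integral_distr[OF shift_measurable[of n] assms] by (simp add: stat)

lemma sqint_shift: "sqint \<mu> f \<Longrightarrow> sqint \<mu> (\<lambda>x. f (shift_pow n x))"
  using integrable_shift[of "\<lambda>x. (cmod (f x))\<^sup>2" n] by (auto simp: sqint_def)

definition corr :: "((int \<Rightarrow> nat) \<Rightarrow> complex) \<Rightarrow> int \<Rightarrow> complex" where
  "corr f n = (\<integral>x. f (shift_pow n x) * cnj (f x) \<partial>\<mu>)"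

lemma corr_diff:
  assumes "sqint \<mu> f"
  shows "corr f (m - n) = (\<integral>x. f (shift_pow m x) * cnj (f (shift_pow n x)) \<partial>\<mu>)"
proof -
  have [measurable]: "f \<in> borel_measurable \<mu>" using assms by (simp add: sqint_def)
  have [measurable]: "(\<lambda>x. f (shift_pow k x)) \<in> borel_measurable \<mu>" for k
    by (rule measurable_compose[OF shift_measurable]) measurable
  show ?thesis
    unfolding corr_def by (subst integral_shift[of _ n, symmetric], measurable) (simp add: shift_pow_add)
qed

definition bsum :: "((int \<Rightarrow> nat) \<Rightarrow> complex) \<Rightarrow> nat \<Rightarrow> real \<Rightarrow> (int \<Rightarrow> nat) \<Rightarrow> complex" where
  "bsum f N t x = (\<Sum>n<N. cis (- 2 * pi * (real n * t)) * f (shift_pow (int n) x))"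

definition bnorm :: "((int \<Rightarrow> nat) \<Rightarrow> complex) \<Rightarrow> nat \<Rightarrow> real \<Rightarrow> real" where
  "bnorm f N t = (\<integral>x. (cmod (bsum f N t x))\<^sup>2 \<partial>\<mu>)"

lemma bnorm_nonneg: "bnorm f N t \<ge> 0"
  by (simp add: bnorm_def)

lemma sqint_bsum: "sqint \<mu> f \<Longrightarrow> sqint \<mu> (bsum f N t)"
  unfolding bsum_def[abs_def] by (intro sqint_sum sqint_cmult sqint_shift)

text \<open>Expand the square; by stationarity the inner product of two shifts depends only on their
  difference. This yields the nonnegativity that \<open>herglotz\<close> asks for.\<close>

lemma bnorm_eq_toeplitz:
  assumes f: "sqint \<mu> f"
  shows "complex_of_real (bnorm f N t) = toeplitz_form (corr f) N t"
proof -
  have eq: "complex_of_real ((cmod (bsum f N t x))\<^sup>2) = (\<Sum>m<N. \<Sum>n<N. cis (- 2 * pi * of_int (int m - int n) * t) *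
      (f (shift_pow (int m) x) * cnj (f (shift_pow (int n) x))))" for x
  proof -
    have "complex_of_real ((cmod (bsum f N t x))\<^sup>2) = bsum f N t x * cnj (bsum f N t x)"
      by (rule complex_norm_square)
    also have "\<dots> = (\<Sum>m<N. \<Sum>n<N. (cis (- 2 * pi * (real m * t)) * f (shift_pow (int m) x)) *
        (cnj (cis (- 2 * pi * (real n * t))) * cnj (f (shift_pow (int n) x))))"
      by (simp add: bsum_def sum_product)
    also have "\<dots> = (\<Sum>m<N. \<Sum>n<N. cis (- 2 * pi * of_int (int m - int n) * t) *
      (f (shift_pow (int m) x) * cnj (f (shift_pow (int n) x))))"
    proof (intro sum.cong refl)
      fix m n
      have cis: "cis (- 2 * pi * (real m * t)) * cnj (cis (- 2 * pi * (real n * t))) = cis (- 2 * pi * of_int (int m - int n) * t)"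
        by (simp add: cis_cnj cis_mult algebra_simps)
      have swap: "(a * b) * (c * e) = (a * c) * (b * e)" for a b c e :: complex
        by (simp add: mult_ac)
      show "(cis (- 2 * pi * (real m * t)) * f (shift_pow (int m) x)) *
        (cnj (cis (- 2 * pi * (real n * t))) * cnj (f (shift_pow (int n) x))) = cis (- 2 * pi * of_int (int m - int n) * t) *
      (f (shift_pow (int m) x) * cnj (f (shift_pow (int n) x)))"
        by (subst swap, subst cis) (rule refl)
    qed
    finally show ?thesis .
  qed
  have int: "integrable \<mu> (\<lambda>x. f (shift_pow m x) * cnj (f (shift_pow n x)))" for m n
    by (intro sqint_mult sqint_shift f)
  have "complex_of_real (bnorm f N t) = (\<integral>x. complex_of_real ((cmod (bsum f N t x))\<^sup>2) \<partial>\<mu>)"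
    unfolding bnorm_def by (rule integral_complex_of_real[symmetric])
  also have "\<dots> = (\<Sum>m<N. \<Sum>n<N. cis (- 2 * pi * of_int (int m - int n) * t) *
      (\<integral>x. f (shift_pow (int m) x) * cnj (f (shift_pow (int n) x)) \<partial>\<mu>))"
    unfolding eq using int by (simp add: Bochner_Integration.integral_sum)
  also have "\<dots> = toeplitz_form (corr f) N t"
    unfolding toeplitz_form_def corr_diff[OF f] ..
  finally show ?thesis .
qed

abbreviation nsq :: "((int \<Rightarrow> nat) \<Rightarrow> complex) \<Rightarrow> real" where
  "nsq f \<equiv> \<integral>x. (cmod (f x))\<^sup>2 \<partial>\<mu>"

abbreviation dsq :: "((int \<Rightarrow> nat) \<Rightarrow> complex) \<Rightarrow> ((int \<Rightarrow> nat) \<Rightarrow> complex) \<Rightarrow> real" where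
  "dsq f h \<equiv> nsq (\<lambda>x. f x - h x)"

lemma corr_0: "corr f 0 = complex_of_real (nsq f)"
  unfolding corr_def by (simp add: complex_norm_square[symmetric] integral_complex_of_real[symmetric] del: integral_complex_of_real)

theorem spectral_measure_exists:
  assumes f: "sqint \<mu> f"
  shows "\<exists>\<sigma>. is_spectral_measure \<mu> f \<sigma>"
proof -
  have "\<exists>\<sigma>::real measure. sets \<sigma> = sets borel \<and> finite_measure \<sigma> \<and> emeasure \<sigma> (UNIV - {0..<1}) = 0 \<and>
     (\<forall>n::int. integrable \<sigma> (\<lambda>t. cis (2 * pi * n * t)) \<and> (\<integral>t. cis (2 * pi * n * t) \<partial>\<sigma>) = corr f n)"
  proof (rule herglotz)
    show "Im (toeplitz_form (corr f) N t) = 0 \<and> 0 \<le> Re (toeplitz_form (corr f) N t)" for N t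
      unfolding bnorm_eq_toeplitz[OF f, symmetric] using bnorm_nonneg by simp
    assume "corr f 0 = 0"
    then have "nsq f = 0" unfolding corr_0 of_real_eq_0_iff .
    then have "AE x in \<mu>. (cmod (f x))\<^sup>2 = 0"
      using f by (subst (asm) integral_nonneg_eq_0_iff_AE) (auto simp: sqint_def)
    then have "AE x in \<mu>. f (shift_pow n x) * cnj (f x) = 0" for n
      by eventually_elim simp
    then show "corr f n = 0" for n
      unfolding corr_def by (rule integral_eq_zero_AE)
  qed
  then show ?thesis
    unfolding is_spectral_measure_def exp_eq_cis_int corr_def by simp
qed

text \<open>Parseval in the frequency. It is what controls the error f - h of an approximation,
  about which nothing is known at individual frequencies.\<close>

lemma integral_bnorm:
  assumes "sqint \<mu> f"
  shows "has_bochner_integral lborel (\<lambda>t. indicator {0..1} t * bnorm f N t) (N * nsq f)"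
proof -
  have "has_bochner_integral lborel (\<lambda>t. indicator {0..1} t *\<^sub>R complex_of_real (bnorm f N t))
     (complex_of_real (N * nsq f))"
    using toeplitz_form_fourier[of 0 "corr f" N] unfolding count_diff_zero corr_0 bnorm_eq_toeplitz[OF assms]
    by (simp add: mult.commute)
  from has_bochner_integral_Re[OF this] show ?thesis by (simp add: scaleR_conv_of_real)
qed

lemma bnorm_add_le:
  assumes "sqint \<mu> f" "sqint \<mu> h"
  shows "bnorm f N t \<le> 2 * bnorm h N t + 2 * bnorm (\<lambda>x. f x - h x) N t"
proof -
  have int: "integrable \<mu> (\<lambda>x. (cmod (bsum u N t x))\<^sup>2)" if "sqint \<mu> u" for u
    using sqint_bsum[OF that] by (simp add: sqint_def)
  have "bsum f N t x = bsum h N t x + bsum (\<lambda>x. f x - h x) N t x" for x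
    by (simp add: bsum_def sum.distrib[symmetric] algebra_simps)
  then have "(cmod (bsum f N t x))\<^sup>2 \<le> 2 * (cmod (bsum h N t x))\<^sup>2 + 2 * (cmod (bsum (\<lambda>x. f x - h x) N t x))\<^sup>2" for x
    using norm_add_sq_le by simp
  then have "bnorm f N t \<le> (\<integral>x. 2 * (cmod (bsum h N t x))\<^sup>2 + 2 * (cmod (bsum (\<lambda>x. f x - h x) N t x))\<^sup>2 \<partial>\<mu>)"
    unfolding bnorm_def using int assms sqint_diff[OF assms] by (intro integral_mono) auto
  also have "\<dots> = 2 * bnorm h N t + 2 * bnorm (\<lambda>x. f x - h x) N t"
    unfolding bnorm_def using int assms sqint_diff[OF assms] by simp
  finally show ?thesis .
qed

text \<open>The spectral theorem for the vector \<open>bsum f N t\<close>: both sides expand into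
  the same combination of correlations.\<close>

lemma bnorm_spectral:
  assumes f: "sqint \<mu> f" and \<sigma>: "is_spectral_measure \<mu> f \<sigma>"
  shows "has_bochner_integral \<sigma> (\<lambda>s. (cmod (\<Sum>n<N. cis (2 * pi * (real n * (s - t)))))\<^sup>2) (bnorm f N t)"
proof -
  have \<sigma>': "has_bochner_integral \<sigma> (\<lambda>s. cis (2 * pi * of_int n * s)) (corr f n)" for n :: int
    using \<sigma> unfolding is_spectral_measure_def exp_eq_cis_int corr_def by (auto simp: has_bochner_integral_iff)
  have eq: "complex_of_real ((cmod (\<Sum>n<N. cis (2 * pi * (real n * (s - t)))))\<^sup>2)
     = (\<Sum>m<N. \<Sum>n<N. cis (- 2 * pi * of_int (int m - int n) * t) * cis (2 * pi * of_int (int m - int n) * s))" for s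
    unfolding complex_norm_square cnj_sum sum_product
    by (intro sum.cong refl) (simp add: cis_cnj cis_mult algebra_simps)
  have "has_bochner_integral \<sigma> (\<lambda>s. complex_of_real ((cmod (\<Sum>n<N. cis (2 * pi * (real n * (s - t)))))\<^sup>2)) (toeplitz_form (corr f) N t)"
    unfolding eq toeplitz_form_def
    by (intro has_bochner_integral_sum has_bochner_integral_mult_right \<sigma>')
  from has_bochner_integral_Re[OF this] show ?thesis
    unfolding bnorm_eq_toeplitz[OF f, symmetric] by simp
qed

text \<open>The bound 1/(6 N) keeps every phase within pi/3 of 0, where the cosine is at least
  1/2.\<close>

lemma dirichlet_lower:
  assumes "\<bar>x\<bar> \<le> 1 / (6 * real N)" "N > 0"
  shows "real N / 2 \<le> cmod (\<Sum>n<N. cis (2 * pi * (real n * x)))"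
proof -
  have "real N / 2 = (\<Sum>n<N. 1 / 2)" by simp
  also have "\<dots> \<le> (\<Sum>n<N. cos (2 * pi * (real n * x)))"
  proof (rule sum_mono)
    fix n assume "n \<in> {..<N}"
    then have "real n * \<bar>x\<bar> \<le> real N * (1 / (6 * real N))" using assms by (intro mult_mono) auto
    then have "\<bar>2 * pi * (n * x)\<bar> \<le> pi / 3" using assms by (simp add: abs_mult)
    then have "cos (pi / 3) \<le> cos \<bar>2 * pi * (n * x)\<bar>" by (intro cos_monotone_0_pi_le) auto
    then show "1 / 2 \<le> cos (2 * pi * (real n * x))" by (simp add: cos_60)
  qed
  also have "\<dots> = Re (\<Sum>n<N. cis (2 * pi * (real n * x)))" by (simp add: Re_sum)
  also have "\<dots> \<le> cmod (\<Sum>n<N. cis (2 * pi * (real n * x)))" by (rule complex_Re_le_cmod)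
  finally show ?thesis .
qed

lemma spectral_measure_interval:
  assumes f: "sqint \<mu> f" and \<sigma>: "is_spectral_measure \<mu> f \<sigma>" and "N > 0"
    and I: "I \<in> sets borel" "\<And>s. s \<in> I \<Longrightarrow> \<bar>s - t\<bar> \<le> 1 / (6 * real N)"
  shows "measure \<sigma> I * ((real N)\<^sup>2 / 4) \<le> bnorm f N t"
proof -
  interpret \<sigma>: finite_measure \<sigma> using \<sigma> by (simp add: is_spectral_measure_def)
  have [simp]: "sets \<sigma> = sets borel" using \<sigma> by (simp add: is_spectral_measure_def)
  have "measure \<sigma> I * ((real N)\<^sup>2 / 4) = (\<integral>s. indicator I s * ((real N)\<^sup>2 / 4) \<partial>\<sigma>)"
    using I by simp
  also have "\<dots> \<le> (\<integral>s. (cmod (\<Sum>n<N. cis (2 * pi * (real n * (s - t)))))\<^sup>2 \<partial>\<sigma>)"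
  proof (rule integral_mono)
    show "integrable \<sigma> (\<lambda>s. indicator I s * ((real N)\<^sup>2 / 4))"
      using I(1) by (intro integrable_mult_left integrable_real_indicator) (auto simp: \<sigma>.emeasure_eq_measure)
    show "integrable \<sigma> (\<lambda>s. (cmod (\<Sum>n<N. cis (2 * pi * (real n * (s - t)))))\<^sup>2)"
      using bnorm_spectral[OF f \<sigma>] by (simp add: has_bochner_integral_iff)
    fix s
    show "indicator I s * ((real N)\<^sup>2 / 4) \<le> (cmod (\<Sum>n<N. cis (2 * pi * (real n * (s - t)))))\<^sup>2"
    proof (cases "s \<in> I")
      case True
      have "(real N / 2)\<^sup>2 \<le> (cmod (\<Sum>n<N. cis (2 * pi * (real n * (s - t)))))\<^sup>2"
        using dirichlet_lower[OF I(2)[OF True] \<open>N > 0\<close>] by (intro power_mono) auto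
      then show ?thesis using True by (simp add: power_divide)
    qed simp
  qed
  also have "\<dots> = bnorm f N t" using bnorm_spectral[OF f \<sigma>] by (simp add: has_bochner_integral_iff)
  finally show ?thesis .
qed

text \<open>Averaging over the cells of a grid of mesh \<open>1 / (6 N)\<close> that meet \<open>A\<close>.\<close>
theorem spectral_measure_le:
  assumes f: "sqint \<mu> f" and h: "sqint \<mu> h" and \<sigma>: "is_spectral_measure \<mu> f \<sigma>" and N: "N > 0"
    and A: "A \<in> sets borel" "A \<subseteq> {0..<1}"
    and small: "\<And>t t0. t0 \<in> A \<Longrightarrow> \<bar>t - t0\<bar> \<le> 1 / (6 * real N) \<Longrightarrow> bnorm h N t \<le> \<epsilon> * N" and "\<epsilon> \<ge> 0"
  shows "measure \<sigma> A \<le> 48 * (\<epsilon> + dsq f h)"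
proof -
  interpret \<sigma>: finite_measure \<sigma> using \<sigma> by (simp add: is_spectral_measure_def)
  have [simp]: "sets \<sigma> = sets borel" using \<sigma> by (simp add: is_spectral_measure_def)
  define M where "M = 6 * N"
  have M: "M > 0" using N by (simp add: M_def)
  define I where "I j = {real j / M..<real (Suc j) / M}" for j
  define J where "J = {j. j < M \<and> I j \<inter> A \<noteq> {}}"
  define e where "e x = f x - h x" for x
  have e: "sqint \<mu> e" unfolding e_def by (intro sqint_diff f h)
  have finJ: "finite J" by (simp add: J_def)
  have width: "\<bar>s - t\<bar> \<le> 1 / (6 * real N)" if "s \<in> I j" "t \<in> I j" for s t j
  proof -
    have "real (Suc j) / M = real j / M + 1 / (6 * real N)" using N by (simp add: M_def add_divide_distrib)
    then show ?thesis using that by (auto simp: I_def)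
  qed
  have A_sub: "A \<subseteq> (\<Union>j\<in>J. I j)"
  proof
    fix x assume x: "x \<in> A"
    define j where "j = nat \<lfloor>x * M\<rfloor>"
    have "0 \<le> x * M" "x * M < M" using x A M by (auto simp: mult_less_cancel_right1)
    then have j: "real j \<le> x * M" "x * M < real j + 1" "j < M"
      unfolding j_def by linarith+
    then have "x \<in> I j" using M by (simp add: I_def field_simps)
    then show "x \<in> (\<Union>j\<in>J. I j)" using j x by (auto simp: J_def)
  qed
  have disj: "disjoint_family_on I J"
    unfolding disjoint_family_on_def
  proof (intro ballI impI)
    fix i j :: nat assume "i \<noteq> j"
    have "I i \<inter> I j = {}" if "i < j" for i j :: nat
    proof -
      have "real (Suc i) / M \<le> real j / M" using that by (intro divide_right_mono) auto
      then show ?thesis by (auto simp: I_def)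
    qed
    then show "I i \<inter> I j = {}" using \<open>i \<noteq> j\<close> by (metis Int_commute linorder_neqE_nat)
  qed
  have cell: "measure \<sigma> (I j) * ((real N)\<^sup>2 / 4) \<le> 2 * (\<epsilon> * N) + 2 * bnorm e N t" if j: "j \<in> J" and t: "t \<in> I j" for j t
  proof -
    \<comment> \<open>The cell has width 1/(6 N) and meets A, so the estimate \<open>small\<close>
      spreads from t0 to every t of the cell.\<close>
    obtain t0 where t0: "t0 \<in> I j" "t0 \<in> A" using j by (auto simp: J_def)
    have "measure \<sigma> (I j) * ((real N)\<^sup>2 / 4) \<le> bnorm f N t"
      by (rule spectral_measure_interval[OF f \<sigma> N]) (use width t in \<open>auto simp: I_def\<close>)
    also have "\<dots> \<le> 2 * bnorm h N t + 2 * bnorm e N t" unfolding e_def by (rule bnorm_add_le[OF f h])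
    also have "bnorm h N t \<le> \<epsilon> * N" by (rule small[OF t0(2)]) (rule width[OF t t0(1)])
    finally show ?thesis by simp
  qed
  have int_I: "has_bochner_integral lborel (\<lambda>t. indicator (I j) t * c) (1 / M * c)" for j and c :: real
  proof -
    have "real j / M \<le> real (Suc j) / M" by (intro divide_right_mono) auto
    moreover have "real (Suc j) / M - real j / M = 1 / M" by (simp add: diff_divide_distrib[symmetric])
    ultimately have em: "emeasure lborel (I j) = ennreal (1 / M)"
      unfolding I_def by (simp only: emeasure_lborel_Ico)
    have "has_bochner_integral lborel (indicator (I j) :: real \<Rightarrow> real) (measure lborel (I j))"
      by (rule has_bochner_integral_real_indicator) (auto simp: em, simp add: I_def)
    moreover have "measure lborel (I j) = 1 / M" by (simp add: measure_def em)
    ultimately have "has_bochner_integral lborel (indicator (I j) :: real \<Rightarrow> real) (1 / M)" by simp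
    then show ?thesis by (rule has_bochner_integral_mult_left)
  qed
  have lhs: "has_bochner_integral lborel (\<lambda>t. \<Sum>j\<in>J. indicator (I j) t * (measure \<sigma> (I j) * ((real N)\<^sup>2 / 4)))
      (\<Sum>j\<in>J. 1 / M * (measure \<sigma> (I j) * ((real N)\<^sup>2 / 4)))"
    by (intro has_bochner_integral_sum int_I)
  have one: "has_bochner_integral lborel (\<lambda>t::real. indicator {0..1} t :: real) 1"
    using has_bochner_integral_cos_period[of 0] by simp
  have rhs: "has_bochner_integral lborel (\<lambda>t. 2 * (\<epsilon> * N) * indicator {0..1} t + 2 * (indicator {0..1} t * bnorm e N t))
      (2 * (\<epsilon> * N) * 1 + 2 * (N * nsq e))"
    by (intro has_bochner_integral_add has_bochner_integral_mult_right integral_bnorm e one)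
  have "(\<Sum>j\<in>J. 1 / M * (measure \<sigma> (I j) * ((real N)\<^sup>2 / 4))) \<le> 2 * (\<epsilon> * N) * 1 + 2 * (N * nsq e)"
  proof (rule has_bochner_integral_mono[OF lhs rhs])
    fix t
    have "(\<Sum>j\<in>J. indicator (I j) t * (measure \<sigma> (I j) * ((real N)\<^sup>2 / 4)))
       \<le> (\<Sum>j\<in>J. indicator (I j) t * (2 * (\<epsilon> * N) + 2 * bnorm e N t))"
      using cell by (intro sum_mono) (auto split: split_indicator)
    also have "\<dots> = indicator (\<Union>j\<in>J. I j) t * (2 * (\<epsilon> * N) + 2 * bnorm e N t)"
      by (simp add: indicator_UN_disjoint[OF finJ disj] sum_distrib_right)
    also have "\<dots> \<le> indicator {0..1} t * (2 * (\<epsilon> * N) + 2 * bnorm e N t)"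
    proof (rule mult_right_mono)
      have "I j \<subseteq> {0..1}" if "j \<in> J" for j
      proof -
        have "real (Suc j) / M \<le> real M / M" using that by (intro divide_right_mono) (auto simp: J_def)
        then have le1: "real (Suc j) / M \<le> 1" using M by simp
        show ?thesis
        proof
          fix x assume "x \<in> I j"
          then have "real j / M \<le> x" "x < real (Suc j) / M" by (simp_all add: I_def)
          moreover have "0 \<le> real j / M" by simp
          ultimately show "x \<in> {0..1}" using le1 unfolding atLeastAtMost_iff by linarith
        qed
      qed
      then have "(\<Union>j\<in>J. I j) \<subseteq> {0..1}" by blast
      then show "(indicator (\<Union>j\<in>J. I j) t :: real) \<le> indicator {0..1} t"
        by (intro indicator_leI) blast
      show "0 \<le> 2 * (\<epsilon> * N) + 2 * bnorm e N t" using \<open>\<epsilon> \<ge> 0\<close> bnorm_nonneg by simp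
    qed
    also have "\<dots> = 2 * (\<epsilon> * N) * indicator {0..1} t + 2 * (indicator {0..1} t * bnorm e N t)"
      by (simp add: algebra_simps)
    finally show "(\<Sum>j\<in>J. indicator (I j) t * (measure \<sigma> (I j) * ((real N)\<^sup>2 / 4)))
       \<le> 2 * (\<epsilon> * N) * indicator {0..1} t + 2 * (indicator {0..1} t * bnorm e N t)" .
  qed
  \<comment> \<open>Cell length 1/(6 N) times N^2/4 is N/24; with the factor 2 from
    \<open>bnorm_add_le\<close> this is the origin of 48.\<close>
  also have "(\<Sum>j\<in>J. 1 / M * (measure \<sigma> (I j) * ((real N)\<^sup>2 / 4))) = N / 24 * (\<Sum>j\<in>J. measure \<sigma> (I j))"
    using N by (simp add: sum_distrib_left M_def power2_eq_square field_simps)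
  finally have "N * (\<Sum>j\<in>J. measure \<sigma> (I j)) \<le> N * (48 * (\<epsilon> + nsq e))"
    by (simp add: algebra_simps)
  then have "(\<Sum>j\<in>J. measure \<sigma> (I j)) \<le> 48 * (\<epsilon> + nsq e)"
    using N by simp
  moreover have "measure \<sigma> A \<le> measure \<sigma> (\<Union>j\<in>J. I j)"
    using A_sub finJ by (intro \<sigma>.finite_measure_mono) (auto simp: I_def)
  moreover have "measure \<sigma> (\<Union>j\<in>J. I j) \<le> (\<Sum>j\<in>J. measure \<sigma> (I j))"
    using finJ by (intro \<sigma>.finite_measure_subadditive_finite) (auto simp: I_def)
  ultimately show ?thesis unfolding e_def by linarith
qed

text \<open>Summation by parts moves an estimate at one frequency to the frequencies at distance \<open>1 / N\<close>.\<close>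
lemma bsum_move:
  assumes R: "\<And>n. n \<le> N \<Longrightarrow> cmod (bsum f n t0 x) \<le> R" and t: "\<bar>t - t0\<bar> \<le> 1 / (6 * real N)" and N: "N > 0"
  shows "cmod (bsum f N t x) \<le> 3 * R"
proof -
  define z where "z = cis (- 2 * pi * (t - t0))"
  have parts: "bsum f n t x = z ^ n * bsum f n t0 x + (1 - z) * (\<Sum>k<n. z ^ k * bsum f (Suc k) t0 x)" for n
  proof (induction n)
    case (Suc n)
    have "cis (- 2 * pi * (real n * t)) = z ^ n * cis (- 2 * pi * (real n * t0))"
      by (simp add: z_def Complex.DeMoivre cis_mult algebra_simps)
    then have "bsum f (Suc n) t x = bsum f n t x + z ^ n * (bsum f (Suc n) t0 x - bsum f n t0 x)"
      by (simp add: bsum_def mult.assoc)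
    then show ?case unfolding Suc by (simp add: algebra_simps)
  qed (simp add: bsum_def)
  have R0: "R \<ge> 0" using R[of 0] norm_ge_zero[of "bsum f 0 t0 x"] by linarith
  have z1: "cmod (z ^ k) = 1" for k by (simp add: z_def norm_power)
  have "cmod (1 - z) \<le> 2 * pi * \<bar>t - t0\<bar>"
  proof -
    have "cmod (1 - z) = cmod (exp (\<i> * complex_of_real (- 2 * pi * (t - t0))) - 1)"
      by (simp add: z_def cis_conv_exp norm_minus_commute)
    also have "\<dots> \<le> \<bar>- 2 * pi * (t - t0)\<bar>"
      using abs_sin_x_le_abs_x[of "- 2 * pi * (t - t0) / 2"] unfolding dist_exp_i_1 by simp
    finally show ?thesis by (simp add: abs_mult)
  qed
  also have "\<dots> \<le> 2 * pi * (1 / (6 * real N))" using t by (intro mult_left_mono) auto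
  \<comment> \<open>Multiplied by the N terms of the sum this gives 2 R, and the boundary term adds
    R, hence 3 R.\<close>
  also have "\<dots> \<le> 2 / N"
  proof -
    have "pi \<le> 4" using pi_less_4 by simp
    then show ?thesis using N by (simp add: field_simps)
  qed
  finally have z2: "cmod (1 - z) \<le> 2 / N" .
  have "cmod (\<Sum>k<N. z ^ k * bsum f (Suc k) t0 x) \<le> (\<Sum>k<N. R)"
    by (rule order_trans[OF norm_sum], rule sum_mono) (simp add: norm_mult z1 R)
  then have "cmod ((1 - z) * (\<Sum>k<N. z ^ k * bsum f (Suc k) t0 x)) \<le> 2 / N * (N * R)"
    unfolding norm_mult using z2 by (intro mult_mono) auto
  also have "\<dots> = 2 * R" using N by simp
  finally have "cmod ((1 - z) * (\<Sum>k<N. z ^ k * bsum f (Suc k) t0 x)) \<le> 2 * R" .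
  moreover have "cmod (z ^ N * bsum f N t0 x) \<le> R" using R[of N] by (simp add: norm_mult z1)
  ultimately show ?thesis unfolding parts[of N]
    using norm_triangle_ineq[of "z ^ N * bsum f N t0 x" "(1 - z) * (\<Sum>k<N. z ^ k * bsum f (Suc k) t0 x)"] by linarith
qed

lemma bnorm_le:
  assumes "sqint \<mu> f" "AE x in \<mu>. cmod (bsum f N t x) \<le> R" "R \<ge> 0"
  shows "bnorm f N t \<le> R\<^sup>2"
proof -
  have "bnorm f N t \<le> (\<integral>x. R\<^sup>2 \<partial>\<mu>)"
    unfolding bnorm_def
  proof (rule integral_mono_AE)
    show "integrable \<mu> (\<lambda>x. (cmod (bsum f N t x))\<^sup>2)" using sqint_bsum[OF assms(1)] by (simp add: sqint_def)
    show "AE x in \<mu>. (cmod (bsum f N t x))\<^sup>2 \<le> R\<^sup>2"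
      using assms(2) by eventually_elim (auto intro: power_mono)
  qed simp
  then show ?thesis by (simp add: prob_space[unfolded space_mu])
qed

end

section \<open>Density of cylinder functions\<close>

context stationary
begin

definition depends :: "nat \<Rightarrow> ((int \<Rightarrow> nat) \<Rightarrow> 'b) \<Rightarrow> bool" where
  "depends r h \<longleftrightarrow> (\<forall>x y. (\<forall>i. \<bar>i\<bar> \<le> int r \<longrightarrow> x i = y i) \<longrightarrow> h x = h y)"

lemma depends_mono: "depends r h \<Longrightarrow> r \<le> s \<Longrightarrow> depends s h"
  unfolding depends_def by (meson of_nat_le_iff order_trans)

lemma depends_comp: "depends r h \<Longrightarrow> depends r (\<lambda>x. F (h x))"
  unfolding depends_def by (intro allI impI arg_cong[where f = F]) blast

lemma depends_comp2: "depends r h \<Longrightarrow> depends s k \<Longrightarrow> depends (max r s) (\<lambda>x. F (h x) (k x))"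
  using depends_mono[of r h "max r s"] depends_mono[of s k "max r s"] unfolding depends_def by (metis max.cobounded1 max.cobounded2)

text \<open>Boundedness is demanded explicitly: coordinates in the sequence space are arbitrary
  natural numbers, so a finite window has infinitely many possible contents.\<close>

definition cyl_fun :: "((int \<Rightarrow> nat) \<Rightarrow> complex) \<Rightarrow> bool" where
  "cyl_fun h \<longleftrightarrow> h \<in> borel_measurable \<mu> \<and> (\<exists>B. \<forall>x. cmod (h x) \<le> B) \<and> (\<exists>r. depends r h)"

lemma cyl_fun_add:
  assumes "cyl_fun h" "cyl_fun k" shows "cyl_fun (\<lambda>x. h x + k x)"
proof -
  obtain B B' where "\<And>x. cmod (h x) \<le> B" "\<And>x. cmod (k x) \<le> B'" using assms by (auto simp: cyl_fun_def)
  then have "cmod (h x + k x) \<le> B + B'" for x by (intro norm_triangle_mono)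
  moreover obtain r s where "depends r h" "depends s k" using assms by (auto simp: cyl_fun_def)
  then have "depends (max r s) (\<lambda>x. h x + k x)" by (rule depends_comp2)
  ultimately show ?thesis using assms by (auto simp: cyl_fun_def)
qed

lemma cyl_fun_cmult:
  assumes "cyl_fun h" shows "cyl_fun (\<lambda>x. c * h x)"
proof -
  obtain B where "\<And>x. cmod (h x) \<le> B" using assms by (auto simp: cyl_fun_def)
  then have "cmod (c * h x) \<le> cmod c * B" for x by (simp add: norm_mult mult_left_mono)
  moreover obtain r where "depends r h" using assms by (auto simp: cyl_fun_def)
  then have "depends r (\<lambda>x. c * h x)" by (rule depends_comp)
  ultimately show ?thesis using assms by (auto simp: cyl_fun_def)
qed

lemma cyl_fun_sqint: "cyl_fun h \<Longrightarrow> sqint \<mu> h"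
proof -
  assume h: "cyl_fun h"
  then obtain B where B: "\<And>x. cmod (h x) \<le> B" and [measurable]: "h \<in> borel_measurable \<mu>" by (auto simp: cyl_fun_def)
  have "integrable \<mu> (\<lambda>x. (cmod (h x))\<^sup>2)"
    by (rule integrable_const_bound[of _ "B\<^sup>2"]) (auto intro!: power_mono B)
  then show ?thesis by (simp add: sqint_def)
qed

definition cyl_set :: "(int \<Rightarrow> nat) set \<Rightarrow> bool" where
  "cyl_set C \<longleftrightarrow> C \<in> sets \<mu> \<and> (\<exists>r. depends r (\<lambda>x. x \<in> C))"

lemma cyl_set_Un: "cyl_set C \<Longrightarrow> cyl_set D \<Longrightarrow> cyl_set (C \<union> D)"
proof -
  assume "cyl_set C" "cyl_set D"
  moreover then obtain r s where "depends r (\<lambda>x. x \<in> C)" "depends s (\<lambda>x. x \<in> D)" by (auto simp: cyl_set_def)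
  then have "depends (max r s) (\<lambda>x. x \<in> C \<or> x \<in> D)" by (rule depends_comp2)
  ultimately show ?thesis by (auto simp: cyl_set_def)
qed

lemma cyl_set_empty: "cyl_set {}" by (auto simp: cyl_set_def depends_def)

lemma cyl_set_UN: "finite A \<Longrightarrow> (\<And>i. i \<in> A \<Longrightarrow> cyl_set (C i)) \<Longrightarrow> cyl_set (\<Union>i\<in>A. C i)"
  by (induction A rule: finite_induct) (auto intro: cyl_set_Un cyl_set_empty)

lemma cyl_fun_indicator: "cyl_set C \<Longrightarrow> cyl_fun (indicator C)"
proof -
  assume C: "cyl_set C"
  then obtain r where "depends r (\<lambda>x. x \<in> C)" by (auto simp: cyl_set_def)
  then have "depends r (indicator C :: _ \<Rightarrow> complex)" unfolding indicator_def[abs_def] by (rule depends_comp)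
  moreover have "cmod (indicator C x) \<le> 1" for x by (simp split: split_indicator)
  ultimately show ?thesis using C by (auto simp: cyl_fun_def cyl_set_def)
qed

text \<open>The sets approximable by cylinder sets form a sigma-algebra containing the coordinate
  sets. Measurability is carried through the induction because each step measures
  differences.\<close>

lemma sets_approx:
  assumes "A \<in> sets \<mu>" "\<epsilon> > 0"
  shows "\<exists>C. cyl_set C \<and> prob (sym_diff A C) < \<epsilon>"
proof -
  have A_sig: "A \<in> sigma_sets UNIV {{f. f i \<in> A} | i A. True}"
    using assms(1) sets_mu by (simp add: seq_space_def sets_PiM_single)
  have gen: "{{f. f i \<in> A} | i A. True} \<subseteq> sets \<mu>"
  proof -
    have "{f. f i \<in> A} \<in> sets \<mu>" for i :: int and A :: "nat set"
    proof -
      have "{f. f i \<in> A} \<in> sigma_sets UNIV {{f. f i \<in> A} | i A. True}" by (rule sigma_sets.Basic) blast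
      then show ?thesis using sets_mu by (simp add: seq_space_def sets_PiM_single)
    qed
    then show ?thesis by blast
  qed
  from A_sig have "A \<in> sets \<mu> \<and> (\<forall>\<epsilon>>0. \<exists>C. cyl_set C \<and> prob (sym_diff A C) < \<epsilon>)"
  proof (induction rule: sigma_sets.induct)
    case (Basic a)
    then obtain i A where a: "a = {f. f i \<in> A}" by blast
    have "depends (nat \<bar>i\<bar>) (\<lambda>x. x \<in> a)" by (auto simp: depends_def a)
    then have "cyl_set a" using subsetD[OF gen Basic] by (auto simp: cyl_set_def)
    show ?case
    proof (intro conjI allI impI)
      show "a \<in> sets \<mu>" using Basic gen by blast
      show "\<exists>C. cyl_set C \<and> prob (sym_diff a C) < \<epsilon>" if "\<epsilon> > 0" for \<epsilon>
        using that by (intro exI[of _ a]) (simp add: \<open>cyl_set a\<close>)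
    qed
  next
    case Empty
    show ?case
    proof (intro conjI allI impI)
      show "\<exists>C. cyl_set C \<and> prob (({} - C) \<union> (C - {})) < \<epsilon>" if "\<epsilon> > 0" for \<epsilon>
        using that by (intro exI[of _ "{}"]) (simp add: cyl_set_empty)
    qed simp
  next
    case (Compl a)
    have a: "a \<in> sets \<mu>" by (rule conjunct1[OF Compl.IH])
    have IH: "\<exists>C. cyl_set C \<and> prob (sym_diff a C) < \<epsilon>" if "\<epsilon> > 0" for \<epsilon>
      by (rule conjunct2[OF Compl.IH, rule_format]) fact
    have "\<exists>C. cyl_set C \<and> prob (sym_diff (UNIV - a) C) < \<epsilon>" if "\<epsilon> > 0" for \<epsilon>
    proof -
      obtain C where C: "cyl_set C" "prob (sym_diff a C) < \<epsilon>" using IH[OF \<open>\<epsilon> > 0\<close>] by blast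
      then obtain r where r: "depends r (\<lambda>x. x \<in> C)" by (auto simp: cyl_set_def)
      have "depends r (\<lambda>x. x \<in> UNIV - C)" using r unfolding depends_def by auto
      moreover have "UNIV - C \<in> sets \<mu>" using C sets.compl_sets[of C \<mu>] by (simp add: cyl_set_def)
      ultimately have "cyl_set (UNIV - C)" by (auto simp: cyl_set_def)
      moreover have "(UNIV - a - (UNIV - C)) \<union> (UNIV - C - (UNIV - a)) = (a - C) \<union> (C - a)" by auto
      ultimately show ?thesis using C by (intro exI[of _ "UNIV - C"]) simp
    qed
    moreover have "UNIV - a \<in> sets \<mu>" using a sets.compl_sets[of a \<mu>] by simp
    ultimately show ?case by blast
  next
    case (Union a)
    have meas: "a i \<in> sets \<mu>" for i by (rule conjunct1[OF Union.IH])
    have IH: "\<exists>C. cyl_set C \<and> prob (sym_diff (a i) C) < \<epsilon>" if "\<epsilon> > 0" for i \<epsilon>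
      by (rule conjunct2[OF Union.IH, rule_format]) fact
    have U: "(\<Union>i. a i) \<in> sets \<mu>" using meas by auto
    have "\<exists>C. cyl_set C \<and> prob (sym_diff (\<Union>i. a i) C) < \<epsilon>" if \<epsilon>: "\<epsilon> > 0" for \<epsilon>
    proof -
      have "(\<lambda>n. prob (\<Union>i<n. a i)) \<longlonglongrightarrow> prob (\<Union>n. \<Union>i<n. a i)"
      proof (rule finite_Lim_measure_incseq)
        show "range (\<lambda>n. \<Union>i<n. a i) \<subseteq> sets \<mu>" using meas by auto
        show "incseq (\<lambda>n. \<Union>i<n. a i)" unfolding incseq_def by (intro allI impI UN_mono) auto
      qed
      moreover have "(\<Union>n. \<Union>i<n. a i) = (\<Union>i. a i)" by auto
      ultimately have "\<forall>\<^sub>F n in sequentially. prob (\<Union>i. a i) - \<epsilon> / 2 < prob (\<Union>i<n. a i)"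
        using \<epsilon> by (intro order_tendstoD(1)) auto
      then obtain n where n: "prob (\<Union>i. a i) - \<epsilon> / 2 < prob (\<Union>i<n. a i)"
        by (auto simp: eventually_sequentially)
      \<comment> \<open>Half of \<epsilon> has paid for truncating the union; the other half is
        shared by n approximations, with n + 1 to avoid a zero denominator.\<close>
      have "\<forall>i. \<exists>C. cyl_set C \<and> prob (sym_diff (a i) C) < \<epsilon> / (2 * (real n + 1))"
        using IH \<epsilon> by simp
      then obtain C where C: "\<And>i. cyl_set (C i)" "\<And>i. prob (sym_diff (a i) (C i)) < \<epsilon> / (2 * (real n + 1))"
        by metis
      have C_sets: "C i \<in> sets \<mu>" for i using C by (simp add: cyl_set_def)
      let ?D = "\<Union>i<n. C i"
      have "((\<Union>i. a i) - ?D) \<union> (?D - (\<Union>i. a i)) \<subseteq> ((\<Union>i. a i) - (\<Union>i<n. a i)) \<union> (\<Union>i<n. (a i - C i) \<union> (C i - a i))"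
        by auto
      then have "prob (sym_diff (\<Union>i. a i) ?D)
          \<le> prob (((\<Union>i. a i) - (\<Union>i<n. a i)) \<union> (\<Union>i<n. (a i - C i) \<union> (C i - a i)))"
        using meas C_sets by (intro finite_measure_mono) auto
      also have "\<dots> \<le> prob ((\<Union>i. a i) - (\<Union>i<n. a i)) + prob (\<Union>i<n. (a i - C i) \<union> (C i - a i))"
        using meas C_sets by (intro measure_Un_le) auto
      also have "prob ((\<Union>i. a i) - (\<Union>i<n. a i)) = prob (\<Union>i. a i) - prob (\<Union>i<n. a i)"
        using meas by (intro finite_measure_Diff) auto
      also have "prob (\<Union>i<n. (a i - C i) \<union> (C i - a i)) \<le> (\<Sum>i<n. prob (sym_diff (a i) (C i)))"
        using meas C_sets by (intro finite_measure_subadditive_finite) auto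
      also have "\<dots> \<le> (\<Sum>i<n. \<epsilon> / (2 * (real n + 1)))" using C(2) by (intro sum_mono less_imp_le)
      also have "\<dots> \<le> \<epsilon> / 2" using \<epsilon> by (simp add: field_simps)
      finally have "prob (sym_diff (\<Union>i. a i) ?D) < \<epsilon>" using n by linarith
      moreover have "cyl_set ?D" using C by (intro cyl_set_UN) auto
      ultimately show ?thesis by blast
    qed
    then show ?case using U by blast
  qed
  then show ?thesis using assms by blast
qed

definition approximable :: "((int \<Rightarrow> nat) \<Rightarrow> complex) \<Rightarrow> bool" where
  "approximable f \<longleftrightarrow> sqint \<mu> f \<and> (\<forall>\<epsilon>>0. \<exists>h. cyl_fun h \<and> dsq f h < \<epsilon>)"

lemma integral_norm_add_le:
  assumes "sqint \<mu> u" "sqint \<mu> v"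
  shows "nsq (\<lambda>x. u x + v x) \<le> 2 * nsq u + 2 * nsq v"
proof -
  have "nsq (\<lambda>x. u x + v x) \<le> (\<integral>x. 2 * (cmod (u x))\<^sup>2 + 2 * (cmod (v x))\<^sup>2 \<partial>\<mu>)"
    using assms sqint_add[OF assms] norm_add_sq_le by (intro integral_mono) (auto simp: sqint_def)
  also have "\<dots> = 2 * nsq u + 2 * nsq v"
    using assms by (simp add: sqint_def)
  finally show ?thesis .
qed

lemma approximable_add:
  assumes "approximable f" "approximable f'" shows "approximable (\<lambda>x. f x + f' x)"
  unfolding approximable_def
proof (intro conjI allI impI)
  have f: "sqint \<mu> f" and f': "sqint \<mu> f'" using assms by (auto simp: approximable_def)
  then show "sqint \<mu> (\<lambda>x. f x + f' x)" by (rule sqint_add)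
  fix \<epsilon> :: real assume "\<epsilon> > 0"
  then have "\<epsilon> / 4 > 0" by simp
  then obtain h h' where h: "cyl_fun h" "dsq f h < \<epsilon> / 4"
    and h': "cyl_fun h'" "dsq f' h' < \<epsilon> / 4"
    using assms unfolding approximable_def by meson
  have "nsq (\<lambda>x. (f x - h x) + (f' x - h' x))
      \<le> 2 * dsq f h + 2 * dsq f' h'"
    by (intro integral_norm_add_le sqint_diff f f' cyl_fun_sqint h h')
  then have "nsq (\<lambda>x. (f x + f' x) - (h x + h' x)) < \<epsilon>"
    using h(2) h'(2) by (simp add: algebra_simps)
  then show "\<exists>h. cyl_fun h \<and> nsq (\<lambda>x. f x + f' x - h x) < \<epsilon>"
    using cyl_fun_add[OF h(1) h'(1)] by blast
qed

lemma approximable_cmult: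
  assumes "approximable f" shows "approximable (\<lambda>x. c * f x)"
  unfolding approximable_def
proof (intro conjI allI impI)
  show "sqint \<mu> (\<lambda>x. c * f x)" using assms by (auto simp: approximable_def intro: sqint_cmult)
  fix \<epsilon> :: real assume \<epsilon>: "\<epsilon> > 0"
  define \<delta> where "\<delta> = \<epsilon> / ((cmod c)\<^sup>2 + 1)"
  have \<delta>: "\<delta> > 0" using \<epsilon> by (simp add: \<delta>_def add_nonneg_pos)
  then obtain h where h: "cyl_fun h" "dsq f h < \<delta>"
    using assms by (auto simp: approximable_def)
  have "nsq (\<lambda>x. c * f x - c * h x) = (cmod c)\<^sup>2 * dsq f h"
    by (simp add: right_diff_distrib[symmetric] norm_mult power_mult_distrib)
  also have "\<dots> \<le> (cmod c)\<^sup>2 * \<delta>" using h by (intro mult_left_mono) auto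
  also have "\<dots> < ((cmod c)\<^sup>2 + 1) * \<delta>" using \<delta> by (intro mult_strict_right_mono) auto
  also have "\<dots> = \<epsilon>"
  proof -
    have "(cmod c)\<^sup>2 + 1 > 0" by (simp add: add_nonneg_pos)
    then show ?thesis by (simp add: \<delta>_def)
  qed
  finally show "\<exists>h. cyl_fun h \<and> nsq (\<lambda>x. c * f x - h x) < \<epsilon>"
    using cyl_fun_cmult[OF h(1)] by blast
qed

lemma approximable_indicator:
  assumes A: "A \<in> sets \<mu>" shows "approximable (indicator A)"
  unfolding approximable_def
proof (intro conjI allI impI)
  have "integrable \<mu> (\<lambda>x. (cmod (indicator A x))\<^sup>2)"
    using A by (intro integrable_const_bound[of _ 1]) (auto split: split_indicator)
  then show "sqint \<mu> (indicator A)" using A by (simp add: sqint_def)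
  fix \<epsilon> :: real assume "\<epsilon> > 0"
  then obtain C where C: "cyl_set C" "prob (sym_diff A C) < \<epsilon>" using sets_approx[OF A] by blast
  have "(cmod (indicator A x - indicator C x))\<^sup>2 = indicator (sym_diff A C) x" for x
    by (auto split: split_indicator)
  then have "nsq (\<lambda>x. indicator A x - indicator C x) = prob (sym_diff A C)"
    using A C by (simp add: cyl_set_def)
  then show "\<exists>h. cyl_fun h \<and> nsq (\<lambda>x. indicator A x - h x) < \<epsilon>"
    using cyl_fun_indicator[OF C(1)] C(2) by auto
qed

lemma approximable_sum:
  "finite A \<Longrightarrow> (\<And>i. i \<in> A \<Longrightarrow> approximable (f i)) \<Longrightarrow> approximable (\<lambda>x. \<Sum>i\<in>A. f i x)"
proof (induction A rule: finite_induct)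
  case empty
  then show ?case using approximable_indicator[of "{}"] by (simp add: indicator_def[abs_def])
next
  case (insert a A)
  then show ?case using approximable_add[of "f a" "\<lambda>x. \<Sum>i\<in>A. f i x"] by simp
qed

lemma approximable_simple:
  assumes "simple_function \<mu> s" shows "approximable s"
proof -
  have fin: "finite (range s)" and meas: "\<And>y. y \<in> range s \<Longrightarrow> s -` {y} \<in> sets \<mu>"
    using assms by (auto simp: simple_function_def)
  have "s x = (\<Sum>y\<in>range s. y * indicator (s -` {y}) x)" for x
  proof -
    have "(\<Sum>y\<in>range s. y * indicator (s -` {y}) x) = (\<Sum>y\<in>range s. if y = s x then y else 0)"
      by (intro sum.cong refl) (auto split: split_indicator)
    then show ?thesis using fin by simp
  qed
  then have eq: "s = (\<lambda>x. \<Sum>y\<in>range s. y * indicator (s -` {y}) x)" by (rule ext)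
  show ?thesis
    by (subst eq) (intro approximable_sum fin approximable_cmult approximable_indicator meas)
qed

text \<open>Simple functions with modulus at most 2 |f| converge to f, so the squared error is
  dominated by 9 |f|^2; a simple function is then approximated through its level sets.\<close>

theorem sqint_approximable:
  assumes f: "sqint \<mu> f" shows "approximable f"
  unfolding approximable_def
proof (intro conjI allI impI)
  show "sqint \<mu> f" by fact
  fix \<epsilon> :: real assume \<epsilon>: "\<epsilon> > 0"
  have [measurable]: "f \<in> borel_measurable \<mu>" using f by (simp add: sqint_def)
  then obtain s where s: "\<And>i. simple_function \<mu> (s i)" "\<And>x. (\<lambda>i. s i x) \<longlonglongrightarrow> f x" "\<And>i x. cmod (s i x) \<le> 2 * cmod (f x)"
    using borel_measurable_implies_sequence_metric[of f \<mu> 0] by auto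
  have [measurable]: "s i \<in> borel_measurable \<mu>" for i using s(1) by (rule borel_measurable_simple_function)
  have "(\<lambda>i. \<integral>x. (cmod (f x - s i x))\<^sup>2 \<partial>\<mu>) \<longlonglongrightarrow> (\<integral>x. 0 \<partial>\<mu>)"
  proof (rule integral_dominated_convergence)
    show "integrable \<mu> (\<lambda>x. 9 * (cmod (f x))\<^sup>2)" using f by (simp add: sqint_def)
    show "AE x in \<mu>. (\<lambda>i. (cmod (f x - s i x))\<^sup>2) \<longlonglongrightarrow> 0"
    proof (rule AE_I2)
      fix x
      have "(\<lambda>i. (cmod (f x - s i x))\<^sup>2) \<longlonglongrightarrow> (cmod (f x - f x))\<^sup>2" by (intro tendsto_intros s(2))
      then show "(\<lambda>i. (cmod (f x - s i x))\<^sup>2) \<longlonglongrightarrow> 0" by simp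
    qed
    show "AE x in \<mu>. norm ((cmod (f x - s i x))\<^sup>2) \<le> 9 * (cmod (f x))\<^sup>2" for i
    proof (rule AE_I2)
      fix x
      have "cmod (f x - s i x) \<le> 3 * cmod (f x)"
        using norm_triangle_ineq4[of "f x" "s i x"] s(3)[of i x] by linarith
      then have "(cmod (f x - s i x))\<^sup>2 \<le> (3 * cmod (f x))\<^sup>2" by (intro power_mono) auto
      then show "norm ((cmod (f x - s i x))\<^sup>2) \<le> 9 * (cmod (f x))\<^sup>2" by (simp add: power_mult_distrib)
    qed
  qed measurable
  \<comment> \<open>A quarter is enough because squared norms are subadditive only up to a factor
    2.\<close>
  then have "\<forall>\<^sub>F i in sequentially. dsq f (s i) < \<epsilon> / 4"
    using \<epsilon> by (intro order_tendstoD(2)) auto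
  then obtain i where i: "dsq f (s i) < \<epsilon> / 4" by (auto simp: eventually_sequentially)
  have si: "approximable (s i)" by (rule approximable_simple) fact
  then obtain h where h: "cyl_fun h" "dsq (s i) h < \<epsilon> / 4"
    using \<epsilon> unfolding approximable_def by (meson divide_pos_pos zero_less_numeral)
  have "nsq (\<lambda>x. (f x - s i x) + (s i x - h x))
      \<le> 2 * dsq f (s i) + 2 * dsq (s i) h"
  proof -
    have "sqint \<mu> (s i)" using si by (simp add: approximable_def)
    then show ?thesis
      using f cyl_fun_sqint[OF h(1)] by (intro integral_norm_add_le sqint_diff)
  qed
  then have "dsq f h < \<epsilon>" using i h(2) by simp
  then show "\<exists>h. cyl_fun h \<and> dsq f h < \<epsilon>" using h(1) by blast
qed

end

section \<open>Singularity\<close>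

lemma wsum_conv_sum:
  "wsum g l t w = (\<Sum>k<length w. cis (- 2 * pi * (real k * t)) * g (take l (drop k w)))"
proof (induction w)
  case (Cons a w)
  have "cis (- 2 * pi * (real (Suc k) * t)) = cis (- 2 * pi * t) * cis (- 2 * pi * (real k * t))" for k
    by (simp add: cis_mult algebra_simps)
  then show ?case
    by (simp add: Cons.IH sum.lessThan_Suc_shift sum_distrib_left mult.assoc del: sum.lessThan_Suc of_nat_Suc)
qed simp

lemma poly_exp_tendsto_0:
  fixes \<beta> :: real assumes "\<beta> > 0"
  shows "(\<lambda>i. (1 + real i) ^ 4 * exp (- \<beta> * real i)) \<longlonglongrightarrow> 0"
  using assms by real_asymp

lemma twist_orbit_measurable: "(\<lambda>t. twist c (\<lambda>b. t * L b) w) \<in> borel_measurable borel"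
proof -
  have "continuous_on UNIV (\<lambda>t. twist c (\<lambda>b. t * L b) w)"
    by (induction w) (auto intro!: continuous_intros)
  then show ?thesis by (rule borel_measurable_continuous_onI)
qed

section \<open>From twisted sums on the subshift to null sets of spectral measures\<close>

locale substitution_system = primitive_substitution + stationary +
  assumes supp: "AE x in \<mu>. x \<in> subst_space d \<zeta>"
begin

lemma gfun_orbit_measurable: "(\<lambda>t. gfun K (orbit K t j)) \<in> borel_measurable borel"
proof -
  have [measurable]: "(\<lambda>t. twist c (orbit K t j) w) \<in> borel_measurable borel" for c w
    unfolding orbit_def[abs_def] by (rule twist_orbit_measurable)
  show ?thesis unfolding gfun_def sq_norm_def by measurable
qed

text \<open>Fixing N0 makes the orbit estimate uniform in t; for suitable K and c the union over N0
  covers almost all of [0,1).\<close>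

definition good :: "nat \<Rightarrow> real \<Rightarrow> nat \<Rightarrow> real set" where
  "good K c N0 = {t \<in> {0..<1}. \<forall>N\<ge>N0. gsum K t N \<le> c * N}"

lemma good_borel: "good K c N0 \<in> sets borel"
proof -
  note [measurable] = gfun_orbit_measurable
  have "{t \<in> space borel. t \<in> {0..<1} \<and> (\<forall>N. N \<ge> N0 \<longrightarrow> gsum K t N \<le> c * N)} \<in> sets borel"
    by measurable
  then show ?thesis by (simp add: good_def)
qed

text \<open>Words read off a point of the subshift belong to the language, so
  \<open>wsum_growth\<close> applies uniformly in x, and for all lengths n up to the shortest
  block.\<close>

lemma cylinder_bsum_bound:
  fixes c :: real
  assumes h: "cyl_fun h" and c: "c \<ge> 0"
  obtains C where "C \<ge> 0"
    "\<And>t i n x. t \<in> good K c N0 \<Longrightarrow> x \<in> subst_space d \<zeta> \<Longrightarrow> (\<And>b. b < d \<Longrightarrow> n \<le> length (sw (K * i) b))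
      \<Longrightarrow> cmod (bsum h n t x) \<le> C * (1 + real i)\<^sup>2 * exp (c * i)"
proof -
  obtain B r where B: "\<And>x. cmod (h x) \<le> B" and r: "depends r h" using h by (auto simp: cyl_fun_def)
  define l where "l = 2 * r + 1"
  \<comment> \<open>The window of length 2 r + 1 is recentred at 0. Past the end of a truncated
    window the entries are unspecified; there only the bound B is used.\<close>
  define g where "g w = h (\<lambda>i. if \<bar>i\<bar> \<le> int r then w ! nat (i + int r) else 0)" for w :: "nat list"
  interpret substitution_window d \<zeta> g l B
    by unfold_locales (simp add: g_def B)
  \<comment> \<open>Reading starts at -r, so that the window beginning at position k of the word is
    centred at coordinate k of x.\<close>
  define W where "W n x = map (\<lambda>j. x (- int r + int j)) [0..<n]" for n :: nat and x :: "int \<Rightarrow> nat"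
  have window: "h (shift_pow (int k) x) = g (take l (drop k (W n x)))" if "k + l \<le> n" for k n x
  proof -
    have "take l (drop k (W n x)) ! nat (i + int r) = x (i + int k)" if i: "\<bar>i\<bar> \<le> int r" for i
    proof -
      have "nat (i + int r) < l" using i by (auto simp: l_def)
      then have "take l (drop k (W n x)) ! nat (i + int r) = W n x ! (k + nat (i + int r))"
        using \<open>k + l \<le> n\<close> by (simp add: W_def)
      also have "\<dots> = x (- int r + int (k + nat (i + int r)))"
        using \<open>k + l \<le> n\<close> \<open>nat (i + int r) < l\<close> unfolding W_def by (subst nth_map) auto
      also have "- int r + int (k + nat (i + int r)) = i + int k" using i by simp
      finally show ?thesis .
    qed
    then show ?thesis
      unfolding g_def shift_pow_def using r unfolding depends_def by simp
  qed
  have close: "cmod (bsum h n t x) \<le> cmod (wsum g l t (W n x)) + err" for n t x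
  proof -
    have len: "length (W n x) = n" by (simp add: W_def)
    have "cmod (bsum h n t x - wsum g l t (W n x))
       = cmod (\<Sum>k<n. cis (- 2 * pi * (real k * t)) * (h (shift_pow (int k) x) - g (take l (drop k (W n x)))))"
      unfolding bsum_def wsum_conv_sum len by (simp add: sum_subtractf right_diff_distrib)
    \<comment> \<open>Only starting points within l of the right end have truncated windows.\<close>
    also have "\<dots> \<le> (\<Sum>k<n. if n < k + l then 2 * B else 0)"
    proof (rule order_trans[OF norm_sum], rule sum_mono)
      fix k
      have "cmod (h (shift_pow (int k) x) - g (take l (drop k (W n x)))) \<le> cmod (h (shift_pow (int k) x)) + cmod (g (take l (drop k (W n x))))"
        by (rule norm_triangle_ineq4)
      also have "\<dots> \<le> B + B" by (intro add_mono B g_bound)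
      finally show "cmod (cis (- 2 * pi * (real k * t)) * (h (shift_pow (int k) x) - g (take l (drop k (W n x)))))
         \<le> (if n < k + l then 2 * B else 0)"
        using window[of k n x] by (auto simp: norm_mult not_less)
    qed
    also have "\<dots> = 2 * B * card {k. k < n \<and> n < k + l}"
    proof -
      have "(\<Sum>k<n. if n < k + l then 2 * B else 0) = (\<Sum>k\<in>{k. k < n \<and> n < k + l}. 2 * B)"
        by (intro sum.mono_neutral_cong_right) auto
      then show ?thesis by simp
    qed
    also have "\<dots> \<le> 2 * B * l"
    proof -
      have "card {k. k < n \<and> n < k + l} \<le> card {n - l..<n}" by (intro card_mono) auto
      also have "\<dots> \<le> l" by simp
      finally show ?thesis using B_nonneg by (intro mult_left_mono) auto
    qed
    finally have "cmod (bsum h n t x - wsum g l t (W n x)) \<le> err" by (simp add: err_def)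
    then show ?thesis using norm_triangle_sub[of "bsum h n t x" "wsum g l t (W n x)"] by linarith
  qed
  obtain C where C: "C \<ge> 0"
    "\<And>t i W m a. (\<And>N. N \<ge> N0 \<Longrightarrow> gsum K t N \<le> c * N) \<Longrightarrow> a < d \<Longrightarrow> sublist W (sw m a)
      \<Longrightarrow> (\<And>b. b < d \<Longrightarrow> length W \<le> length (sw (K * i) b)) \<Longrightarrow>
      cmod (wsum g l t W) \<le> C * (1 + real i)\<^sup>2 * exp (c * i)"
    by (rule wsum_growth[OF c, of N0 K]) blast
  show ?thesis
  proof (rule that[of "C + err"])
    show "C + err \<ge> 0" using C err_nonneg by simp
    fix t i n x
    assume t: "t \<in> good K c N0" and x: "x \<in> subst_space d \<zeta>" and n: "\<And>b. b < d \<Longrightarrow> n \<le> length (sw (K * i) b)"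
    obtain a m where am: "a < d" "sublist (W n x) (sw m a)"
      using x unfolding subst_space_def W_def sw_def by blast
    have "cmod (wsum g l t (W n x)) \<le> C * (1 + real i)\<^sup>2 * exp (c * i)"
    proof (rule C(2)[OF _ am])
      show "gsum K t N \<le> c * N" if "N \<ge> N0" for N using t that by (simp add: good_def)
      show "length (W n x) \<le> length (sw (K * i) b)" if "b < d" for b using n[OF that] by (simp add: W_def)
    qed
    moreover have "err * 1 \<le> err * ((1 + real i)\<^sup>2 * exp (c * i))"
    proof -
      have "1 * 1 \<le> (1 + real i)\<^sup>2 * exp (c * i)" using c by (intro mult_mono) auto
      then show ?thesis using err_nonneg by (intro mult_left_mono) auto
    qed
    ultimately show "cmod (bsum h n t x) \<le> (C + err) * (1 + real i)\<^sup>2 * exp (c * i)"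
      using close[of n t x] by (simp add: algebra_simps)
  qed
qed

text \<open>At length N of order \<Theta>^(K i) the sums are at most R i, and R^2/N decays since 2 c
  < K ln \<Theta>. In the limit only the distance from f to a cylinder function remains, and density
  makes it arbitrarily small.\<close>

lemma spectral_measure_good:
  fixes \<Theta> c0 c :: real
  assumes f: "sqint \<mu> f" and \<sigma>: "is_spectral_measure \<mu> f \<sigma>"
    and \<Theta>: "\<Theta> > 1" "c0 > 0" "\<And>n b. b < d \<Longrightarrow> c0 * \<Theta> ^ n \<le> length (sw n b)"
    and c: "c \<ge> 0" "2 * c < K * ln \<Theta>"
  shows "measure \<sigma> (good K c N0) = 0"
proof -
  define A where "A = good K c N0"
  define \<rho> where "\<rho> = K * ln \<Theta>"
  have le_h: "measure \<sigma> A \<le> 48 * dsq f h" if h: "cyl_fun h" for h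
  proof -
    obtain C where C: "C \<ge> 0"
      "\<And>t i n x. t \<in> good K c N0 \<Longrightarrow> x \<in> subst_space d \<zeta> \<Longrightarrow> (\<And>b. b < d \<Longrightarrow> n \<le> length (sw (K * i) b))
      \<Longrightarrow> cmod (bsum h n t x) \<le> C * (1 + real i)\<^sup>2 * exp (c * i)"
      by (rule cylinder_bsum_bound[OF h c(1), of K N0]) blast
    have h': "sqint \<mu> h" by (rule cyl_fun_sqint) fact
    define R where "R i = C * (1 + real i)\<^sup>2 * exp (c * i)" for i
    \<comment> \<open>18 = 9 * 2: the 9 squares the factor 3 of \<open>bsum_move\<close>, the 2 is
      lost in rounding N down to an integer.\<close>
    define \<epsilon> where "\<epsilon> i = 18 * C\<^sup>2 / c0 * ((1 + real i) ^ 4 * exp (- (\<rho> - 2 * c) * i))" for i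
    \<comment> \<open>The lower bound 2 ensures that N is positive and at least half of the
      unrounded value.\<close>
    have step: "measure \<sigma> A \<le> 48 * (\<epsilon> i + dsq f h)" if i: "2 \<le> c0 * exp (\<rho> * i)" for i
    proof -
      define N where "N = nat \<lfloor>c0 * exp (\<rho> * i)\<rfloor>"
      have N1: "real N \<le> c0 * exp (\<rho> * i)" "c0 * exp (\<rho> * i) - 1 < N"
        unfolding N_def using i by linarith+
      then have N: "N > 0" "c0 / 2 * exp (\<rho> * i) \<le> N" using i by auto
      have \<Theta>_eq: "exp (\<rho> * i) = \<Theta> ^ (K * i)"
      proof -
        have "exp (\<rho> * i) = exp (real (K * i) * ln \<Theta>)" by (simp add: \<rho>_def mult_ac)
        also have "\<dots> = \<Theta> ^ (K * i)" unfolding exp_of_nat_mult using \<Theta>(1) by simp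
        finally show ?thesis .
      qed
      have N_len: "N \<le> length (sw (K * i) b)" if "b < d" for b
        using N1(1) \<Theta>(3)[OF that, of "K * i"] unfolding \<Theta>_eq by linarith
      have R0: "R i \<ge> 0" using C by (simp add: R_def)
      have \<epsilon>: "(3 * R i)\<^sup>2 \<le> \<epsilon> i * N"
      proof -
        have "(3 * R i)\<^sup>2 = 9 * C\<^sup>2 * ((1 + real i) ^ 4 * exp (2 * c * i))"
          by (simp add: R_def power_mult_distrib exp_double[symmetric] mult.assoc flip: power_mult)
        also have "exp (2 * c * i) = exp (- (\<rho> - 2 * c) * i) * exp (\<rho> * i)"
          by (simp add: exp_add[symmetric] algebra_simps)
        also have "9 * C\<^sup>2 * ((1 + real i) ^ 4 * (exp (- (\<rho> - 2 * c) * i) * exp (\<rho> * i)))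
           = \<epsilon> i * (c0 / 2 * exp (\<rho> * i))"
          using \<Theta>(2) by (simp add: \<epsilon>_def)
        also have "\<dots> \<le> \<epsilon> i * N"
          using N(2) \<Theta>(2) by (intro mult_left_mono) (auto simp: \<epsilon>_def)
        finally show ?thesis .
      qed
      show ?thesis
      proof (rule spectral_measure_le[OF f h' \<sigma> N(1)])
        show "A \<in> sets borel" unfolding A_def by (rule good_borel)
        show "A \<subseteq> {0..<1}" by (auto simp: A_def good_def)
        show "\<epsilon> i \<ge> 0" using \<Theta>(2) by (simp add: \<epsilon>_def)
        fix t t0 assume t0: "t0 \<in> A" and t: "\<bar>t - t0\<bar> \<le> 1 / (6 * real N)"
        have "AE x in \<mu>. cmod (bsum h N t x) \<le> 3 * R i"
          using supp
        proof eventually_elim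
          case (elim x)
          \<comment> \<open>All partial sums up to N are bounded, as the summation by parts in
            \<open>bsum_move\<close> demands.\<close>
          have "cmod (bsum h n t0 x) \<le> R i" if "n \<le> N" for n
            unfolding R_def using t0 elim N_len that unfolding A_def by (intro C(2)) (auto intro: order_trans)
          then show ?case using t N(1) by (rule bsum_move)
        qed
        then have "bnorm h N t \<le> (3 * R i)\<^sup>2" using R0 by (intro bnorm_le h') auto
        then show "bnorm h N t \<le> \<epsilon> i * N" using \<epsilon> by simp
      qed
    qed
    have "(\<lambda>i. 18 * C\<^sup>2 / c0 * ((1 + real i) ^ 4 * exp (- (\<rho> - 2 * c) * real i))) \<longlonglongrightarrow> 18 * C\<^sup>2 / c0 * 0"
      using c by (intro tendsto_mult tendsto_const poly_exp_tendsto_0) (simp add: \<rho>_def)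
    then have "\<epsilon> \<longlonglongrightarrow> 0" by (simp add: \<epsilon>_def[abs_def])
    then have "(\<lambda>i. 48 * (\<epsilon> i + dsq f h)) \<longlonglongrightarrow> 48 * (0 + dsq f h)"
      by (intro tendsto_mult tendsto_add tendsto_const)
    moreover have "\<forall>\<^sub>F i in sequentially. measure \<sigma> A \<le> 48 * (\<epsilon> i + dsq f h)"
    proof -
      have "\<rho> > 0" using c by (simp add: \<rho>_def)
      then have "filterlim (\<lambda>i. c0 * exp (\<rho> * real i)) at_top sequentially"
        using \<Theta>(2) by real_asymp
      then have "\<forall>\<^sub>F i in sequentially. 2 \<le> c0 * exp (\<rho> * real i)" by (simp add: filterlim_at_top)
      then show ?thesis by eventually_elim (rule step)
    qed
    ultimately have "measure \<sigma> A \<le> 48 * (0 + dsq f h)"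
      by (intro tendsto_lowerbound) auto
    then show ?thesis by simp
  qed
  have "measure \<sigma> A \<le> e" if "e > 0" for e
  proof -
    have "e / 48 > 0" using that by simp
    then obtain h where h: "cyl_fun h" "dsq f h < e / 48"
      using sqint_approximable[OF f] unfolding approximable_def by blast
    then show ?thesis using le_h[OF h(1)] by simp
  qed
  then have "measure \<sigma> A \<le> 0" by (rule field_le_epsilon[of _ 0, simplified])
  then show ?thesis unfolding A_def by (simp add: measure_le_0_iff)
qed

text \<open>c is placed strictly between the mean of \<open>gfun K\<close> and K ln(\<Theta>)/2: the
  first inequality makes almost every frequency good, the second makes the good frequencies a null
  set of every spectral measure.\<close>

theorem singular_spectrum:
  assumes irr: "irreducible (char_poly (map_mat rat_of_int (subst_matrix d \<zeta>)))"
    and lyap: "top_lyapunov_is d \<zeta> lyap" "lyap < ln (PF_eigenvalue d \<zeta>) / 2"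
  shows "pure_singular_spectrum \<mu>"
  unfolding pure_singular_spectrum_def
proof (intro allI impI)
  fix f assume "f \<in> borel_measurable \<mu> \<and> integrable \<mu> (\<lambda>x. (cmod (f x))\<^sup>2)"
  then have f: "sqint \<mu> f" by (simp add: sqint_def)
  obtain \<Theta> c0 where \<Theta>: "\<Theta> > 1" "c0 > 0" "lyap < ln \<Theta> / 2"
    "\<And>n b. b < d \<Longrightarrow> c0 * \<Theta> ^ n \<le> length (sw n b)"
    by (rule growth_rate[OF lyap(2)]) blast
  have "ln \<Theta> / 2 > 0" using \<Theta>(1) by simp
  from integral_gfun_less[OF lyap(1) \<Theta>(3) this] obtain K where K: "K \<ge> prim_exp"
    "(\<integral>\<xi>. cube_ind d \<xi> * gfun K \<xi> \<partial>leb d) < K * (ln \<Theta> / 2)" by blast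
  then obtain c where c: "(\<integral>\<xi>. cube_ind d \<xi> * gfun K \<xi> \<partial>leb d) < c" "c < K * (ln \<Theta> / 2)"
    using dense by blast
  have "(\<integral>\<xi>. cube_ind d \<xi> * gfun K \<xi> \<partial>leb d) \<ge> 0"
    using cube_ind_nonneg gfun_nonneg by (intro integral_nonneg_AE) auto
  then have c0: "c \<ge> 0" "2 * c < K * ln \<Theta>" using c by auto
  obtain \<sigma> where \<sigma>: "is_spectral_measure \<mu> f \<sigma>" using spectral_measure_exists[OF f] by blast
  interpret \<sigma>: finite_measure \<sigma> using \<sigma> by (simp add: is_spectral_measure_def)
  have \<sigma>_sets: "sets \<sigma> = sets borel" using \<sigma> by (simp add: is_spectral_measure_def)
  have "good K c N0 \<in> null_sets \<sigma>" for N0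
    using spectral_measure_good[OF f \<sigma> \<Theta>(1,2,4) c0, of N0] good_borel \<sigma>_sets
    by (intro null_setsI) (auto simp: \<sigma>.emeasure_eq_measure)
  then have U: "(\<Union>N0. good K c N0) \<in> null_sets \<sigma>" by (rule null_sets_UN)
  have out: "UNIV - {0..<1} \<in> null_sets \<sigma>"
    using \<sigma> by (intro null_setsI) (auto simp: is_spectral_measure_def)
  \<comment> \<open>The Lebesgue-null set that carries \<sigma>: it consists of exceptional
    frequencies of the orbit average, a condition in which f does not occur.\<close>
  obtain N where N: "{t \<in> space lborel. \<not> (t \<in> {0..1} \<longrightarrow> (\<exists>N0. \<forall>N\<ge>N0. gsum K t N \<le> c * N))} \<subseteq> N"
    "emeasure lborel N = 0" "N \<in> sets lborel"
    using gfun_orbit_average[OF irr K(1) c(1)] by (rule AE_E)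
  have "UNIV - N \<subseteq> (UNIV - {0..<1}) \<union> (\<Union>N0. good K c N0)"
  proof
    fix t assume "t \<in> UNIV - N"
    then have "t \<in> {0..1} \<longrightarrow> (\<exists>N0. \<forall>N\<ge>N0. gsum K t N \<le> c * N)" using N(1) by auto
    then show "t \<in> (UNIV - {0..<1}) \<union> (\<Union>N0. good K c N0)" by (auto simp: good_def)
  qed
  moreover have "UNIV - N \<in> sets \<sigma>" using N(3) \<sigma>_sets by auto
  ultimately have "UNIV - N \<in> null_sets \<sigma>"
    using null_sets_subset[OF null_sets.Un[OF out U]] by blast
  then have "singular_lebesgue \<sigma>"
    unfolding singular_lebesgue_def using N by (intro bexI[of _ N]) auto
  then show "\<exists>\<sigma>. is_spectral_measure \<mu> f \<sigma> \<and> singular_lebesgue \<sigma>" using \<sigma> by blast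
qed

end

text \<open>\<open>\<mu>\<close> is any invariant probability measure carried by the subshift; by
  unique ergodicity of primitive substitutions it is the measure meant in the English
  statement.\<close>

theorem theorem2p4:
  fixes d :: nat and \<zeta> :: "nat \<Rightarrow> nat list" and lyap :: real
    and \<mu> :: "(int \<Rightarrow> nat) measure"
  assumes "d \<ge> 2"
    and "is_substitution d \<zeta>"
    and "primitive_subst d \<zeta>"
    and "infinite (subst_space d \<zeta>)"
    and "det (subst_matrix d \<zeta>) \<noteq> 0"
    and "irreducible (char_poly (map_mat rat_of_int (subst_matrix d \<zeta>)))"
    and "top_lyapunov_is d \<zeta> lyap"
    and "lyap < ln (PF_eigenvalue d \<zeta>) / 2"
    and "prob_space \<mu>" and "sets \<mu> = sets seq_space"
    and "AE x in \<mu>. x \<in> subst_space d \<zeta>"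
    and "\<And>n. distr \<mu> \<mu> (shift_pow n) = \<mu>"
  shows "pure_singular_spectrum \<mu>"
proof -
  interpret prob_space \<mu> by fact
  interpret substitution_system d \<zeta> \<mu>
    by unfold_locales fact+
  show ?thesis by (rule singular_spectrum) fact+
qed

end
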